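(* $\mathrm{LTL}^\mu+\mathcal{W}=\mathrm{FO}$ over both finite nested words and nested $\omega$-words: every $\mathrm{LTL}^\mu+\mathcal{W}$ formula $\phi$ has a first-order formula $\phi'(x)$ with $(\bar w,i)\models\phi$ iff $\bar w\models\phi'(i)$ for all nested words $\bar w$ and positions $i$, and every first-order formula $\psi(x)$ with one free variable has an $\mathrm{LTL}^\mu+\mathcal{W}$ formula $\psi'$ with $\bar w\models\psi(i)$ iff $(\bar w,i)\models\psi'$.
   Context: Let $\Sigma$ be a finite alphabet. A matching on $\mathbb{N}$ or on $[1,n]$ is a binary relation $\mu$ with unary relations $\mathit{call},\mathit{ret}$ such that: (1) $\mu(i,j)$ implies $\mathit{call}(i)$, $\mathit{ret}(j)$, $i<j$; (2) if $\mu(i,j),\mu(i,j')$ then $j=j'$, and if $\mu(i,j),\mu(i',j)$ then $i=i'$; (3) if $i\le j$, $\mathit{call}(i)$, $\mathit{ret}(j)$ then some $k\in[i,j]$ has $\mu(i,k)$ or $\mu(k,j)$. A finite nested word is $\bar w=(w,\mu,\mathit{call},\mathit{ret})$ with $w\in\Sigma^*$ of length $n$ and a matching on $[1,n]$; a nested $\omega$-word has $w\in\Sigma^\omega$ and a matching on $\mathbb{N}$; viewed as structures $\langle U,(P_a)_{a\in\Sigma},<,\mu,\mathit{call},\mathit{ret}\rangle$ for FO. If $\mu(i,j)$, $i$ is a matched call, $j$ a matched return, $r(i)=j$; calls without match are unmatched. $\mathcal{C}(i)$ is the greatest matched call $j<i$ with $r(j)>i$ (if any). For positions $i\le j$, $\bar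 w[i,j]$ is the substructure induced by positions $i,\dots,j$ (a finite nested word), and $\bar w[i,\infty]$ the one induced by positions $\ge i$. Paths $i=i_0<\dots<i_k=j$: linear if $i_{p+1}=i_p+1$; call if $i_p=\mathcal{C}(i_{p+1})$ for all $p$; abstract if for all $p<k$, $i_{p+1}=r(i_p)$ when $i_p$ is a matched call, and $i_{p+1}=i_p+1$ when $i_p$ is not a call and $i_p+1$ is not a matched return (no other steps). For a path notion, until $\phi\,\mathbf{U}\psi$ holds at $i$ iff there is $j\ge i$ and such a path $i=i_0<\dots<i_k=j$ with $\psi$ at $j$ and $\phi$ at all $i_p$, $p<k$; since holds at $i$ iff there is $j\le i$ and such a path $j=i_0<\dots<i_k=i$ with $\psi$ at $j$ and $\phi$ at $i_p$, $0<p\le k$. $\mathrm{LTL}^\mu$ formulas: $\top$, $a\in\Sigma$, $\mathit{call}$, $\mathit{ret}$, closed under $\neg$, $\vee$, $\bigcirc$ (truth at $i+1$), $\bigcirc_\mu$ (truth at $r(i)$, $i$ a matched call), $\ominus$ (truth at $i-1$, $i>1$), $\ominus_\mu$ (truth at $j$ with $\mu(j,i)$), and the until/since operators $\mathbf{U},\mathbf{S}$ (linear paths), $\mathbf{U}^c,\mathbf{S}^c$ (call paths), $\mathbf{U}^a,\mathbf{S}^a$ (abstract paths). $\mathrm{LTL}^\mu+\mathcal{W}$ adds the within operator: $(\bar w,i)\models\mathcal{W}\phi$ iff $i$ is a call and $(\bar w[i,j],i)\models\phi$ (evaluated at the first position of the subword), where $j=r(i)$ if $i$ is a matched call, $j=|\bar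 w|$ if $i$ is unmatched and $\bar w$ finite, and $j=\infty$ otherwise. *)

theory Defs
  imports Main "HOL-Library.Extended_Nat"
begin

section \<open>Nested words\<close>

text \<open>
  A nested word is a structure over a set of positions. Nested words proper live on
  \<open>{1..n}\<close> or on \<open>{1..}\<close>; their induced substructures keep the original positions, so that
  they live on arbitrary intervals. The field \<open>lab\<close> is only meaningful on \<open>univ\<close>: the
  predicate \<open>P\<^sub>a\<close> holds at \<open>i\<close> iff \<open>lab w i = a\<close>.
\<close>

record 'a nword =
  univ :: "nat set"
  lab  :: "nat \<Rightarrow> 'a"
  mu   :: "nat \<Rightarrow> nat \<Rightarrow> bool"
  call :: "nat \<Rightarrow> bool"
  ret  :: "nat \<Rightarrow> bool"

definition matching_on ::
  "nat set \<Rightarrow> (nat \<Rightarrow> nat \<Rightarrow> bool) \<Rightarrow> (nat \<Rightarrow> bool) \<Rightarrow> (nat \<Rightarrow> bool) \<Rightarrow> bool" where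
  "matching_on U m c r \<longleftrightarrow>
     (\<forall>i. c i \<longrightarrow> i \<in> U) \<and> (\<forall>i. r i \<longrightarrow> i \<in> U) \<and>
     (\<forall>i j. m i j \<longrightarrow> c i \<and> r j \<and> i < j) \<and>
     (\<forall>i j j'. m i j \<longrightarrow> m i j' \<longrightarrow> j = j') \<and>
     (\<forall>i i' j. m i j \<longrightarrow> m i' j \<longrightarrow> i = i') \<and>
     (\<forall>i j. i \<le> j \<longrightarrow> c i \<longrightarrow> r j \<longrightarrow> (\<exists>k\<in>{i..j}. m i k \<or> m k j))"

definition finite_nested_word :: "'a nword \<Rightarrow> bool" where
  "finite_nested_word w \<longleftrightarrow>
     (\<exists>n. univ w = {1..n}) \<and> matching_on (univ w) (mu w) (call w) (ret w)"

definition nested_omega_word :: "'a nword \<Rightarrow> bool" where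
  "nested_omega_word w \<longleftrightarrow>
     univ w = {1..} \<and> matching_on (univ w) (mu w) (call w) (ret w)"

definition nested_word :: "'a nword \<Rightarrow> bool" where
  "nested_word w \<longleftrightarrow> finite_nested_word w \<or> nested_omega_word w"

definition matched_call :: "'a nword \<Rightarrow> nat \<Rightarrow> bool" where
  "matched_call w i \<longleftrightarrow> (\<exists>j. mu w i j)"

definition matched_ret :: "'a nword \<Rightarrow> nat \<Rightarrow> bool" where
  "matched_ret w j \<longleftrightarrow> (\<exists>i. mu w i j)"

text \<open>The matching return \<open>r(i)\<close>; only meaningful for matched calls \<open>i\<close>.\<close>

definition ret_of :: "'a nword \<Rightarrow> nat \<Rightarrow> nat" where
  "ret_of w i = (THE j. mu w i j)"

text \<open>\<open>enclosing_call w i j\<close> states that \<open>\<C>(i)\<close> exists and equals \<open>j\<close>.\<close>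

definition enclosing_call :: "'a nword \<Rightarrow> nat \<Rightarrow> nat \<Rightarrow> bool" where
  "enclosing_call w i j \<longleftrightarrow>
     matched_call w j \<and> j < i \<and> i < ret_of w j \<and>
     (\<forall>j'. matched_call w j' \<and> j' < i \<and> i < ret_of w j' \<longrightarrow> j' \<le> j)"

definition induced :: "'a nword \<Rightarrow> nat set \<Rightarrow> 'a nword" where
  "induced w S =
     \<lparr>univ = univ w \<inter> S, lab = lab w,
      mu = (\<lambda>i j. mu w i j \<and> i \<in> S \<and> j \<in> S),
      call = (\<lambda>i. call w i \<and> i \<in> S),
      ret = (\<lambda>i. ret w i \<and> i \<in> S)\<rparr>"

text \<open>The subword \<open>w[i,j]\<close>, where \<open>j\<close> may be \<open>\<infinity>\<close>.\<close>

definition subword :: "'a nword \<Rightarrow> nat \<Rightarrow> enat \<Rightarrow> 'a nword" where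
  "subword w i j = induced w {k. i \<le> k \<and> enat k \<le> j}"

text \<open>
  Right end of the subword used by the within operator at a call \<open>i\<close>. Positions of subwords
  are not renumbered, so the last position of a finite word is \<open>Max (univ w)\<close>; this is
  \<open>|w|\<close> when \<open>univ w = {1..n}\<close>.
\<close>

definition within_end :: "'a nword \<Rightarrow> nat \<Rightarrow> enat" where
  "within_end w i =
     (if matched_call w i then enat (ret_of w i)
      else if finite (univ w) then enat (Max (univ w))
      else \<infinity>)"


section \<open>Paths\<close>

datatype path_kind = Linear | CallPath | Abstract

fun path_step :: "'a nword \<Rightarrow> path_kind \<Rightarrow> nat \<Rightarrow> nat \<Rightarrow> bool" where
  "path_step w Linear i j \<longleftrightarrow> j = i + 1"
| "path_step w CallPath i j \<longleftrightarrow> enclosing_call w j i"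
| "path_step w Abstract i j \<longleftrightarrow>
     (matched_call w i \<and> j = ret_of w i) \<or>
     (\<not> call w i \<and> \<not> matched_ret w (i + 1) \<and> j = i + 1)"

text \<open>A path \<open>i\<^sub>0 < \<dots> < i\<^sub>k\<close> is the nonempty list of its positions; \<open>k = 0\<close> is allowed.\<close>

definition is_path :: "'a nword \<Rightarrow> path_kind \<Rightarrow> nat list \<Rightarrow> bool" where
  "is_path w K p \<longleftrightarrow>
     p \<noteq> [] \<and> set p \<subseteq> univ w \<and> sorted_wrt (<) p \<and> successively (path_step w K) p"


section \<open>The temporal logic with the within operator\<close>

text \<open>
  \<open>Until K\<close> and \<open>Since K\<close> stand for \<open>U, U\<^sup>c, U\<^sup>a\<close> and \<open>S, S\<^sup>c, S\<^sup>a\<close>, depending on the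
  path kind \<open>K\<close>.
\<close>

datatype 'a ltl =
    TT
  | Letter 'a
  | IsCall
  | IsRet
  | Not "'a ltl"
  | Or "'a ltl" "'a ltl"
  | Next "'a ltl"
  | NextMu "'a ltl"
  | Prev "'a ltl"
  | PrevMu "'a ltl"
  | Until path_kind "'a ltl" "'a ltl"
  | Since path_kind "'a ltl" "'a ltl"
  | Within "'a ltl"

primrec ltl_sat :: "'a ltl \<Rightarrow> 'a nword \<Rightarrow> nat \<Rightarrow> bool" where
  "ltl_sat TT w i \<longleftrightarrow> True"
| "ltl_sat (Letter a) w i \<longleftrightarrow> lab w i = a"
| "ltl_sat IsCall w i \<longleftrightarrow> call w i"
| "ltl_sat IsRet w i \<longleftrightarrow> ret w i"
| "ltl_sat (Not \<phi>) w i \<longleftrightarrow> \<not> ltl_sat \<phi> w i"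
| "ltl_sat (Or \<phi> \<psi>) w i \<longleftrightarrow> ltl_sat \<phi> w i \<or> ltl_sat \<psi> w i"
| "ltl_sat (Next \<phi>) w i \<longleftrightarrow> i + 1 \<in> univ w \<and> ltl_sat \<phi> w (i + 1)"
| "ltl_sat (NextMu \<phi>) w i \<longleftrightarrow> matched_call w i \<and> ltl_sat \<phi> w (ret_of w i)"
| "ltl_sat (Prev \<phi>) w i \<longleftrightarrow> (\<exists>j. i = j + 1 \<and> j \<in> univ w \<and> ltl_sat \<phi> w j)"
| "ltl_sat (PrevMu \<phi>) w i \<longleftrightarrow> (\<exists>j. mu w j i \<and> ltl_sat \<phi> w j)"
| "ltl_sat (Until K \<phi> \<psi>) w i \<longleftrightarrow>
     (\<exists>p. is_path w K p \<and> hd p = i \<and> ltl_sat \<psi> w (last p) \<and>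
          (\<forall>k\<in>set (butlast p). ltl_sat \<phi> w k))"
| "ltl_sat (Since K \<phi> \<psi>) w i \<longleftrightarrow>
     (\<exists>p. is_path w K p \<and> last p = i \<and> ltl_sat \<psi> w (hd p) \<and>
          (\<forall>k\<in>set (tl p). ltl_sat \<phi> w k))"
| "ltl_sat (Within \<phi>) w i \<longleftrightarrow>
     call w i \<and> ltl_sat \<phi> (subword w i (within_end w i)) i"


section \<open>First-order logic over nested words\<close>

datatype 'a fo =
    FEq nat nat
  | FLess nat nat
  | FLetter 'a nat
  | FMu nat nat
  | FCall nat
  | FRet nat
  | FNot "'a fo"
  | FOr "'a fo" "'a fo"
  | FEx nat "'a fo"

primrec fo_sat :: "'a fo \<Rightarrow> 'a nword \<Rightarrow> (nat \<Rightarrow> nat) \<Rightarrow> bool" where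
  "fo_sat (FEq x y) w \<sigma> \<longleftrightarrow> \<sigma> x = \<sigma> y"
| "fo_sat (FLess x y) w \<sigma> \<longleftrightarrow> \<sigma> x < \<sigma> y"
| "fo_sat (FLetter a x) w \<sigma> \<longleftrightarrow> lab w (\<sigma> x) = a"
| "fo_sat (FMu x y) w \<sigma> \<longleftrightarrow> mu w (\<sigma> x) (\<sigma> y)"
| "fo_sat (FCall x) w \<sigma> \<longleftrightarrow> call w (\<sigma> x)"
| "fo_sat (FRet x) w \<sigma> \<longleftrightarrow> ret w (\<sigma> x)"
| "fo_sat (FNot \<phi>) w \<sigma> \<longleftrightarrow> \<not> fo_sat \<phi> w \<sigma>"
| "fo_sat (FOr \<phi> \<psi>) w \<sigma> \<longleftrightarrow> fo_sat \<phi> w \<sigma> \<or> fo_sat \<psi> w \<sigma>"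
| "fo_sat (FEx x \<phi>) w \<sigma> \<longleftrightarrow> (\<exists>i\<in>univ w. fo_sat \<phi> w (\<sigma>(x := i)))"

primrec fo_fv :: "'a fo \<Rightarrow> nat set" where
  "fo_fv (FEq x y) = {x, y}"
| "fo_fv (FLess x y) = {x, y}"
| "fo_fv (FLetter a x) = {x}"
| "fo_fv (FMu x y) = {x, y}"
| "fo_fv (FCall x) = {x}"
| "fo_fv (FRet x) = {x}"
| "fo_fv (FNot \<phi>) = fo_fv \<phi>"
| "fo_fv (FOr \<phi> \<psi>) = fo_fv \<phi> \<union> fo_fv \<psi>"
| "fo_fv (FEx x \<phi>) = fo_fv \<phi> - {x}"

end

theory Submission
  imports Defs "HOL-Library.FSet"
begin

text \<open>
  From first-order logic to the temporal logic, the proof goes by induction on the quantifier rank,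
  with finitely many rank-\<open>k\<close> types in place of formulas. If the rank-\<open>k\<close> type of a word with one
  marked position is definable, then so is the rank-\<open>(k + 1)\<close> type of the bare word, and \<open>Within\<close>
  makes the rank-\<open>(k + 1)\<close> type of the block from a matched call to its return definable at the call.
  The type of a word with a marked position \<open>i\<close> is a product in the monoid of types, taken along the
  chain of calls enclosing \<open>i\<close>; the factors are in turn products of block types along sequences of
  siblings. The monoid is aperiodic, and by the local divisor technique of Diekert and Gastin
  products in an aperiodic monoid along a path are expressible by next and until on that path.

  In the other direction only the reachability relations of the three kinds of paths have to be
  defined in first-order logic: on a path with unique predecessors, the positions visited between
  \<open>i\<close> and \<open>j\<close> are those that are reachable from \<open>i\<close> and from which \<open>j\<close> is reachable.
\<close>


section \<open>Local divisors: definability of products in aperiodic monoids\<close>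

text \<open>A position does not cut its word into a left and a right part but into layers: the
  siblings around it, the enclosing pair, the siblings around that pair, and so on. Each layer lies
  on both sides of the next one. Types therefore record on which side every mark lies, so that one
  associative product describes factors that surround each other, and this product remains
  aperiodic. A second obstacle is that an abstract path stops at an unmatched call, whereas the
  sequence of siblings has to pass it. Inside a matched pair every call is matched, so there the
  siblings form an abstract path. At the top level they are the top positions in their order, a
  subsequence of the linear path; closure under next and until passes from a path to such a
  subsequence. The same passage drives the local divisor argument, where the subsequence consists of
  the points with a given label. Definability is always uniform over all intervals of positions,
  since \<open>Within\<close> evaluates its argument in a subword that keeps its positions.\<close>

inductive untilp :: "('p \<Rightarrow> 'p option) \<Rightarrow> ('p \<Rightarrow> bool) \<Rightarrow> ('p \<Rightarrow> bool) \<Rightarrow> 'p \<Rightarrow> bool"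
  for s P Q where
  untilp_now: "Q p \<Longrightarrow> untilp s P Q p"
| untilp_step: "P p \<Longrightarrow> s p = Some q \<Longrightarrow> untilp s P Q q \<Longrightarrow> untilp s P Q p"

definition nextp :: "('p \<Rightarrow> 'p option) \<Rightarrow> ('p \<Rightarrow> bool) \<Rightarrow> 'p \<Rightarrow> bool" where
  "nextp s P p \<longleftrightarrow> (\<exists>q. s p = Some q \<and> P q)"

text \<open>\<open>F\<close> is a Boolean algebra of properties of points that admits next and until
  along \<open>s\<close>. The local divisor argument uses only these closure properties and never
  mentions formulas, so it applies to every path for which they can be shown.\<close>

definition closed :: "('p \<Rightarrow> bool) set \<Rightarrow> ('p \<Rightarrow> 'p option) \<Rightarrow> bool" where
  "closed F s \<longleftrightarrow> (\<lambda>_. True) \<in> F \<and> (\<forall>P\<in>F. (\<lambda>p. \<not> P p) \<in> F) \<and>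
     (\<forall>P\<in>F. \<forall>Q\<in>F. (\<lambda>p. P p \<or> Q p) \<in> F) \<and>
     (\<forall>P\<in>F. nextp s P \<in> F) \<and> (\<forall>P\<in>F. \<forall>Q\<in>F. untilp s P Q \<in> F)"

lemma closed_True: "closed F s \<Longrightarrow> (\<lambda>_. True) \<in> F"
  and closed_Not: "closed F s \<Longrightarrow> P \<in> F \<Longrightarrow> (\<lambda>p. \<not> P p) \<in> F"
  and closed_disj: "closed F s \<Longrightarrow> P \<in> F \<Longrightarrow> Q \<in> F \<Longrightarrow> (\<lambda>p. P p \<or> Q p) \<in> F"
  and closed_nextp: "closed F s \<Longrightarrow> P \<in> F \<Longrightarrow> nextp s P \<in> F"
  and closed_untilp: "closed F s \<Longrightarrow> P \<in> F \<Longrightarrow> Q \<in> F \<Longrightarrow> untilp s P Q \<in> F"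
  by (auto simp: closed_def)

lemma closed_False: "closed F s \<Longrightarrow> (\<lambda>_. False) \<in> F"
  using closed_Not[OF _ closed_True] by force

lemma closed_conj:
  assumes F: "closed F s" and P: "P \<in> F" and Q: "Q \<in> F"
  shows "(\<lambda>p. P p \<and> Q p) \<in> F"
  using closed_Not[OF F closed_disj[OF F closed_Not[OF F P] closed_Not[OF F Q]]] by simp

lemma closed_imp:
  assumes F: "closed F s" and P: "P \<in> F" and Q: "Q \<in> F"
  shows "(\<lambda>p. P p \<longrightarrow> Q p) \<in> F"
  unfolding imp_conv_disj by (rule closed_disj[OF F closed_Not[OF F P] Q])

lemma closed_Bex:
  assumes "closed F s" "finite I" "\<And>i. i \<in> I \<Longrightarrow> P i \<in> F"
  shows "(\<lambda>p. \<exists>i\<in>I. P i p) \<in> F"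
  using assms(2,3)
proof (induction I rule: finite_induct)
  case empty
  then show ?case using closed_False[OF assms(1)] by simp
next
  case (insert x I)
  then show ?case using closed_disj[OF assms(1), of "P x" "\<lambda>p. \<exists>i\<in>I. P i p"] by simp
qed

section \<open>First visits to a set of points, and the path formed by them\<close>

inductive hit :: "('p \<Rightarrow> 'p option) \<Rightarrow> ('p \<Rightarrow> bool) \<Rightarrow> 'p \<Rightarrow> 'p \<Rightarrow> bool" for s C where
  hit_here: "C p \<Longrightarrow> hit s C p p"
| hit_step: "\<not> C p \<Longrightarrow> s p = Some q \<Longrightarrow> hit s C q r \<Longrightarrow> hit s C p r"

lemma hit_unique: "hit s C p q \<Longrightarrow> hit s C p r \<Longrightarrow> q = r"
proof (induction arbitrary: r rule: hit.induct)
  case (hit_here p)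
  then show ?case by (auto elim: hit.cases)
next
  case (hit_step p q r')
  from hit_step.prems hit_step.hyps show ?case
    by (cases rule: hit.cases) (auto dest: hit_step.IH)
qed

lemma hit_C: "hit s C p q \<Longrightarrow> C q"
  by (induction rule: hit.induct)

definition next_hit :: "('p \<Rightarrow> 'p option) \<Rightarrow> ('p \<Rightarrow> bool) \<Rightarrow> 'p \<Rightarrow> 'p option" where
  "next_hit s C p = (if \<exists>r. nextp s (\<lambda>q. hit s C q r) p then Some (THE r. nextp s (\<lambda>q. hit s C q r) p) else None)"

lemma next_hit_Some: "next_hit s C p = Some r \<longleftrightarrow> (\<exists>q. s p = Some q \<and> hit s C q r)"
proof -
  have "nextp s (\<lambda>q. hit s C q r) p \<Longrightarrow> nextp s (\<lambda>q. hit s C q r') p \<Longrightarrow> r = r'" for r r'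
    by (auto simp: nextp_def intro: hit_unique)
  hence "next_hit s C p = Some r \<longleftrightarrow> nextp s (\<lambda>q. hit s C q r) p"
    unfolding next_hit_def using theI[of "\<lambda>r. nextp s (\<lambda>q. hit s C q r) p"] by (auto simp: the_equality)
  thus ?thesis by (simp add: nextp_def)
qed

lemma untilp_hit: "untilp s (\<lambda>p. \<not> C p) (\<lambda>p. C p \<and> P p) p \<longleftrightarrow> (\<exists>r. hit s C p r \<and> P r)"
proof
  assume "untilp s (\<lambda>p. \<not> C p) (\<lambda>p. C p \<and> P p) p"
  thus "\<exists>r. hit s C p r \<and> P r"
    by induction (auto intro: hit.intros)
next
  assume "\<exists>r. hit s C p r \<and> P r"
  then obtain r where "hit s C p r" "P r" by blast
  thus "untilp s (\<lambda>p. \<not> C p) (\<lambda>p. C p \<and> P p) p"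
    by induction (auto intro: untilp.intros)
qed

lemma nextp_next_hit: "nextp (next_hit s C) P = nextp s (untilp s (\<lambda>p. \<not> C p) (\<lambda>p. C p \<and> P p))"
  by (rule ext) (auto simp: nextp_def next_hit_Some untilp_hit)

text \<open>Points between two visits to \<open>C\<close> satisfy
  \<open>C p \<longrightarrow> P p\<close> vacuously, so an until on the original path simulates one
  on the sparse path. The starting point is treated apart because it need not lie in
  \<open>C\<close>, while every later point of the sparse path does.\<close>

lemma untilp_next_hit:
  "untilp (next_hit s C) P Q = (\<lambda>p. Q p \<or> P p \<and> nextp s (untilp s (\<lambda>p. C p \<longrightarrow> P p) (\<lambda>p. C p \<and> Q p)) p)"
proof (rule ext)
  fix p
  let ?U = "untilp s (\<lambda>p. C p \<longrightarrow> P p) (\<lambda>p. C p \<and> Q p)"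
  have hU: "hit s C p r \<Longrightarrow> ?U r \<Longrightarrow> ?U p" for p r
    by (induction rule: hit.induct) (auto intro: untilp_step)
  have Uh: "?U p \<Longrightarrow> \<exists>r. hit s C p r \<and> untilp (next_hit s C) P Q r" for p
  proof (induction rule: untilp.induct)
    case (untilp_now p)
    then show ?case by (auto intro: hit_here untilp.untilp_now)
  next
    case (untilp_step p q)
    then obtain r where r: "hit s C q r" "untilp (next_hit s C) P Q r" by blast
    show ?case
    proof (cases "C p")
      case True
      have "next_hit s C p = Some r" using untilp_step.hyps(2) r(1) by (auto simp: next_hit_Some)
      thus ?thesis using True untilp_step.hyps(1) r(2) by (meson hit_here untilp.untilp_step)
    next
      case False
      thus ?thesis using r untilp_step.hyps(2) by (meson hit_step)
    qed
  qed
  show "untilp (next_hit s C) P Q p = (Q p \<or> P p \<and> nextp s ?U p)"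
  proof
    assume "untilp (next_hit s C) P Q p"
    thus "Q p \<or> P p \<and> nextp s ?U p"
    proof induction
      case (untilp_step p q)
      then obtain p' where p': "s p = Some p'" "hit s C p' q" by (auto simp: next_hit_Some)
      have "C q" using p'(2) by (rule hit_C)
      have "?U q"
        using untilp_step.IH \<open>C q\<close> by (auto simp: nextp_def intro: untilp_now untilp.untilp_step)
      thus ?case using untilp_step p' hU by (auto simp: nextp_def)
    qed auto
  next
    assume "Q p \<or> P p \<and> nextp s ?U p"
    thus "untilp (next_hit s C) P Q p"
    proof
      assume "P p \<and> nextp s ?U p"
      then obtain q where "P p" "s p = Some q" "?U q" by (auto simp: nextp_def)
      moreover then obtain r where "hit s C q r" "untilp (next_hit s C) P Q r" using Uh by blast
      moreover from calculation have "next_hit s C p = Some r" by (auto simp: next_hit_Some)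
      ultimately show ?thesis by (rule_tac untilp_step)
    qed (rule untilp_now)
  qed
qed

text \<open>This lets the induction on the monoid replace the path by a sparser one while the family
  \<open>F\<close> stays the same.\<close>

lemma closed_next_hit:
  assumes F: "closed F s" and C: "C \<in> F"
  shows "closed F (next_hit s C)"
  unfolding closed_def nextp_next_hit untilp_next_hit
proof (intro conjI ballI)
  fix P Q assume "P \<in> F" "Q \<in> F"
  thus "(\<lambda>p. Q p \<or> P p \<and> nextp s (untilp s (\<lambda>p. C p \<longrightarrow> P p) (\<lambda>p. C p \<and> Q p)) p) \<in> F"
    by (intro closed_disj[OF F] closed_conj[OF F] closed_nextp[OF F] closed_untilp[OF F] closed_imp[OF F] C)
next
  fix P assume "P \<in> F"
  thus "nextp s (untilp s (\<lambda>p. \<not> C p) (\<lambda>p. C p \<and> P p)) \<in> F"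
    by (intro closed_conj[OF F] closed_nextp[OF F] closed_untilp[OF F] closed_Not[OF F] C)
qed (use closed_True[OF F] closed_Not[OF F] closed_disj[OF F] in auto)

section \<open>Products of labels along walks\<close>

inductive walk :: "('p \<Rightarrow> 'p option) \<Rightarrow> ('p \<Rightarrow> 'm) \<Rightarrow> 'm set \<Rightarrow> 'p \<Rightarrow> 'm list \<Rightarrow> 'p \<Rightarrow> bool"
  for s lb A where
  walk_Nil: "walk s lb A p [] p"
| walk_Cons: "lb p \<in> A \<Longrightarrow> s p = Some q \<Longrightarrow> walk s lb A q xs r \<Longrightarrow> walk s lb A p (lb p # xs) r"

lemma walk_set: "walk s lb A p xs q \<Longrightarrow> set xs \<subseteq> A"
  by (induction rule: walk.induct) auto

lemma walk_mono: "walk s lb B p xs q \<Longrightarrow> B \<subseteq> A \<Longrightarrow> walk s lb A p xs q"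
  by (induction rule: walk.induct) (auto intro: walk.intros)

lemma walk_append: "walk s lb A p xs q \<Longrightarrow> walk s lb A q ys r \<Longrightarrow> walk s lb A p (xs @ ys) r"
  by (induction rule: walk.induct) (auto intro: walk.intros)

lemma walk_hit: "walk s lb (A - {c}) p xs q \<Longrightarrow> lb q = c \<Longrightarrow> hit s (\<lambda>p. lb p = c) p q"
  by (induction rule: walk.induct) (auto intro: hit.intros)

text \<open>No label before the end point is \<open>c\<close>, so the end point is the first point
  labelled \<open>c\<close>, and a partial function admits only one walk to it. Hence the segment
  between consecutive visits to \<open>c\<close> is a function of its left end.\<close>

lemma walk_unique:
  "walk s lb (A - {c}) p xs q \<Longrightarrow> lb q = c \<Longrightarrow> walk s lb (A - {c}) p ys r \<Longrightarrow> lb r = c \<Longrightarrow> xs = ys \<and> q = r"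
proof (induction arbitrary: ys rule: walk.induct)
  case (walk_Nil p)
  from walk_Nil.prems(2,1) show ?case by cases auto
next
  case (walk_Cons p q xs r')
  from walk_Cons.prems(2) show ?case
  proof cases
    case walk_Nil
    then show ?thesis using walk_Cons by auto
  next
    case (walk_Cons q' zs)
    then show ?thesis using walk_Cons.IH walk_Cons.prems walk_Cons.hyps by auto
  qed
qed

text \<open>A walk stops before reading the label of its end point. Thus \<open>Q\<close> can be
  tested there, and walks can be concatenated without counting a label twice.\<close>

definition reach ::
  "('p \<Rightarrow> 'p option) \<Rightarrow> ('p \<Rightarrow> 'm) \<Rightarrow> 'm set \<Rightarrow> ('m \<Rightarrow> 'm \<Rightarrow> 'm) \<Rightarrow> 'm \<Rightarrow> 'm \<Rightarrow> ('p \<Rightarrow> bool) \<Rightarrow> 'p \<Rightarrow> bool" where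
  "reach s lb A f e m Q p \<longleftrightarrow> (\<exists>xs q. walk s lb A p xs q \<and> foldr f xs e = m \<and> Q q)"

section \<open>Finite aperiodic monoids and local divisors\<close>

fun power_in :: "('m \<Rightarrow> 'm \<Rightarrow> 'm) \<Rightarrow> 'm \<Rightarrow> 'm \<Rightarrow> nat \<Rightarrow> 'm" where
  "power_in f e x 0 = e"
| "power_in f e x (Suc n) = f x (power_in f e x n)"

definition aperiodic_monoid :: "'m set \<Rightarrow> ('m \<Rightarrow> 'm \<Rightarrow> 'm) \<Rightarrow> 'm \<Rightarrow> bool" where
  "aperiodic_monoid M f e \<longleftrightarrow> finite M \<and> e \<in> M \<and> (\<forall>x\<in>M. \<forall>y\<in>M. f x y \<in> M) \<and>
     (\<forall>x\<in>M. \<forall>y\<in>M. \<forall>z\<in>M. f (f x y) z = f x (f y z)) \<and>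
     (\<forall>x\<in>M. f e x = x \<and> f x e = x) \<and>
     (\<forall>x\<in>M. \<exists>n. power_in f e x (Suc n) = power_in f e x n)"

lemma apmonD:
  assumes "aperiodic_monoid M f e"
  shows "finite M" "e \<in> M" "x \<in> M \<Longrightarrow> y \<in> M \<Longrightarrow> f x y \<in> M"
    "x \<in> M \<Longrightarrow> y \<in> M \<Longrightarrow> z \<in> M \<Longrightarrow> f (f x y) z = f x (f y z)"
    "x \<in> M \<Longrightarrow> f e x = x" "x \<in> M \<Longrightarrow> f x e = x"
    "x \<in> M \<Longrightarrow> \<exists>n. power_in f e x (Suc n) = power_in f e x n"
  using assms by (simp_all add: aperiodic_monoid_def)

lemma power_in_in: "aperiodic_monoid M f e \<Longrightarrow> x \<in> M \<Longrightarrow> power_in f e x n \<in> M"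
  by (induction n) (auto simp: apmonD)

lemma power_in_comm: "aperiodic_monoid M f e \<Longrightarrow> x \<in> M \<Longrightarrow> f (power_in f e x n) x = f x (power_in f e x n)"
  by (induction n) (auto simp: apmonD power_in_in)

lemma foldr_in: "aperiodic_monoid M f e \<Longrightarrow> set xs \<subseteq> M \<Longrightarrow> z \<in> M \<Longrightarrow> foldr f xs z \<in> M"
  by (induction xs) (auto simp: apmonD)

lemma foldr_mult:
  "aperiodic_monoid M f e \<Longrightarrow> set xs \<subseteq> M \<Longrightarrow> z \<in> M \<Longrightarrow> foldr f xs z = f (foldr f xs e) z"
  by (induction xs) (auto simp: apmonD foldr_in)

text \<open>Needed for paths that run leftwards or outwards: there the factors met later on the path
  stand further left in the product.\<close>

lemma aperiodic_monoid_opp: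
  assumes "aperiodic_monoid M f e"
  shows "aperiodic_monoid M (\<lambda>x y. f y x) e"
proof -
  have "power_in (\<lambda>x y. f y x) e x n = power_in f e x n" if "x \<in> M" for x n
    by (induction n) (use assms that power_in_comm in auto)
  thus ?thesis using assms power_in_comm[OF assms] by (simp add: aperiodic_monoid_def)
qed

text \<open>An aperiodic monoid has no units besides its identity, so the local divisor at \<open>c \<noteq> e\<close> is smaller.\<close>

lemma aperiodic_monoid_unit:
  assumes M: "aperiodic_monoid M f e" and "c \<in> M" "n \<in> M" "f c n = e"
  shows "c = e"
proof -
  \<comment> \<open>Cancelling the innermost factor \<open>c n\<close> repeatedly reduces
    \<open>c^k n^k\<close> to \<open>e\<close>. With \<open>c^(k+1) = c^k\<close> the same product
    equals \<open>c\<close>.\<close>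
  have inv: "f (power_in f e c k) (power_in f e n k) = e" for k
  proof (induction k)
    case (Suc k)
    have "f (power_in f e c (Suc k)) (power_in f e n (Suc k)) = f (f (power_in f e c k) c) (f n (power_in f e n k))"
      using power_in_comm[OF M \<open>c \<in> M\<close>] by simp
    also have "\<dots> = f (power_in f e c k) (f (f c n) (power_in f e n k))"
      using assms(2,3) power_in_in[OF M] apmonD(3,4)[OF M] by simp
    also have "\<dots> = e" using assms(3,4) Suc power_in_in[OF M] apmonD(5)[OF M] by simp
    finally show ?case .
  qed (use M in \<open>simp add: apmonD\<close>)
  obtain k where k: "power_in f e c (Suc k) = power_in f e c k" using apmonD(7)[OF M \<open>c \<in> M\<close>] by blast
  have "e = f (power_in f e c (Suc k)) (power_in f e n k)" using inv[of k] k by simp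
  also have "\<dots> = f c e" using assms power_in_in[OF M] inv[of k] by (simp add: apmonD)
  also have "\<dots> = c" using assms by (simp add: apmonD)
  finally show ?thesis by simp
qed

text \<open>
  The local divisor at \<open>c\<close> is \<open>M c \<inter> c M\<close> with the product \<open>a c \<circ> c b = a c b\<close> and identity \<open>c\<close>.
\<close>

definition ldiv :: "'m set \<Rightarrow> ('m \<Rightarrow> 'm \<Rightarrow> 'm) \<Rightarrow> 'm \<Rightarrow> 'm set" where
  "ldiv M f c = {x. (\<exists>a\<in>M. x = f a c) \<and> (\<exists>a\<in>M. x = f c a)}"

definition ldmul :: "'m set \<Rightarrow> ('m \<Rightarrow> 'm \<Rightarrow> 'm) \<Rightarrow> 'm \<Rightarrow> 'm \<Rightarrow> 'm \<Rightarrow> 'm" where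
  "ldmul M f c x y = f x (SOME a. a \<in> M \<and> y = f c a)"

lemma ldivI: "a \<in> M \<Longrightarrow> b \<in> M \<Longrightarrow> x = f a c \<Longrightarrow> x = f c b \<Longrightarrow> x \<in> ldiv M f c"
  unfolding ldiv_def by blast

text \<open>For \<open>y = c b\<close> one has \<open>(a c) b = a (c b) = a y\<close>, so the choice
  of \<open>b\<close> in \<open>ldmul\<close> is immaterial. All computations in the local divisor
  go through this equation.\<close>

lemma ldmul_eq:
  assumes M: "aperiodic_monoid M f e" and c: "c \<in> M" and a: "a \<in> M" and y: "y \<in> ldiv M f c"
  shows "ldmul M f c (f a c) y = f a y"
proof -
  have "\<exists>b. b \<in> M \<and> y = f c b" using y by (auto simp: ldiv_def)
  from someI_ex[OF this] obtain b where "b = (SOME a. a \<in> M \<and> y = f c a)" "b \<in> M" "y = f c b"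
    by (metis (no_types, lifting))
  thus ?thesis using apmonD(4)[OF M a c, of b] by (simp add: ldmul_def)
qed

lemma ldiv_sub: "aperiodic_monoid M f e \<Longrightarrow> c \<in> M \<Longrightarrow> ldiv M f c \<subseteq> M"
  by (auto simp: ldiv_def apmonD)

text \<open>If \<open>x = a c\<close>, then the \<open>n\<close>-th power of \<open>x\<close> in the
  local divisor is \<open>a^n c\<close>, so aperiodicity is inherited from the powers of
  \<open>a\<close>. Associativity reduces in the same way to that of \<open>f\<close> on the left
  cofactors.\<close>

lemma aperiodic_monoid_ldiv:
  assumes M: "aperiodic_monoid M f e" and c: "c \<in> M"
  shows "aperiodic_monoid (ldiv M f c) (ldmul M f c) c"
proof -
  note m = apmonD[OF M]
  let ?D = "ldiv M f c" and ?g = "ldmul M f c"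
  have cD: "c \<in> ?D" using c m by (auto simp: ldiv_def intro!: bexI[of _ e])
  have gD: "?g x y \<in> ?D" if "x \<in> ?D" "y \<in> ?D" for x y
  proof -
    from that obtain a b a' b' where ab: "a \<in> M" "b \<in> M" "a' \<in> M" "b' \<in> M"
      "x = f a c" "x = f c a'" "y = f b c" "y = f c b'" by (auto simp: ldiv_def)
    have "?g x y = f a y" using ldmul_eq[OF M c ab(1) that(2)] ab by simp
    moreover have "f a y = f (f a b) c" using ab c m by simp
    moreover have "f a y = f (f a c) b'" using ab c m by simp
    hence "f a y = f c (f a' b')" using ab c m by metis
    ultimately show ?thesis using ab m by (intro ldivI[of "f a b" M "f a' b'"]) auto
  qed
  have assoc: "?g (?g x y) z = ?g x (?g y z)" if "x \<in> ?D" "y \<in> ?D" "z \<in> ?D" for x y z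
  proof -
    from that obtain a b where ab: "a \<in> M" "b \<in> M" "x = f a c" "y = f b c" by (auto simp: ldiv_def)
    have "?g x y = f (f a b) c" using ldmul_eq[OF M c ab(1) that(2)] ab c m by simp
    hence "?g (?g x y) z = f (f a b) z" using ldmul_eq[OF M c _ that(3), of "f a b"] ab m by simp
    also have "\<dots> = f a (f b z)" using ab ldiv_sub[OF M c] that m by auto
    also have "f b z = ?g y z" using ldmul_eq[OF M c ab(2) that(3)] ab by simp
    also have "f a \<dots> = ?g x (?g y z)" using ldmul_eq[OF M c ab(1) gD[OF that(2,3)]] ab by simp
    finally show ?thesis .
  qed
  have unit: "?g c x = x \<and> ?g x c = x" if x: "x \<in> ?D" for x
  proof -
    obtain a where a: "a \<in> M" "x = f a c" using x by (auto simp: ldiv_def)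
    show ?thesis using ldmul_eq[OF M c a(1) cD] ldmul_eq[OF M c _ x, of e] a m c ldiv_sub[OF M c] x by auto
  qed
  have ap: "\<exists>n. power_in ?g c x (Suc n) = power_in ?g c x n" if x: "x \<in> ?D" for x
  proof -
    obtain a where a: "a \<in> M" "x = f a c" using x by (auto simp: ldiv_def)
    have pD: "power_in ?g c x n \<in> ?D" for n by (induction n) (auto simp: cD gD x)
    have "power_in ?g c x n = f (power_in f e a n) c" for n
    proof (induction n)
      case (Suc n)
      have "power_in ?g c x (Suc n) = f a (power_in ?g c x n)" using ldmul_eq[OF M c a(1) pD] a by simp
      thus ?case using Suc m a c power_in_in[OF M] by simp
    qed (use m c in simp)
    thus ?thesis using m(7)[OF a(1)] by metis
  qed
  show ?thesis unfolding aperiodic_monoid_def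
    using finite_subset[OF ldiv_sub[OF M c] m(1)] cD gD assoc unit ap by blast
qed

text \<open>
  Cut a path at its points labelled \<open>c\<close>. Between the first and the last of them, the products
  \<open>c t c\<close> of the segments multiply in the local divisor, along the path of the \<open>c\<close>-points.
\<close>

lemma reach_letter_split:
  fixes s :: "'p \<Rightarrow> 'p option" and lb lb' :: "'p \<Rightarrow> 'm" and A' :: "'m set" and Q :: "'p \<Rightarrow> bool"
  assumes M: "aperiodic_monoid M f e" and A: "A \<subseteq> M" and c: "c \<in> A"
  defines "B \<equiv> A - {c}" and "C \<equiv> (\<lambda>p. lb p = c)" and "g \<equiv> ldmul M f c"
  defines "G \<equiv> \<lambda>x m1. reach (next_hit s C) lb' A' g c x (\<lambda>p. C p \<and> nextp s (reach s lb B f e m1 Q) p)"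
  assumes lb': "\<And>p q t r. lb p = c \<Longrightarrow> s p = Some q \<Longrightarrow> walk s lb B q t r \<Longrightarrow> lb r = c
      \<Longrightarrow> lb' p = f c (f (foldr f t e) c)"
    and lb'': "\<And>p. lb' p \<in> A' \<Longrightarrow> lb p = c \<and> (\<exists>q t r. s p = Some q \<and> walk s lb B q t r \<and> lb r = c)"
    and A': "A' = {f c (f t c) | t. t \<in> M}"
  shows "reach s lb A f e m Q p \<longleftrightarrow> reach s lb B f e m Q p \<or>
     (\<exists>m0\<in>M. \<exists>x\<in>ldiv M f c. \<exists>m1\<in>M. f m0 (f x m1) = m \<and>
        reach s lb B f e m0 (\<lambda>p. C p \<and> G x m1 p) p)"
    (is "_ \<longleftrightarrow> _ \<or> ?R m p")
proof -
  note mm = apmonD[OF M]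
  have cM: "c \<in> M" using A c by auto
  note gm = aperiodic_monoid_ldiv[OF M cM]
  have BM: "B \<subseteq> M" using A by (auto simp: B_def)
  have A'D: "A' \<subseteq> ldiv M f c"
  proof
    fix x assume "x \<in> A'"
    then obtain t where t: "t \<in> M" "x = f c (f t c)" using A' by auto
    have "x = f (f c t) c" using t cM mm by simp
    thus "x \<in> ldiv M f c" using t cM mm by (intro ldivI[of "f c t" M "f t c"]) auto
  qed
  \<comment> \<open>Induction on the walk, adding one letter in front. If it is \<open>c\<close> and
    the rest already visits \<open>c\<close>, then the initial product \<open>m0\<close> of the rest
    becomes the segment of a new label \<open>c m0 c\<close>, and the new initial product is
    \<open>e\<close>.\<close>
  have fwd: "walk s lb A p xs q \<Longrightarrow> Q q \<Longrightarrow> walk s lb B p xs q \<or> ?R (foldr f xs e) p" for p xs q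
  proof (induction rule: walk.induct)
    case (walk_Nil p)
    then show ?case by (auto intro: walk.intros)
  next
    case (walk_Cons p q xs r)
    have lM: "lb p \<in> M" using walk_Cons.hyps A by auto
    show ?case
    proof (cases "walk s lb B q xs r")
      case Bw: True
      show ?thesis
      proof (cases "lb p = c")
        case True
        let ?m1 = "foldr f xs e"
        have m1: "?m1 \<in> M" using foldr_in[OF M _ mm(2)] walk_set[OF Bw] BM by blast
        have "reach s lb B f e ?m1 Q q" using Bw walk_Cons.prems by (auto simp: reach_def)
        hence "nextp s (reach s lb B f e ?m1 Q) p" using walk_Cons.hyps by (auto simp: nextp_def)
        \<comment> \<open>A single visit to \<open>c\<close> is the empty walk along the
          \<open>c\<close>-points, whose product is the identity \<open>c\<close> of the local
          divisor.\<close>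
        hence "G c ?m1 p"
          unfolding G_def reach_def[of "next_hit s C"] using True
          by (intro exI[of _ "[]"] exI[of _ p]) (auto intro: walk_Nil simp: C_def)
        hence "reach s lb B f e e (\<lambda>p. C p \<and> G c ?m1 p) p"
          unfolding reach_def[of s lb B f e e] using True
          by (intro exI[of _ "[]"] exI[of _ p]) (auto intro: walk_Nil simp: C_def)
        moreover have "f e (f c ?m1) = foldr f (lb p # xs) e" using True m1 cM mm by simp
        moreover have "c \<in> ldiv M f c" using gm by (simp add: apmonD)
        ultimately show ?thesis using m1 mm(2) by blast
      next
        case False
        thus ?thesis using Bw walk_Cons.hyps by (auto intro!: walk.walk_Cons simp: B_def)
      qed
    next
      case False
      then obtain m0 x m1 where mx: "m0 \<in> M" "x \<in> ldiv M f c" "m1 \<in> M" "f m0 (f x m1) = foldr f xs e"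
        and r: "reach s lb B f e m0 (\<lambda>p. C p \<and> G x m1 p) q"
        using walk_Cons by blast
      then obtain ys q' where ys: "walk s lb B q ys q'" "foldr f ys e = m0" "C q'"
        and d: "G x m1 q'"
        by (auto simp: reach_def[of s lb B f e m0])
      have xM: "x \<in> M" using mx ldiv_sub[OF M cM] by auto
      show ?thesis
      proof (cases "lb p = c")
        case True
        have l: "lb' p = f c (f m0 c)" using lb'[OF True walk_Cons.hyps(2) ys(1)] ys by (auto simp: C_def)
        have nxp: "next_hit s C p = Some q'"
          using walk_Cons.hyps(2) walk_hit[of s lb A c q ys q'] ys by (auto simp: next_hit_Some C_def B_def)
        have lA: "lb' p \<in> A'" using l A' mx by auto
        from d obtain zs r' where z: "walk (next_hit s C) lb' A' q' zs r'" "foldr g zs c = x"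
          "C r' \<and> nextp s (reach s lb B f e m1 Q) r'" by (auto simp: G_def reach_def[of "next_hit s C"])
        have "walk (next_hit s C) lb' A' p (lb' p # zs) r'" using lA nxp z by (auto intro: walk.walk_Cons)
        hence d': "G (g (lb' p) x) m1 p"
          unfolding G_def reach_def[of "next_hit s C"] using z by (intro exI[of _ "lb' p # zs"] exI[of _ r']) auto
        have geq: "g (lb' p) x = f (f c m0) x"
          using ldmul_eq[OF M cM _ mx(2), of "f c m0"] l mx cM mm by (simp add: g_def)
        have "reach s lb B f e e (\<lambda>q. C q \<and> G (g (lb' p) x) m1 q) p"
          unfolding reach_def[of s lb B f e e] using True d'
          by (intro exI[of _ "[]"] exI[of _ p]) (auto intro: walk_Nil simp: C_def)
        moreover have "g (lb' p) x \<in> ldiv M f c" using gm A'D lA mx by (auto simp: apmonD g_def)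
        moreover have "f e (f (g (lb' p) x) m1) = foldr f (lb p # xs) e"
          using geq True mx xM cM mm by (simp flip: mx(4))
        ultimately show ?thesis using mx mm(2) by blast
      next
        case False
        hence "walk s lb B p (lb p # ys) q'" using ys walk_Cons.hyps by (auto intro!: walk.walk_Cons simp: B_def)
        hence "reach s lb B f e (f (lb p) m0) (\<lambda>p. C p \<and> G x m1 p) p"
          unfolding reach_def[of s lb B f e "f (lb p) m0"] using ys d
          by (intro exI[of _ "lb p # ys"] exI[of _ q']) auto
        moreover have "f (f (lb p) m0) (f x m1) = foldr f (lb p # xs) e"
          using mx xM lM mm by (simp flip: mx(4))
        ultimately show ?thesis using mx mm lM by blast
      qed
    qed
  qed
  \<comment> \<open>Both folds start from \<open>c\<close>: this accounts for the last visit to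
    \<open>c\<close>, whose letter the walk along the \<open>c\<close>-points does not read.\<close>
  have der: "walk (next_hit s C) lb' A' p ys r \<Longrightarrow> C r \<Longrightarrow>
     \<exists>xs. walk s lb A p xs r \<and> foldr f xs c = foldr g ys c" for p ys r
  proof (induction rule: walk.induct)
    case (walk_Nil p)
    then show ?case by (intro exI[of _ "[]"]) (auto intro: walk.walk_Nil)
  next
    case (walk_Cons p q ys r)
    then obtain xs where xs: "walk s lb A q xs r" "foldr f xs c = foldr g ys c" by blast
    obtain q' t q'' where q': "lb p = c" "s p = Some q'" "walk s lb B q' t q''" "lb q'' = c"
      using lb''[OF walk_Cons.hyps(1)] by blast
    have "next_hit s C p = Some q''" using q' walk_hit[of s lb A c q' t q''] by (auto simp: next_hit_Some C_def B_def)
    hence [simp]: "q'' = q" using walk_Cons.hyps by simp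
    have l: "lb' p = f c (f (foldr f t e) c)" using lb' q' by blast
    have tM: "foldr f t e \<in> M" using foldr_in[OF M _ mm(2)] walk_set[OF q'(3)] BM by blast
    have w: "walk s lb A p (c # t @ xs) r"
      using walk.walk_Cons[of lb p A s q' "t @ xs" r] q' c walk_append[OF walk_mono[OF q'(3)]] xs(1)
      by (auto simp: B_def)
    have yD: "foldr g ys c \<in> ldiv M f c"
      using foldr_in[OF gm, of ys c] walk_set[OF walk_Cons.hyps(3)] A'D gm by (auto simp: apmonD g_def)
    hence yM: "foldr g ys c \<in> M" using ldiv_sub[OF M cM] by auto
    have "foldr f (c # t @ xs) c = f c (foldr f t (foldr g ys c))" using xs by simp
    also have "foldr f t (foldr g ys c) = f (foldr f t e) (foldr g ys c)"
      using foldr_mult[OF M _ yM] walk_set[OF q'(3)] BM by blast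
    also have "f c \<dots> = f (f c (foldr f t e)) (foldr g ys c)" using tM yM cM mm by simp
    also have "\<dots> = g (lb' p) (foldr g ys c)"
      using ldmul_eq[OF M cM _ yD, of "f c (foldr f t e)"] l tM cM mm by (simp add: g_def)
    finally show ?case using w by auto
  qed
  show ?thesis
  proof
    assume "reach s lb A f e m Q p"
    then obtain xs q where "walk s lb A p xs q" "foldr f xs e = m" "Q q" by (auto simp: reach_def)
    thus "reach s lb B f e m Q p \<or> ?R m p" using fwd[of p xs q] by (auto simp: reach_def[of s lb B f e m])
  next
    assume "reach s lb B f e m Q p \<or> ?R m p"
    thus "reach s lb A f e m Q p"
    proof
      assume "reach s lb B f e m Q p"
      thus ?thesis unfolding reach_def using walk_mono[of s lb B _ _ _ A] by (auto simp: B_def) blast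
    next
      assume "?R m p"
      then obtain m0 x m1 where mx: "m0 \<in> M" "x \<in> ldiv M f c" "m1 \<in> M" "f m0 (f x m1) = m"
        and r: "reach s lb B f e m0 (\<lambda>p. C p \<and> G x m1 p) p"
        by blast
      then obtain xs0 p1 where 1: "walk s lb B p xs0 p1" "foldr f xs0 e = m0" "C p1"
        and d: "G x m1 p1"
        by (auto simp: reach_def[of s lb B f e m0])
      from d obtain ys p2 where 2: "walk (next_hit s C) lb' A' p1 ys p2" "foldr g ys c = x" "C p2"
        "nextp s (reach s lb B f e m1 Q) p2" by (auto simp: G_def reach_def[of "next_hit s C"])
      from 2(4) obtain q' xs1 q where 3: "s p2 = Some q'" "walk s lb B q' xs1 q" "foldr f xs1 e = m1" "Q q"
        by (auto simp: nextp_def reach_def)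
      from der[OF 2(1,3)] obtain xs where xs: "walk s lb A p1 xs p2" "foldr f xs c = x" using 2 by auto
      have "walk s lb A p2 (c # xs1) q"
        using walk.walk_Cons[of lb p2 A s q' xs1 q] 3 2(3) c walk_mono[OF 3(2)] by (auto simp: C_def B_def)
      hence w: "walk s lb A p (xs0 @ xs @ c # xs1) q"
        using walk_append[OF walk_mono[OF 1(1)] walk_append[OF xs(1)]] by (simp add: B_def Diff_subset)
      have sM: "set xs0 \<subseteq> M" "set xs \<subseteq> M" "set xs1 \<subseteq> M"
        by (rule subset_trans[OF walk_set[OF 1(1)] BM] subset_trans[OF walk_set[OF xs(1)] A]
            subset_trans[OF walk_set[OF 3(2)] BM])+
      have "foldr f xs (f c m1) = f (foldr f xs e) (f c m1)" by (rule foldr_mult[OF M sM(2)]) (use mx cM mm in simp)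
      also have "\<dots> = f (f (foldr f xs e) c) m1" 
        by (rule mm(4)[symmetric, OF foldr_in[OF M sM(2) mm(2)] cM mx(3)])
      also have "f (foldr f xs e) c = x" using foldr_mult[OF M sM(2) cM, symmetric] xs by (rule_tac trans)
      finally have "foldr f (xs0 @ xs @ c # xs1) e = foldr f xs0 (f x m1)" using 3 by simp
      also have "\<dots> = f m0 (f x m1)"
        using foldr_mult[OF M sM(1), of "f x m1"] 1(2) mm(3)[OF subsetD[OF ldiv_sub[OF M cM] mx(2)] mx(3)] by simp
      finally have "foldr f (xs0 @ xs @ c # xs1) e = m" using mx(4) by (rule trans)
      thus ?thesis unfolding reach_def using w 3(4) by blast
    qed
  qed
qed

text \<open>Nested induction on the size of the monoid and, within it, on the number of letters.
  Segments between visits to \<open>c\<close> use fewer letters. The walk along the visits has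
  labels in the local divisor, a smaller monoid, so there the number of letters may grow.\<close>

theorem reach_definable:
  assumes "aperiodic_monoid M f e" "A \<subseteq> M" "closed F s" "\<And>a. a \<in> A \<Longrightarrow> (\<lambda>p. lb p = a) \<in> F" "Q \<in> F"
  shows "reach s lb A f e m Q \<in> F"
  using assms
proof (induction "card M" arbitrary: M f e A s lb Q m rule: less_induct)
  case less
  note M = less.prems(1)
  note mm = apmonD[OF M]
  have "finite A" using less.prems(2) mm(1) by (rule finite_subset)
  thus ?case using less.prems(2-5)
  proof (induction "card A" arbitrary: A Q m rule: less_induct)
    case inner: less
    note F = inner.prems(3) and AM = inner.prems(2)
    show ?case
    proof (cases "A \<subseteq> {e}")
      case True
      \<comment> \<open>If \<open>e\<close> is the only possible letter, every product is
        \<open>e\<close>, and only the existence of a walk remains to be expressed, which is an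
        until.\<close>
      have tr: "foldr f xs e = e" if "set xs \<subseteq> A" for xs
        using that True mm by (induction xs) auto
      have "reach s lb A f e m Q = (if m = e then untilp s (\<lambda>p. \<exists>a\<in>A. lb p = a) Q else (\<lambda>_. False))"
      proof (rule ext)
        fix p
        have "(\<exists>xs q. walk s lb A p xs q \<and> Q q) \<longleftrightarrow> untilp s (\<lambda>p. \<exists>a\<in>A. lb p = a) Q p"
        proof
          assume "\<exists>xs q. walk s lb A p xs q \<and> Q q"
          then obtain xs q where "walk s lb A p xs q" "Q q" by blast
          thus "untilp s (\<lambda>p. \<exists>a\<in>A. lb p = a) Q p" by induction (auto intro: untilp.intros)
        next
          assume "untilp s (\<lambda>p. \<exists>a\<in>A. lb p = a) Q p"
          thus "\<exists>xs q. walk s lb A p xs q \<and> Q q" by induction (auto intro: walk.intros)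
        qed
        thus "reach s lb A f e m Q p = (if m = e then untilp s (\<lambda>p. \<exists>a\<in>A. lb p = a) Q else (\<lambda>_. False)) p"
          unfolding reach_def using tr[OF walk_set[of s lb A p]] by (cases "m = e") (simp, blast, simp, blast)
      qed
      thus ?thesis
        using closed_False[OF F]
          closed_untilp[OF F closed_Bex[OF F inner.prems(1), of "\<lambda>a p. lb p = a", OF inner.prems(4)] inner.prems(5)]
        by (cases "m = e") simp_all
    next
      case False
      then obtain c where c: "c \<in> A" "c \<noteq> e" by auto
      hence cM: "c \<in> M" using AM by auto
      define B where "B = A - {c}"
      define C where "C = (\<lambda>p. lb p = c)"
      define g where "g = ldmul M f c"
      define D where "D = ldiv M f c"
      define A' where "A' = {f c (f t c) | t. t \<in> M}"
      define seg where "seg = (\<lambda>p t. lb p = c \<and> (\<exists>q r. s p = Some q \<and> walk s lb B q t r \<and> lb r = c))"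
      \<comment> \<open>Points at which no segment starts get the label \<open>e\<close>. It lies
        outside the local divisor and hence outside \<open>A'\<close>, so walks over
        \<open>A'\<close> cannot continue from such points.\<close>
      define lb' where "lb' = (\<lambda>p. if \<exists>t. seg p t then f c (f (foldr f (SOME t. seg p t) e) c) else e)"
      have D: "aperiodic_monoid D g c" unfolding D_def g_def by (rule aperiodic_monoid_ldiv[OF M cM])
      have eD: "e \<notin> D" using aperiodic_monoid_unit[OF M cM] c by (auto simp: D_def ldiv_def)
      have DM: "D \<subseteq> M" unfolding D_def by (rule ldiv_sub[OF M cM])
      have cardD: "card D < card M" using eD DM mm by (intro psubset_card_mono) auto
      have A'D: "A' \<subseteq> D"
      proof
        fix x assume "x \<in> A'"
        then obtain t where t: "t \<in> M" "x = f c (f t c)" by (auto simp: A'_def)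
        have "x = f (f c t) c" using t cM mm by simp
        thus "x \<in> D" unfolding D_def using t cM mm by (intro ldivI[of "f c t" M "f t c"]) auto
      qed
      have seg1: "t = t'" if "seg p t" "seg p t'" for p t t'
        using that walk_unique[of s lb A c] unfolding seg_def B_def by fastforce
      have lb': "lb' p = f c (f (foldr f t e) c)" if "seg p t" for p t
      proof -
        have "(SOME t. seg p t) = t" using that seg1 by blast
        thus ?thesis using that by (auto simp: lb'_def)
      qed
      have lb'': "\<exists>t. seg p t" if "lb' p \<in> A'" for p
        using that A'D eD unfolding lb'_def by (auto split: if_splits)
      have IHB: "reach s lb B f e m' Q' \<in> F" if "Q' \<in> F" for m' Q'
        using inner.hyps[of B] inner.prems(1,2,4) F c that card_Diff1_less[OF inner.prems(1) c(1)]
        by (auto simp: B_def)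
      have CF: "C \<in> F" unfolding C_def using inner.prems(4)[OF c(1)] .
      have cl: "closed F (next_hit s C)" by (rule closed_next_hit[OF F CF])
      have lF: "(\<lambda>p. lb' p = a) \<in> F" if "a \<in> A'" for a
      proof -
        \<comment> \<open>Different segment products \<open>t\<close> may give the same label
          \<open>a\<close>, so all of them are collected; each is a product over the smaller
          alphabet \<open>B\<close>.\<close>
        have "(\<lambda>p. lb' p = a) = (\<lambda>p. \<exists>t\<in>{t\<in>M. f c (f t c) = a}. C p \<and> nextp s (reach s lb B f e t C) p)"
        proof (rule ext, rule iffI)
          fix p assume "lb' p = a"
          hence "lb' p \<in> A'" using that by simp
          then obtain t where t: "seg p t" using lb'' by blast
          then obtain q r where qrank: "lb p = c" "s p = Some q" "walk s lb B q t r" "lb r = c" by (auto simp: seg_def)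
          have "foldr f t e \<in> M" using foldr_in[OF M _ mm(2)] walk_set[OF qrank(3)] AM unfolding B_def by blast
          thus "\<exists>t\<in>{t\<in>M. f c (f t c) = a}. C p \<and> nextp s (reach s lb B f e t C) p"
            using qrank lb'[OF t] \<open>lb' p = a\<close>
            by (intro bexI[of _ "foldr f t e"]) (auto simp: C_def nextp_def reach_def)
        next
          fix p assume "\<exists>t\<in>{t\<in>M. f c (f t c) = a}. C p \<and> nextp s (reach s lb B f e t C) p"
          then obtain t where "f c (f (foldr f t e) c) = a" "seg p t"
            by (auto simp: C_def nextp_def reach_def seg_def)
          thus "lb' p = a" using lb' by simp
        qed
        moreover have "\<dots> \<in> F"
          using mm(1) by (intro closed_Bex[OF F] closed_conj[OF F] CF closed_nextp[OF F] IHB) auto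
        ultimately show ?thesis by simp
      qed
      have IHD: "reach (next_hit s C) lb' A' g c x Q' \<in> F" if "Q' \<in> F" for x Q'
        by (rule less.hyps[OF cardD D A'D cl lF that])
      have "reach s lb A f e m Q = (\<lambda>p. reach s lb B f e m Q p \<or>
         (\<exists>m0\<in>M. \<exists>x\<in>D. \<exists>m1\<in>{m1\<in>M. f m0 (f x m1) = m}.
            reach s lb B f e m0 (\<lambda>p. C p \<and> reach (next_hit s C) lb' A' g c x (\<lambda>p. C p \<and> nextp s (reach s lb B f e m1 Q) p) p) p))"
      proof (rule ext)
        fix p
        have 1: "lb' p = f c (f (foldr f t e) c)" if "lb p = c" "s p = Some q" "walk s lb (A - {c}) q t r" "lb r = c" for p q t r
          by (rule lb') (use that in \<open>auto simp: seg_def B_def\<close>)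
        have 2: "lb p = c \<and> (\<exists>q t r. s p = Some q \<and> walk s lb (A - {c}) q t r \<and> lb r = c)" if "lb' p \<in> A'" for p
          using lb''[OF that] by (auto simp: seg_def B_def)
        show "reach s lb A f e m Q p = (reach s lb B f e m Q p \<or>
         (\<exists>m0\<in>M. \<exists>x\<in>D. \<exists>m1\<in>{m1\<in>M. f m0 (f x m1) = m}.
            reach s lb B f e m0 (\<lambda>p. C p \<and> reach (next_hit s C) lb' A' g c x (\<lambda>p. C p \<and> nextp s (reach s lb B f e m1 Q) p) p) p))"
          unfolding B_def C_def g_def D_def
            Bex_def mem_Collect_eq conj_assoc
          by (rule reach_letter_split[OF M AM c(1), unfolded Bex_def conj_assoc]) (rule 1 2 A'_def; assumption)+
      qed
      moreover have "\<dots> \<in> F"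
        using mm(1) D inner.prems(5)
        by (intro closed_disj[OF F] closed_Bex[OF F] IHB closed_conj[OF F] CF IHD closed_nextp[OF F])
          (auto simp: apmonD)
      ultimately show ?thesis by simp
    qed
  qed
qed

section \<open>The aperiodic monoid of rank types\<close>

text \<open>A type of rank \<open>k + 1\<close> is built from the type of rank \<open>k\<close> of
  the same structure and the types of rank \<open>k\<close> that arise by placing one more mark.
  There are only finitely many types of each rank, so finite sets suffice for the recursion.\<close>

datatype 'f ty = Base "'f set" | Node "'f ty" "'f ty fset"

fun base :: "'f ty \<Rightarrow> 'f set" where "base (Base F) = F" | "base (Node _ _) = {}"
fun low :: "'f ty \<Rightarrow> 'f ty" where "low (Node a _) = a" | "low (Base F) = Base F"
fun subs :: "'f ty \<Rightarrow> 'f ty set" where "subs (Node _ S) = fset S" | "subs (Base _) = {}"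

definition node :: "'f ty \<Rightarrow> 'f ty set \<Rightarrow> 'f ty" where
  "node a S = Node a (Abs_fset S)"

lemma low_node [simp]: "low (node a S) = a"
  and subs_node [simp]: "finite S \<Longrightarrow> subs (node a S) = S"
  by (simp_all add: node_def Abs_fset_inverse)

type_synonym 'a facts = "('a fo + nat \<times> bool) set"
type_synonym 'a wty = "('a fo + nat \<times> bool) ty"

text \<open>
  A mark \<open>p\<close> with \<open>Inr (p, True)\<close> lies on the left side of its component, one with
  \<open>Inr (p, False)\<close> on the right side: the factors of a product are nested inside each other.
\<close>

definition facts_mult :: "'a facts \<Rightarrow> 'a facts \<Rightarrow> 'a facts" where
  "facts_mult F G = F \<union> G \<union> {Inl (FLess p q) | p q. Inr (p, True) \<in> F \<and> (\<exists>b. Inr (q, b) \<in> G)}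
     \<union> {Inl (FLess q p) | p q. Inr (p, False) \<in> F \<and> (\<exists>b. Inr (q, b) \<in> G)}"

lemma facts_mult_assoc: "facts_mult (facts_mult F G) H = facts_mult F (facts_mult G H)"
  unfolding facts_mult_def by blast

lemma facts_mult_empty [simp]: "facts_mult {} F = F" "facts_mult F {} = F"
  by (auto simp: facts_mult_def)

text \<open>Aperiodicity at rank \<open>0\<close>: two equal factors already produce every order
  fact that a product can add for the marks of \<open>F\<close>.\<close>

lemma facts_mult_pow: "facts_mult F (facts_mult F F) = facts_mult F F"
  unfolding facts_mult_def by blast

text \<open>A new mark falls into exactly one of the two factors; the other one then contributes
  only its type of lower rank.\<close>

primrec tmult :: "nat \<Rightarrow> 'a wty \<Rightarrow> 'a wty \<Rightarrow> 'a wty" where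
  "tmult 0 x y = Base (facts_mult (base x) (base y))"
| "tmult (Suc k) x y = node (tmult k (low x) (low y))
     ((\<lambda>s. tmult k s (low y)) ` subs x \<union> tmult k (low x) ` subs y)"

primrec tone :: "nat \<Rightarrow> 'a wty" where
  "tone 0 = Base {}"
| "tone (Suc k) = node (tone k) {}"

text \<open>All ranks share the bound \<open>K\<close> on the names of marks. Together with the
  finiteness of the alphabet it keeps the set of types of each rank finite.\<close>

definition atoms :: "nat \<Rightarrow> 'a fo set" where
  "atoms K = (\<Union>p<K. \<Union>q<K. {FEq p q, FLess p q, FMu p q}) \<union> (\<Union>p<K. {FCall p, FRet p})
     \<union> (\<Union>p<K. range (\<lambda>a. FLetter a p))"

lemma finite_atoms: "finite (atoms K :: 'a::finite fo set)"
  by (auto simp: atoms_def)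

lemma atoms_simps [simp]:
  "FEq p q \<in> atoms K \<longleftrightarrow> p < K \<and> q < K" "FLess p q \<in> atoms K \<longleftrightarrow> p < K \<and> q < K"
  "FMu p q \<in> atoms K \<longleftrightarrow> p < K \<and> q < K" "FCall p \<in> atoms K \<longleftrightarrow> p < K" "FRet p \<in> atoms K \<longleftrightarrow> p < K"
  "FLetter a p \<in> atoms K \<longleftrightarrow> p < K"
  by (auto simp: atoms_def)

lemma atoms_cases:
  assumes "x \<in> atoms K"
  obtains p q where "x = FEq p q" "p < K" "q < K" | p q where "x = FLess p q" "p < K" "q < K"
    | p q where "x = FMu p q" "p < K" "q < K" | p where "x = FCall p" "p < K" | p where "x = FRet p" "p < K"
    | a p where "x = FLetter a p" "p < K"
  using assms unfolding atoms_def by blast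

definition all_facts :: "nat \<Rightarrow> 'a facts" where
  "all_facts K = Inl ` atoms K \<union> Inr ` ({..<K} \<times> UNIV)"

primrec wtypes :: "nat \<Rightarrow> nat \<Rightarrow> 'a wty set" where
  "wtypes K 0 = Base ` Pow (all_facts K)"
| "wtypes K (Suc k) = {node a S | a S. a \<in> wtypes K k \<and> S \<subseteq> wtypes K k}"

lemma finite_wtypes: "finite (wtypes K k :: 'a::finite wty set)"
proof (induction k)
  case (Suc k)
  have "wtypes K (Suc k) = (\<lambda>(a, S). node a S) ` (wtypes K k \<times> Pow (wtypes K k) :: ('a wty \<times> 'a wty set) set)" by auto
  thus ?case using Suc by simp
qed (simp add: all_facts_def finite_atoms)

lemma wtypes_Suc:
  assumes "(x :: 'a::finite wty) \<in> wtypes K (Suc k)"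
  shows "low x \<in> wtypes K k" "subs x \<subseteq> wtypes K k" "finite (subs x)" "x = node (low x) (subs x)"
proof -
  from assms obtain a S where x: "x = node a S" "a \<in> wtypes K k" "S \<subseteq> wtypes K k" by auto
  moreover have "finite S" using finite_subset[OF x(3) finite_wtypes] .
  ultimately show "low x \<in> wtypes K k" "subs x \<subseteq> wtypes K k" "finite (subs x)" "x = node (low x) (subs x)" by auto
qed

lemma node_wtypes: "a \<in> wtypes K k \<Longrightarrow> S \<subseteq> wtypes K k \<Longrightarrow> node a S \<in> wtypes K (Suc k)"
  by auto

lemma all_facts_simps [simp]: "Inl a \<in> all_facts K \<longleftrightarrow> a \<in> atoms K" "Inr (p, b) \<in> all_facts K \<longleftrightarrow> p < K"
  by (auto simp: all_facts_def)

lemma facts_mult_all_facts: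
  assumes "F \<subseteq> all_facts K" "G \<subseteq> all_facts K"
  shows "facts_mult F G \<subseteq> all_facts K"
proof -
  have "p < K" if "Inr (p, b) \<in> F \<or> Inr (p, b) \<in> G" for p b
    using that assms all_facts_simps(2) by blast
  thus ?thesis using assms unfolding facts_mult_def by (auto 0 3)
qed

lemma tmult_wtypes: "(x :: 'a::finite wty) \<in> wtypes K k \<Longrightarrow> y \<in> wtypes K k \<Longrightarrow> tmult k x y \<in> wtypes K k"
proof (induction k arbitrary: x y)
  case 0
  then obtain F G where "x = Base F" "y = Base G" "F \<subseteq> all_facts K" "G \<subseteq> all_facts K" by auto
  thus ?case using facts_mult_all_facts[of F K G] by simp
next
  case (Suc k)
  note x = wtypes_Suc[OF Suc.prems(1)] and y = wtypes_Suc[OF Suc.prems(2)]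
  show ?case unfolding tmult.simps
    by (rule node_wtypes) (use x y Suc.IH in auto)
qed

lemma tone_wtypes: "(tone k :: 'a::finite wty) \<in> wtypes K k"
  by (induction k) (auto intro: node_wtypes simp del: wtypes.simps(2))

lemma tmult_subs:
  assumes "(x :: 'a::finite wty) \<in> wtypes K (Suc k)" "y \<in> wtypes K (Suc k)"
  shows "subs (tmult (Suc k) x y) = (\<lambda>s. tmult k s (low y)) ` subs x \<union> tmult k (low x) ` subs y"
  using wtypes_Suc(3)[OF assms(1)] wtypes_Suc(3)[OF assms(2)] by simp

lemma tmult_low: "low (tmult (Suc k) x y) = tmult k (low x) (low y)"
  by simp

lemma tmult_tone: "(x :: 'a::finite wty) \<in> wtypes K k \<Longrightarrow> tmult k (tone k) x = x \<and> tmult k x (tone k) = x"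
proof (induction k arbitrary: x)
  case 0
  then show ?case by auto
next
  case (Suc k)
  note x = wtypes_Suc[OF Suc.prems]
  have "tmult k (tone k) ` subs x = subs x" "(\<lambda>s. tmult k s (tone k)) ` subs x = subs x"
    using Suc.IH x(2) by (force simp: image_iff)+
  thus ?case using Suc.IH[OF x(1)] x(4) by simp
qed

lemma tmult_assoc: "(x :: 'a::finite wty) \<in> wtypes K k \<Longrightarrow> y \<in> wtypes K k \<Longrightarrow> z \<in> wtypes K k \<Longrightarrow>
   tmult k (tmult k x y) z = tmult k x (tmult k y z)"
proof (induction k arbitrary: x y z)
  case 0
  then show ?case by (auto simp: facts_mult_assoc)
next
  case (Suc k)
  note x = wtypes_Suc[OF Suc.prems(1)] and y = wtypes_Suc[OF Suc.prems(2)] and z = wtypes_Suc[OF Suc.prems(3)]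
  have "subs (tmult (Suc k) (tmult (Suc k) x y) z) = subs (tmult (Suc k) x (tmult (Suc k) y z))"
    unfolding tmult_subs[OF tmult_wtypes[OF Suc.prems(1,2)] Suc.prems(3)]
      tmult_subs[OF Suc.prems(1) tmult_wtypes[OF Suc.prems(2,3)]] tmult_low
      tmult_subs[OF Suc.prems(1,2)] tmult_subs[OF Suc.prems(2,3)] image_Un image_image Un_assoc
    using Suc.IH x(1,2) y(1,2) z(1,2)
    by (intro arg_cong2[of _ _ _ _ "(\<union>)"] image_cong) auto
  moreover have "low (tmult (Suc k) (tmult (Suc k) x y) z) = low (tmult (Suc k) x (tmult (Suc k) y z))"
    using Suc.IH x(1) y(1) z(1) by simp
  ultimately show ?case
    using wtypes_Suc(4)[OF tmult_wtypes[OF tmult_wtypes[OF Suc.prems(1,2)] Suc.prems(3)]]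
      wtypes_Suc(4)[OF tmult_wtypes[OF Suc.prems(1) tmult_wtypes[OF Suc.prems(2,3)]]] by metis
qed

lemma power_in_add:
  assumes "e \<in> M" "\<And>x y. x \<in> M \<Longrightarrow> y \<in> M \<Longrightarrow> f x y \<in> M" "\<And>x. x \<in> M \<Longrightarrow> f e x = x"
    "\<And>x y z. x \<in> M \<Longrightarrow> y \<in> M \<Longrightarrow> z \<in> M \<Longrightarrow> f (f x y) z = f x (f y z)" "x \<in> M"
  shows "power_in f e x m \<in> M" "power_in f e x (m + n) = f (power_in f e x m) (power_in f e x n)"
proof -
  have in_M: "power_in f e x m \<in> M" for m by (induction m) (use assms in auto)
  show "power_in f e x m \<in> M" by fact
  show "power_in f e x (m + n) = f (power_in f e x m) (power_in f e x n)" by (induction m) (use assms in_M in auto)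
qed

lemma power_in_stable: "power_in f e x (Suc N) = power_in f e x N \<Longrightarrow> N \<le> n \<Longrightarrow> power_in f e x n = power_in f e x N"
  by (induction n) (auto simp: le_Suc_eq)

text \<open>In the \<open>n\<close>-th power of \<open>x\<close> a new mark falls into one of the
  \<open>n\<close> factors, so with \<open>a = low x\<close> the subtypes are the products
  \<open>a^i s a^j\<close> where \<open>i + j + 1 = n\<close>. If the powers of \<open>a\<close> are
  stable from \<open>N\<close> on and \<open>n > 2 N\<close>, then one of the exponents is at least
  \<open>N\<close> and can be raised by one without effect; lowering works in the same way from the
  next power.\<close>

lemma aperiodic_monoid_wtypes: "aperiodic_monoid (wtypes K k :: 'a::finite wty set) (tmult k) (tone k)"
proof -
  have "\<exists>n. power_in (tmult k) (tone k) x (Suc n) = power_in (tmult k) (tone k) x n" if "x \<in> wtypes K k" for x :: "'a wty"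
    using that
  proof (induction k arbitrary: x)
    case 0
    then obtain F where [simp]: "x = Base F" by auto
    have "power_in (tmult 0) (tone 0) x (Suc 2) = power_in (tmult 0) (tone 0) x 2"
      by (simp add: numeral_2_eq_2 facts_mult_pow)
    thus ?case by blast
  next
    case (Suc k)
    note xM = Suc.prems
    note x = wtypes_Suc[OF Suc.prems]
    let ?a = "low x" and ?S = "subs x"
    let ?p = "\<lambda>i. power_in (tmult k) (tone k) ?a i"
    have pM: "?p i \<in> wtypes K k" and padd: "?p (i + j) = tmult k (?p i) (?p j)" for i j
      using power_in_add[of "tone k" "wtypes K k" "tmult k" ?a] tmult_wtypes tmult_tone tmult_assoc tone_wtypes x(1) by blast+
    obtain N where N: "?p (Suc N) = ?p N" using Suc.IH[OF x(1)] by blast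
    let ?P = "\<lambda>n. power_in (tmult (Suc k)) (tone (Suc k)) x n"
    have PM: "?P n \<in> wtypes K (Suc k)" for n
      by (induction n) (use tone_wtypes tmult_wtypes Suc.prems in \<open>auto simp del: wtypes.simps tmult.simps tone.simps\<close>)
    have low: "low (?P n) = ?p n" for n
      by (induction n) auto
    have sub: "subs (?P n) = {tmult k (tmult k (?p i) s) (?p j) | i j s. s \<in> ?S \<and> Suc (i + j) = n}" for n
    proof (induction n)
      case (Suc n)
      have "subs (?P (Suc n)) = (\<lambda>s. tmult k s (?p n)) ` ?S \<union> tmult k ?a ` subs (?P n)"
        using tmult_subs[OF xM PM[of n]] low by (simp del: tmult.simps tone.simps)
      also have "\<dots> = {tmult k (tmult k (?p i) s) (?p j) | i j s. s \<in> ?S \<and> Suc (i + j) = Suc n}" (is "_ = ?X")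
      proof (intro equalityI subsetI)
        fix t assume "t \<in> (\<lambda>s. tmult k s (?p n)) ` ?S \<union> tmult k ?a ` subs (?P n)"
        thus "t \<in> ?X"
        proof
          assume "t \<in> (\<lambda>s. tmult k s (?p n)) ` ?S"
          then obtain s where s: "s \<in> ?S" "t = tmult k s (?p n)" by auto
          have "tmult k (?p 0) s = s" using s x(2) tmult_tone by auto
          thus ?thesis using s by (intro CollectI exI[of _ "0::nat"] exI[of _ n] exI[of _ s]) simp
        next
          assume "t \<in> tmult k ?a ` subs (?P n)"
          then obtain i j s where s: "s \<in> ?S" "Suc (i + j) = n" "t = tmult k ?a (tmult k (tmult k (?p i) s) (?p j))"
            unfolding Suc by auto
          have "s \<in> wtypes K k" using s x(2) by auto
          hence "t = tmult k (tmult k (?p (Suc i)) s) (?p j)"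
            using s x(1) pM by (simp add: tmult_assoc[of _ K] tmult_wtypes)
          thus ?thesis using s by (intro CollectI exI[of _ "Suc i"] exI[of _ j] exI[of _ s]) auto
        qed
      next
        fix t assume "t \<in> ?X"
        then obtain i j s where s: "s \<in> ?S" "i + j = n" "t = tmult k (tmult k (?p i) s) (?p j)" by auto
        have sM: "s \<in> wtypes K k" using s x(2) by auto
        show "t \<in> (\<lambda>s. tmult k s (?p n)) ` ?S \<union> tmult k ?a ` subs (?P n)"
        proof (cases i)
          case 0
          thus ?thesis using s tmult_tone[OF sM] by (intro UnI1) simp
        next
          case (Suc i')
          hence "t = tmult k ?a (tmult k (tmult k (?p i') s) (?p j))"
            using s sM x(1) pM by (simp add: tmult_assoc[of _ K] tmult_wtypes)
          moreover have "tmult k (tmult k (?p i') s) (?p j) \<in> subs (?P n)"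
            unfolding \<open>subs (?P n) = _\<close> using s Suc by auto
          ultimately show ?thesis by blast
        qed
      qed
      finally show ?case .
    qed (simp)
    have pS: "?p i = ?p N" if "i \<ge> N" for i by (rule power_in_stable[of "tmult k"]) (use N that in auto)
    have "subs (?P (Suc (2 * N + 1))) = subs (?P (2 * N + 1))"
    proof (intro equalityI subsetI)
      fix t assume "t \<in> subs (?P (Suc (2 * N + 1)))"
      then obtain i j s where s: "s \<in> ?S" "i + j = 2 * N + 1" "t = tmult k (tmult k (?p i) s) (?p j)"
        unfolding sub by auto
      show "t \<in> subs (?P (2 * N + 1))"
      proof (cases "i \<ge> Suc N")
        case True
        hence "?p i = ?p (i - 1)" using pS[of i] pS[of "i - 1"] by simp
        thus ?thesis unfolding sub using s True
          by (intro CollectI exI[of _ "i - 1"] exI[of _ j] exI[of _ s]) auto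
      next
        case False
        hence "j \<ge> Suc N" using s by simp
        hence "?p j = ?p (j - 1)" using pS[of j] pS[of "j - 1"] by simp
        thus ?thesis unfolding sub using s \<open>j \<ge> Suc N\<close>
          by (intro CollectI exI[of _ i] exI[of _ "j - 1"] exI[of _ s]) auto
      qed
    next
      fix t assume "t \<in> subs (?P (2 * N + 1))"
      then obtain i j s where s: "s \<in> ?S" "i + j = 2 * N" "t = tmult k (tmult k (?p i) s) (?p j)"
        unfolding sub by auto
      show "t \<in> subs (?P (Suc (2 * N + 1)))"
      proof (cases "i \<ge> N")
        case True
        hence "?p i = ?p (Suc i)" using pS[of i] pS[of "Suc i"] by simp
        thus ?thesis unfolding sub using s
          by (intro CollectI exI[of _ "Suc i"] exI[of _ j] exI[of _ s]) auto
      next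
        case False
        hence "j \<ge> N" using s by simp
        hence "?p j = ?p (Suc j)" using pS[of j] pS[of "Suc j"] by simp
        thus ?thesis unfolding sub using s
          by (intro CollectI exI[of _ i] exI[of _ "Suc j"] exI[of _ s]) auto
      qed
    qed
    moreover have "low (?P (Suc (2 * N + 1))) = low (?P (2 * N + 1))"
      unfolding low using pS[of "Suc (2 * N + 1)"] pS[of "2 * N + 1"] by simp
    ultimately have "?P (Suc (2 * N + 1)) = ?P (2 * N + 1)"
      using wtypes_Suc(4)[OF PM] by metis
    thus ?case by blast
  qed
  thus ?thesis unfolding aperiodic_monoid_def
    by (intro conjI ballI) (simp_all add: finite_wtypes tone_wtypes tmult_wtypes tmult_assoc[of _ K] tmult_tone[of _ K] del: power_in.simps)
qed

section \<open>Types of components of a word and their composition\<close>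

primrec set_side :: "bool \<Rightarrow> nat \<Rightarrow> 'a wty \<Rightarrow> 'a wty" where
  "set_side c 0 x = Base {f. case f of Inl a \<Rightarrow> Inl a \<in> base x | Inr (p, b) \<Rightarrow> b = c \<and> (\<exists>b'. Inr (p, b') \<in> base x)}"
| "set_side c (Suc k) x = node (set_side c k (low x)) (set_side c k ` subs x)"

text \<open>\<open>S\<close> is a component of \<open>w\<close>, and \<open>sd\<close> assigns a
  side to its positions. Marks outside \<open>S\<close> are invisible: an atom counts only if all
  its marks lie in \<open>S\<close>.\<close>

definition facts :: "nat \<Rightarrow> 'a nword \<Rightarrow> (nat \<Rightarrow> bool) \<Rightarrow> nat set \<Rightarrow> (nat \<Rightarrow> nat) \<Rightarrow> 'a facts" where
  "facts K w sd S \<sigma> = Inl ` {a \<in> atoms K. \<sigma> ` fo_fv a \<subseteq> S \<and> fo_sat a w \<sigma>} \<union>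
     Inr ` {(p, sd (\<sigma> p)) | p. p < K \<and> \<sigma> p \<in> S}"

text \<open>The step from rank \<open>k\<close> to \<open>k + 1\<close> places the mark named
  \<open>k\<close>. Hence the marks below \<open>k\<close> are still available in a type of rank
  \<open>k\<close>, and no fresh names have to be chosen.\<close>

primrec wtype :: "nat \<Rightarrow> nat \<Rightarrow> 'a nword \<Rightarrow> (nat \<Rightarrow> bool) \<Rightarrow> nat set \<Rightarrow> (nat \<Rightarrow> nat) \<Rightarrow> 'a wty" where
  "wtype K 0 w sd S \<sigma> = Base (facts K w sd S \<sigma>)"
| "wtype K (Suc k) w sd S \<sigma> = node (wtype K k w sd S \<sigma>) ((\<lambda>b. wtype K k w sd S (\<sigma>(k := b))) ` S)"

lemma wtype_wtypes: "(wtype K k w sd S \<sigma> :: 'a::finite wty) \<in> wtypes K k"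
  by (induction k arbitrary: \<sigma>) (auto simp: facts_def all_facts_def)

lemma wtype_subs:
  "subs (wtype K (Suc k) (w :: 'a::finite nword) sd S \<sigma>) = (\<lambda>b. wtype K k w sd S (\<sigma>(k := b))) ` S"
proof -
  have "finite ((\<lambda>b. wtype K k w sd S (\<sigma>(k := b))) ` S)"
    by (rule finite_subset[OF _ finite_wtypes[of K k]]) (auto simp: wtype_wtypes)
  thus ?thesis by simp
qed

lemma wtype_iso:
  assumes "bij_betw h S S'"
    "\<And>i. i \<in> S \<Longrightarrow> lab w' (h i) = lab w i" "\<And>i. i \<in> S \<Longrightarrow> call w' (h i) = call w i"
    "\<And>i. i \<in> S \<Longrightarrow> ret w' (h i) = ret w i" "\<And>i. i \<in> S \<Longrightarrow> sd' (h i) = sd i"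
    "\<And>i j. i \<in> S \<Longrightarrow> j \<in> S \<Longrightarrow> mu w' (h i) (h j) = mu w i j"
    "\<And>i j. i \<in> S \<Longrightarrow> j \<in> S \<Longrightarrow> h i < h j \<longleftrightarrow> i < j"
    "\<And>p. p < K \<Longrightarrow> \<sigma> p \<in> S \<longleftrightarrow> \<sigma>' p \<in> S'" "\<And>p. p < K \<Longrightarrow> \<sigma> p \<in> S \<Longrightarrow> \<sigma>' p = h (\<sigma> p)"
  shows "wtype K k (w :: 'a::finite nword) sd S \<sigma> = wtype K k w' sd' S' \<sigma>'"
  using assms(8,9)
proof (induction k arbitrary: \<sigma> \<sigma>')
  case 0
  have inj: "h i = h j \<longleftrightarrow> i = j" if "i \<in> S" "j \<in> S" for i j
    using assms(1) that by (auto simp: bij_betw_def inj_on_def)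
  have "(\<sigma> ` fo_fv a \<subseteq> S \<and> fo_sat a w \<sigma>) = (\<sigma>' ` fo_fv a \<subseteq> S' \<and> fo_sat a w' \<sigma>')" if "a \<in> atoms K" for a
    using that by (rule atoms_cases) (auto simp: 0(1)[symmetric] 0(2) assms inj)
  hence "{a \<in> atoms K. \<sigma> ` fo_fv a \<subseteq> S \<and> fo_sat a w \<sigma>} = {a \<in> atoms K. \<sigma>' ` fo_fv a \<subseteq> S' \<and> fo_sat a w' \<sigma>'}" by auto
  moreover have "{(p, sd (\<sigma> p)) | p. p < K \<and> \<sigma> p \<in> S} = {(p, sd' (\<sigma>' p)) | p. p < K \<and> \<sigma>' p \<in> S'}"
    using 0 assms(5) by fastforce
  ultimately show ?case by (simp add: facts_def)
next
  case (Suc k)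
  have "wtype K k w sd S (\<sigma>(k := b)) = wtype K k w' sd' S' (\<sigma>'(k := h b))" if "b \<in> S" for b
    by (rule Suc.IH) (use that Suc.prems assms(1) in \<open>auto simp: bij_betw_def\<close>)
  hence "(\<lambda>b. wtype K k w sd S (\<sigma>(k := b))) ` S = (\<lambda>b. wtype K k w' sd' S' (\<sigma>'(k := b))) ` S'"
    using assms(1) by (force simp: bij_betw_def image_iff)
  thus ?case using Suc by simp
qed

lemma wtype_cong:
  assumes "\<And>i. i \<in> S \<Longrightarrow> sd' i = sd i" "\<And>p. p < K \<Longrightarrow> \<sigma> p \<in> S \<or> \<sigma>' p \<in> S \<Longrightarrow> \<sigma>' p = \<sigma> p"
  shows "wtype K k (w :: 'a::finite nword) sd S \<sigma> = wtype K k w sd' S \<sigma>'"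
proof (rule wtype_iso[where h = id])
  show "\<sigma> p \<in> S \<longleftrightarrow> \<sigma>' p \<in> S" if "p < K" for p using assms(2)[OF that] by metis
  show "\<sigma>' p = id (\<sigma> p)" if "p < K" "\<sigma> p \<in> S" for p using assms(2) that by simp
qed (simp_all add: assms(1))

lemma wtype_induced:
  "wtype K k (induced (w :: 'a::finite nword) S) sd S \<sigma> = wtype K k w sd S \<sigma>"
  by (rule wtype_iso[where h = id]) (auto simp: induced_def)

lemma wtype_empty: "wtype K k (w :: 'a::finite nword) sd {} \<sigma> = tone k"
proof (induction k)
  case 0
  have "fo_fv a \<noteq> {}" if "a \<in> atoms K" for a :: "'a fo" using that by (rule atoms_cases) auto
  thus ?case by (auto simp: facts_def)
qed auto

text \<open>\<open>S\<close> may surround \<open>T\<close>: its positions with side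
  \<open>True\<close> precede all of \<open>T\<close>, the others follow. Matching edges across are
  excluded because a product of fact sets adds order facts only.\<close>

definition splits :: "'a nword \<Rightarrow> (nat \<Rightarrow> bool) \<Rightarrow> nat set \<Rightarrow> nat set \<Rightarrow> bool" where
  "splits w sd S T \<longleftrightarrow> S \<inter> T = {} \<and> (\<forall>i\<in>S. \<forall>j\<in>T. \<not> mu w i j \<and> \<not> mu w j i \<and> (if sd i then i < j else j < i))"

lemma facts_Un:
  assumes "splits w sd S T"
  shows "facts K w sd (S \<union> T) \<sigma> = facts_mult (facts K w sd S \<sigma>) (facts K w sd T \<sigma>)" (is "?L = ?R")
proof -
  have d: "i \<in> S \<Longrightarrow> i \<in> T \<Longrightarrow> False" for i using assms by (auto simp: splits_def)
  have sp: "\<not> mu w i j" "\<not> mu w j i" "i \<noteq> j" "i < j \<longleftrightarrow> sd i" "j < i \<longleftrightarrow> \<not> sd i" if "i \<in> S" "j \<in> T" for i j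
    using assms that unfolding splits_def by (metis order.asym nat_neq_iff)+
  have Inr: "Inr f \<in> ?L \<longleftrightarrow> Inr f \<in> ?R" for f
    by (auto simp: facts_def facts_mult_def)
  have pres: "(\<exists>b. Inr (q, b) \<in> facts K w sd X \<sigma>) \<longleftrightarrow> q < K \<and> \<sigma> q \<in> X"
    "Inr (q, b) \<in> facts K w sd X \<sigma> \<longleftrightarrow> q < K \<and> \<sigma> q \<in> X \<and> b = sd (\<sigma> q)" for q b X
    by (auto simp: facts_def)
  have at: "Inl a \<in> facts K w sd X \<sigma> \<longleftrightarrow> a \<in> atoms K \<and> \<sigma> ` fo_fv a \<subseteq> X \<and> fo_sat a w \<sigma>" for a X
    by (auto simp: facts_def)
  have Inl: "Inl a \<in> ?L \<longleftrightarrow> Inl a \<in> ?R" for a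
  proof (cases "a \<in> atoms K")
    case True
    have "Inl a \<in> ?R \<longleftrightarrow> Inl a \<in> facts K w sd S \<sigma> \<or> Inl a \<in> facts K w sd T \<sigma> \<or>
      (\<exists>p q. a = FLess p q \<and> (p < K \<and> \<sigma> p \<in> S \<and> sd (\<sigma> p) \<and> q < K \<and> \<sigma> q \<in> T \<or>
         q < K \<and> \<sigma> q \<in> S \<and> \<not> sd (\<sigma> q) \<and> p < K \<and> \<sigma> p \<in> T))"
      unfolding facts_mult_def pres by (auto simp: pres)
    thus ?thesis using True unfolding at
      by (rule_tac atoms_cases[OF True]) (auto simp: sp dest: d)
  next
    case False
    thus ?thesis by (auto simp: facts_mult_def at pres)
  qed
  show ?thesis
  proof (rule set_eqI)
    fix x show "x \<in> ?L \<longleftrightarrow> x \<in> ?R" using Inl Inr by (cases x) auto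
  qed
qed

text \<open>Placing a mark in one component leaves the other unchanged only if the mark was not
  there before, since its old value is overwritten. This is why the marks still to be placed must
  lie outside both components.\<close>

lemma wtype_Un:
  assumes "splits w sd S T" "\<And>j. j < k \<Longrightarrow> \<sigma> j \<notin> S \<union> T"
  shows "wtype K k (w :: 'a::finite nword) sd (S \<union> T) \<sigma> = tmult k (wtype K k w sd S \<sigma>) (wtype K k w sd T \<sigma>)"
  using assms(2)
proof (induction k arbitrary: \<sigma>)
  case 0
  then show ?case using assms(1) by (simp add: facts_Un)
next
  case (Suc k)
  have d: "i \<in> S \<Longrightarrow> i \<in> T \<Longrightarrow> False" for i using assms(1) by (auto simp: splits_def)
  have S: "wtype K k w sd (S \<union> T) (\<sigma>(k := b)) = tmult k (wtype K k w sd S (\<sigma>(k := b))) (wtype K k w sd T \<sigma>)" if "b \<in> S" for b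
  proof -
    have "wtype K k w sd T (\<sigma>(k := b)) = wtype K k w sd T \<sigma>"
      by (rule wtype_cong) (use d Suc.prems that in \<open>auto split: if_splits\<close>)
    moreover have "(\<sigma>(k := b)) j \<notin> S \<union> T" if "j < k" for j using Suc.prems[of j] that by simp
    ultimately show ?thesis using Suc.IH[of "\<sigma>(k := b)"] by (simp del: fun_upd_apply)
  qed
  have T: "wtype K k w sd (S \<union> T) (\<sigma>(k := b)) = tmult k (wtype K k w sd S \<sigma>) (wtype K k w sd T (\<sigma>(k := b)))" if "b \<in> T" for b
  proof -
    have "wtype K k w sd S (\<sigma>(k := b)) = wtype K k w sd S \<sigma>"
      by (rule wtype_cong) (use d Suc.prems that in \<open>auto split: if_splits\<close>)
    moreover have "(\<sigma>(k := b)) j \<notin> S \<union> T" if "j < k" for j using Suc.prems[of j] that by simp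
    ultimately show ?thesis using Suc.IH[of "\<sigma>(k := b)"] by (simp del: fun_upd_apply)
  qed
  have "(\<lambda>b. wtype K k w sd (S \<union> T) (\<sigma>(k := b))) ` (S \<union> T) =
     (\<lambda>b. tmult k (wtype K k w sd S (\<sigma>(k := b))) (wtype K k w sd T \<sigma>)) ` S \<union>
     (\<lambda>b. tmult k (wtype K k w sd S \<sigma>) (wtype K k w sd T (\<sigma>(k := b)))) ` T"
    unfolding image_Un by (intro arg_cong2[of _ _ _ _ "(\<union>)"] image_cong) (auto simp: S T)
  thus ?case using Suc.IH[of \<sigma>] Suc.prems
    by (simp add: wtype_subs image_image del: wtype.simps(2)) (simp add: image_image)
qed

text \<open>Sides only steer later products and are independent of the atoms inside the component.
  They can therefore be overwritten on the level of types when a component is reused in another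
  place.\<close>

lemma wtype_set_side: "wtype K k (w :: 'a::finite nword) (\<lambda>_. c) S \<sigma> = set_side c k (wtype K k w sd S \<sigma>)"
proof (induction k arbitrary: \<sigma>)
  case 0
  have "{f. case f of Inl a \<Rightarrow> Inl a \<in> facts K w sd S \<sigma> | Inr (p, b) \<Rightarrow> b = c \<and> (\<exists>b'. Inr (p, b') \<in> facts K w sd S \<sigma>)}
    = facts K w (\<lambda>_. c) S \<sigma>"
    (is "?L = ?R")
  proof (rule set_eqI)
    fix x show "x \<in> ?L \<longleftrightarrow> x \<in> ?R" by (cases x) (auto simp: facts_def)
  qed
  then show ?case by (simp only: set_side.simps wtype.simps base.simps)
next
  case (Suc k)
  show ?case unfolding set_side.simps wtype_subs by (simp only: wtype.simps low_node image_image Suc)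
qed

section \<open>Formulas of bounded quantifier rank see only the type\<close>

primrec qrank :: "'a fo \<Rightarrow> nat" where
  "qrank (FEq x y) = 0"
| "qrank (FLess x y) = 0"
| "qrank (FLetter a x) = 0"
| "qrank (FMu x y) = 0"
| "qrank (FCall x) = 0"
| "qrank (FRet x) = 0"
| "qrank (FNot \<phi>) = qrank \<phi>"
| "qrank (FOr \<phi> \<psi>) = max (qrank \<phi>) (qrank \<psi>)"
| "qrank (FEx x \<phi>) = Suc (qrank \<phi>)"

lemma wtype_facts: "wtype K k (w :: 'a::finite nword) sd S \<sigma> = wtype K k w' sd' S' \<sigma>' \<Longrightarrow> facts K w sd S \<sigma> = facts K w' sd' S' \<sigma>'"
  by (induction k) (auto dest: arg_cong[of _ _ low])

lemma facts_atom:
  assumes "facts K w sd (univ w) \<sigma> = facts K w' sd' (univ w') \<sigma>'" "a \<in> atoms K"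
    "\<sigma> ` fo_fv a \<subseteq> univ w" "\<sigma>' ` fo_fv a \<subseteq> univ w'"
  shows "fo_sat a w \<sigma> = fo_sat a w' \<sigma>'"
proof -
  have "Inl a \<in> facts K w sd (univ w) \<sigma> \<longleftrightarrow> Inl a \<in> facts K w' sd' (univ w') \<sigma>'" using assms(1) by simp
  thus ?thesis using assms(2-4) by (auto simp: facts_def)
qed

lemma fo_sat_cong: "(\<And>v. v \<in> fo_fv \<psi> \<Longrightarrow> \<sigma> v = \<tau> v) \<Longrightarrow> fo_sat \<psi> w \<sigma> = fo_sat \<psi> w \<tau>"
proof (induction \<psi> arbitrary: \<sigma> \<tau>)
  case (FEx x \<psi>)
  have "fo_sat \<psi> w (\<sigma>(x := i)) = fo_sat \<psi> w (\<tau>(x := i))" for i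
    by (rule FEx.IH) (use FEx.prems in auto)
  then show ?case by simp
next
  case (FOr \<psi>1 \<psi>2)
  show ?case using FOr.IH(1)[of \<sigma> \<tau>] FOr.IH(2)[of \<sigma> \<tau>] FOr.prems by auto
next
  case (FNot \<psi>)
  show ?case using FNot.IH[of \<sigma> \<tau>] FNot.prems by auto
qed auto

text \<open>The renaming \<open>\<rho>\<close> sends variables to marks from \<open>k\<close> on, so
  the outermost quantifier can use the mark \<open>k - 1\<close>. Variables that are bound
  repeatedly cause no conflict, as \<open>\<rho>\<close> is updated at every quantifier.\<close>

lemma fo_sat_wtype:
  assumes "qrank \<psi> \<le> k" "wtype K k (w :: 'a::finite nword) sd (univ w) \<sigma> = wtype K k w' sd' (univ w') \<sigma>'"
    "\<And>v. v \<in> fo_fv \<psi> \<Longrightarrow> k \<le> \<rho> v \<and> \<rho> v < K \<and> \<sigma> (\<rho> v) \<in> univ w \<and> \<sigma>' (\<rho> v) \<in> univ w'" "k \<le> K"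
  shows "fo_sat \<psi> w (\<sigma> \<circ> \<rho>) = fo_sat \<psi> w' (\<sigma>' \<circ> \<rho>)"
  using assms
proof (induction \<psi> arbitrary: k \<sigma> \<sigma>' \<rho>)
  case (FEx x \<psi>)
  then obtain k' where k: "k = Suc k'" by (cases k) auto
  have eq: "(\<lambda>b. wtype K k' w sd (univ w) (\<sigma>(k' := b))) ` univ w = (\<lambda>b. wtype K k' w' sd' (univ w') (\<sigma>'(k' := b))) ` univ w'"
    using arg_cong[OF FEx.prems(2)[unfolded k], of subs] unfolding wtype_subs .
  have IH: "fo_sat \<psi> w ((\<sigma> \<circ> \<rho>)(x := b)) = fo_sat \<psi> w' ((\<sigma>' \<circ> \<rho>)(x := b'))"
    if "b \<in> univ w" "b' \<in> univ w'" "wtype K k' w sd (univ w) (\<sigma>(k' := b)) = wtype K k' w' sd' (univ w') (\<sigma>'(k' := b'))" for b b'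
  proof -
    have "fo_sat \<psi> w (\<sigma>(k' := b) \<circ> \<rho>(x := k')) = fo_sat \<psi> w' (\<sigma>'(k' := b') \<circ> \<rho>(x := k'))"
      by (rule FEx.IH) (use FEx.prems that k in \<open>force+\<close>)
    moreover have "fo_sat \<psi> w (\<sigma>(k' := b) \<circ> \<rho>(x := k')) = fo_sat \<psi> w ((\<sigma> \<circ> \<rho>)(x := b))" for \<sigma> b and w :: "'a nword"
    proof (rule fo_sat_cong)
      fix v assume "v \<in> fo_fv \<psi>"
      thus "(\<sigma>(k' := b) \<circ> \<rho>(x := k')) v = ((\<sigma> \<circ> \<rho>)(x := b)) v"
        using FEx.prems(3)[of v] k by (cases "v = x") auto
    qed
    ultimately show ?thesis by simp
  qed
  show ?case
  proof
    assume "fo_sat (FEx x \<psi>) w (\<sigma> \<circ> \<rho>)"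
    then obtain b where b: "b \<in> univ w" "fo_sat \<psi> w ((\<sigma> \<circ> \<rho>)(x := b))" by auto
    from b(1) eq obtain b' where "b' \<in> univ w'" "wtype K k' w sd (univ w) (\<sigma>(k' := b)) = wtype K k' w' sd' (univ w') (\<sigma>'(k' := b'))"
      by (metis (no_types, lifting) imageE imageI)
    thus "fo_sat (FEx x \<psi>) w' (\<sigma>' \<circ> \<rho>)" using IH b by auto
  next
    assume "fo_sat (FEx x \<psi>) w' (\<sigma>' \<circ> \<rho>)"
    then obtain b where b: "b \<in> univ w'" "fo_sat \<psi> w' ((\<sigma>' \<circ> \<rho>)(x := b))" by auto
    from b(1) eq obtain b' where "b' \<in> univ w" "wtype K k' w sd (univ w) (\<sigma>(k' := b')) = wtype K k' w' sd' (univ w') (\<sigma>'(k' := b))"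
      by (metis (no_types, lifting) imageE imageI)
    thus "fo_sat (FEx x \<psi>) w (\<sigma> \<circ> \<rho>)" using IH b by auto
  qed
next
  case (FNot \<psi>)
  then show ?case using FNot.IH[of k \<sigma> \<sigma>' \<rho>] by simp
next
  case (FOr \<psi>1 \<psi>2)
  then show ?case using FOr.IH(1)[of k \<sigma> \<sigma>' \<rho>] FOr.IH(2)[of k \<sigma> \<sigma>' \<rho>] by simp
next
  case (FEq x y)
  show ?case using facts_atom[OF wtype_facts[OF FEq.prems(2)], of "FEq (\<rho> x) (\<rho> y)"] FEq.prems(3) by simp
next
  case (FLess x y)
  show ?case using facts_atom[OF wtype_facts[OF FLess.prems(2)], of "FLess (\<rho> x) (\<rho> y)"] FLess.prems(3) by simp
next
  case (FLetter a x)
  show ?case using facts_atom[OF wtype_facts[OF FLetter.prems(2)], of "FLetter a (\<rho> x)"] FLetter.prems(3) by simp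
next
  case (FMu x y)
  show ?case using facts_atom[OF wtype_facts[OF FMu.prems(2)], of "FMu (\<rho> x) (\<rho> y)"] FMu.prems(3) by simp
next
  case (FCall x)
  show ?case using facts_atom[OF wtype_facts[OF FCall.prems(2)], of "FCall (\<rho> x)"] FCall.prems(3) by simp
next
  case (FRet x)
  show ?case using facts_atom[OF wtype_facts[OF FRet.prems(2)], of "FRet (\<rho> x)"] FRet.prems(3) by simp
qed

section \<open>Blocks and siblings in nested words\<close>

text \<open>Unlike \<open>nested_word\<close>, this property passes to subwords, which need not
  start at \<open>1\<close>. Excluding position \<open>0\<close> provides a value for marks that are
  not set.\<close>

definition good :: "'a nword \<Rightarrow> bool" where
  "good w \<longleftrightarrow> 0 \<notin> univ w \<and> (\<forall>i\<in>univ w. \<forall>k\<in>univ w. {i..k} \<subseteq> univ w) \<and>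
     matching_on (univ w) (mu w) (call w) (ret w)"

definition encloses :: "'a nword \<Rightarrow> nat \<Rightarrow> nat \<Rightarrow> nat \<Rightarrow> bool" where
  "encloses w c d i \<longleftrightarrow> mu w c d \<and> c < i \<and> i < d"

definition top_pos :: "'a nword \<Rightarrow> nat \<Rightarrow> bool" where
  "top_pos w i \<longleftrightarrow> (\<nexists>c d. encloses w c d i)"

text \<open>In contrast to an abstract step, the step to the next position is also allowed from an
  unmatched call. The call and the return of a matched pair count as two consecutive
  siblings.\<close>

definition sib :: "'a nword \<Rightarrow> nat \<Rightarrow> nat \<Rightarrow> bool" where
  "sib w i j \<longleftrightarrow> i \<in> univ w \<and> j \<in> univ w \<and>
     (mu w i j \<or> \<not> matched_call w i \<and> \<not> matched_ret w (i + 1) \<and> j = i + 1)"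

text \<open>\<open>lo\<close> and \<open>hi\<close> delimit the block of \<open>y\<close>: the
  matched pair that \<open>y\<close> begins or ends, or \<open>y\<close> alone.\<close>

definition lo :: "'a nword \<Rightarrow> nat \<Rightarrow> nat" where
  "lo w y = (if matched_ret w y then THE i. mu w i y else y)"

definition hi :: "'a nword \<Rightarrow> nat \<Rightarrow> nat" where
  "hi w y = (if matched_call w y then ret_of w y else y)"

text \<open>Quantifying over all enclosing pairs avoids naming the innermost one and covers top
  positions, which have none.\<close>

definition left_sibs :: "'a nword \<Rightarrow> nat \<Rightarrow> nat set" where
  "left_sibs w y = {k \<in> univ w. k < lo w y \<and> (\<forall>c d. encloses w c d y \<longrightarrow> c < k)}"

definition right_sibs :: "'a nword \<Rightarrow> nat \<Rightarrow> nat set" where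
  "right_sibs w y = {k \<in> univ w. hi w y < k \<and> (\<forall>c d. encloses w c d y \<longrightarrow> k < d)}"

text \<open>A block must be counted once although both its ends are siblings: forwards at its call,
  so that the return contributes nothing, and in \<open>itemB\<close> backwards at its
  return.\<close>

definition itemF :: "'a nword \<Rightarrow> nat \<Rightarrow> nat set" where
  "itemF w y = (if matched_ret w y then {} else {y..hi w y})"

definition itemB :: "'a nword \<Rightarrow> nat \<Rightarrow> nat set" where
  "itemB w y = (if matched_call w y then {} else {lo w y..y})"

section \<open>Nesting of matched pairs in a fixed word\<close>

context
  fixes w :: "'a nword"
  assumes good: "good w"
begin

lemma mu_univ: "mu w i j \<Longrightarrow> i \<in> univ w \<and> j \<in> univ w \<and> i < j \<and> call w i \<and> ret w j"
  using good unfolding good_def matching_on_def by blast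

lemma mu_fun: "mu w i j \<Longrightarrow> mu w i j' \<Longrightarrow> j = j'"
  using good unfolding good_def matching_on_def by blast

lemma mu_inj: "mu w i j \<Longrightarrow> mu w i' j \<Longrightarrow> i = i'"
  using good unfolding good_def matching_on_def by blast

lemma mu_between: "i \<le> j \<Longrightarrow> call w i \<Longrightarrow> ret w j \<Longrightarrow> \<exists>k. i \<le> k \<and> k \<le> j \<and> (mu w i k \<or> mu w k j)"
  using good unfolding good_def matching_on_def by (meson atLeastAtMost_iff)

lemma univ_convex: "i \<in> univ w \<Longrightarrow> k \<in> univ w \<Longrightarrow> i \<le> j \<Longrightarrow> j \<le> k \<Longrightarrow> j \<in> univ w"
  using good unfolding good_def by (meson atLeastAtMost_iff subset_iff)

lemma univ_interval: "i \<in> univ w \<Longrightarrow> k \<in> univ w \<Longrightarrow> {i..k} \<subseteq> univ w"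
  using good unfolding good_def by blast

lemma call_ret_univ: "call w i \<Longrightarrow> i \<in> univ w" "ret w i \<Longrightarrow> i \<in> univ w"
  using good unfolding good_def matching_on_def by blast+

lemma zero_notin: "0 \<notin> univ w"
  using good unfolding good_def by blast

lemma ret_of_eq: "mu w i j \<Longrightarrow> ret_of w i = j"
  unfolding ret_of_def by (rule the_equality) (auto intro: mu_fun)

lemma call_of_eq: "mu w i j \<Longrightarrow> (THE i. mu w i j) = i"
  by (rule the_equality) (auto intro: mu_inj)

lemma matched_call_mu: "matched_call w i \<longleftrightarrow> mu w i (ret_of w i)"
  unfolding matched_call_def using ret_of_eq by blast

text \<open>Applied to a call and a return at the same position, the matching axiom would yield an
  edge from \<open>i\<close> to itself.\<close>

lemma not_call_ret: "call w i \<Longrightarrow> ret w i \<Longrightarrow> False"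
  using mu_between[of i i] mu_univ by (metis le_antisym less_irrefl order.refl)

text \<open>The call \<open>c'\<close> and the return \<open>d\<close> behind it force one of them
  to have its partner in \<open>{c'..d}\<close>. The partner of \<open>d\<close> is
  \<open>c\<close>, which lies outside.\<close>

lemma nest: "mu w c d \<Longrightarrow> mu w c' d' \<Longrightarrow> c < c' \<Longrightarrow> c' < d \<Longrightarrow> d' < d"
proof -
  assume a: "mu w c d" "mu w c' d'" "c < c'" "c' < d"
  then obtain k where k: "c' \<le> k" "k \<le> d" "mu w c' k \<or> mu w k d"
    using mu_between[of c' d] mu_univ by (meson less_imp_le)
  have "mu w c' k" using k a mu_inj[of k d c] by auto
  hence "k = d'" using a mu_fun by blast
  moreover have "d' \<noteq> d" using a mu_inj by blast
  ultimately show "d' < d" using k by simp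
qed

text \<open>The matching axiom for \<open>i\<close> and the return \<open>d\<close> yields a partner
  of \<open>i\<close>, because \<open>d\<close> already belongs to \<open>c\<close>. So unmatched
  calls occur at the top level only.\<close>

lemma inside_call:
  assumes "encloses w c d i" "call w i"
  shows "matched_call w i"
proof -
  have e: "mu w c d" "c < i" "i < d" using assms by (auto simp: encloses_def)
  then obtain k where k: "i \<le> k" "mu w i k \<or> mu w k d"
    using mu_between[of i d] assms mu_univ[OF e(1)] by auto
  thus ?thesis using mu_inj[OF e(1), of k] e by (auto simp: matched_call_def)
qed

lemma encloses_mu: "mu w a b \<Longrightarrow> encloses w c d a \<longleftrightarrow> encloses w c d b"
proof -
  assume ab: "mu w a b"
  note u = mu_univ[OF ab]
  show ?thesis
  proof
    assume e: "encloses w c d a"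
    thus "encloses w c d b" using nest[of c d a b] ab u by (auto simp: encloses_def)
  next
    assume e: "encloses w c d b"
    hence m: "mu w c d" "c < b" "b < d" by (auto simp: encloses_def)
    have "\<not> a < c" using nest[OF ab m(1)] m by auto
    moreover have "a \<noteq> c" using mu_fun[OF ab] m by auto
    ultimately show "encloses w c d a" using m u by (auto simp: encloses_def)
  qed
qed

lemma encloses_sib: "sib w i j \<Longrightarrow> encloses w c d i \<longleftrightarrow> encloses w c d j"
  unfolding sib_def
proof (elim conjE disjE)
  assume "\<not> matched_call w i" "\<not> matched_ret w (i + 1)" "j = i + 1"
  moreover have "c \<noteq> i" "d \<noteq> i + 1" if "mu w c d"
    using that \<open>\<not> matched_call w i\<close> \<open>\<not> matched_ret w (i + 1)\<close> by (auto simp: matched_call_def matched_ret_def)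
  ultimately show ?thesis unfolding encloses_def by auto
qed (rule encloses_mu)

lemma sib_less: "sib w i j \<Longrightarrow> i < j"
  unfolding sib_def using mu_univ by auto

lemma sib_fun: "sib w i j \<Longrightarrow> sib w i j' \<Longrightarrow> j = j'"
  unfolding sib_def matched_call_def using mu_fun by blast

lemma sib_inj: "sib w i j \<Longrightarrow> sib w i' j \<Longrightarrow> i = i'"
  unfolding sib_def matched_ret_def using mu_inj by auto

lemma blk_cases:
  obtains "\<not> matched_call w y" "\<not> matched_ret w y" "lo w y = y" "hi w y = y"
  | d where "mu w y d" "\<not> matched_ret w y" "lo w y = y" "hi w y = d"
  | c where "mu w c y" "\<not> matched_call w y" "lo w y = c" "hi w y = y"
proof -
  have "\<not> (matched_call w y \<and> matched_ret w y)"
    using not_call_ret mu_univ unfolding matched_call_def matched_ret_def by blast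
  thus thesis using that unfolding lo_def hi_def
    by (cases "matched_call w y"; cases "matched_ret w y")
      (auto simp: matched_call_mu matched_ret_def call_of_eq)
qed

lemma lo_hi: "lo w y \<le> y" "y \<le> hi w y" "y \<in> univ w \<Longrightarrow> lo w y \<in> univ w" "y \<in> univ w \<Longrightarrow> hi w y \<in> univ w"
  by (rule blk_cases[of y]; use mu_univ in force)+

lemma blk_univ: "y \<in> univ w \<Longrightarrow> {lo w y..hi w y} \<subseteq> univ w"
  using lo_hi univ_interval by blast

lemma block_closed: "mu w c d \<Longrightarrow> mu w a b \<Longrightarrow> a \<in> {c..d} \<longleftrightarrow> b \<in> {c..d}"
proof -
  assume m: "mu w c d" "mu w a b"
  note u = mu_univ[OF m(1)] mu_univ[OF m(2)]
  consider "a = c" | "a < c" "b < c" | "a < c" "b = c" | "a < c" "c < b" | "c < a" "a < d" | "a = d" | "d < a" using u by linarith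
  thus ?thesis
  proof cases
    case 1 thus ?thesis using m u mu_fun by auto
  next
    case 3 thus ?thesis using u not_call_ret by blast
  next
    case 4 thus ?thesis using nest[OF m(2,1)] u by auto
  next
    case 5 thus ?thesis using nest[OF m] u by auto
  next
    case 6 thus ?thesis using u not_call_ret by blast
  qed (use u in auto)
qed

lemma blk_closed: "mu w a b \<Longrightarrow> a \<in> {lo w y..hi w y} \<longleftrightarrow> b \<in> {lo w y..hi w y}"
  by (rule blk_cases[of y]) (use block_closed in \<open>auto simp: matched_call_def matched_ret_def\<close>)

lemma encloses_blk: "encloses w c d y \<Longrightarrow> k \<in> {lo w y..hi w y} \<Longrightarrow> encloses w c d k"
proof -
  assume a: "encloses w c d y" "k \<in> {lo w y..hi w y}"
  show ?thesis
  proof (rule blk_cases[of y])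
    fix d' assume *: "mu w y d'" "lo w y = y" "hi w y = d'"
    have "encloses w c d d'" using encloses_mu[OF *(1)] a by simp
    thus ?thesis using a * by (auto simp: encloses_def)
  next
    fix c' assume *: "mu w c' y" "lo w y = c'" "hi w y = y"
    have "encloses w c d c'" using encloses_mu[OF *(1)] a by simp
    thus ?thesis using a * by (auto simp: encloses_def)
  qed (use a in auto)
qed

text \<open>A step along the siblings peels one item off the front, in the form that
  \<open>wtype_Un\<close> expects. If the step goes from a call to its return, the item is empty and
  nothing changes.\<close>

lemma right_sibs_step:
  assumes "sib w y j"
  shows "right_sibs w y = itemF w j \<union> right_sibs w j \<and> splits w (\<lambda>_. True) (itemF w j) (right_sibs w j)"
proof (cases "mu w y j")
  case True
  hence "matched_ret w j" "hi w y = j" "hi w j = j"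
    using mu_univ[OF True] ret_of_eq[OF True] not_call_ret mu_univ
    by (auto simp: matched_ret_def matched_call_def hi_def)
  thus ?thesis using encloses_sib[OF assms] by (auto simp: right_sibs_def itemF_def splits_def)
next
  case False
  hence j: "\<not> matched_call w y" "\<not> matched_ret w j" "j = y + 1" "j \<in> univ w" using assms by (auto simp: sib_def)
  have h: "hi w y = y" "lo w j = j" using j by (auto simp: hi_def lo_def)
  have i: "itemF w j = {lo w j..hi w j}" using j h by (auto simp: itemF_def)
  have "right_sibs w y = {lo w j..hi w j} \<union> right_sibs w j"
  proof (intro equalityI subsetI)
    fix k assume "k \<in> right_sibs w y"
    thus "k \<in> {lo w j..hi w j} \<union> right_sibs w j" using h j encloses_sib[OF assms] by (auto simp: right_sibs_def)
  next
    fix k assume "k \<in> {lo w j..hi w j} \<union> right_sibs w j"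
    thus "k \<in> right_sibs w y"
    proof
      assume k: "k \<in> {lo w j..hi w j}"
      have "k < d" if "encloses w c d y" for c d
        using encloses_blk[OF _ k, of c d] encloses_sib[OF assms] that by (auto simp: encloses_def)
      thus ?thesis using k h j blk_univ[OF j(4)] by (auto simp: right_sibs_def)
    next
      assume "k \<in> right_sibs w j"
      thus ?thesis using h j encloses_sib[OF assms] lo_hi(2)[of j] by (auto simp: right_sibs_def)
    qed
  qed
  moreover have "splits w (\<lambda>_. True) {lo w j..hi w j} (right_sibs w j)"
    using blk_closed[of _ _ j] unfolding splits_def right_sibs_def by fastforce
  ultimately show ?thesis using i by simp
qed

text \<open>A position without a next sibling is followed by the end of the word or by the return of
  its enclosing pair.\<close>

lemma right_sibs_end:
  assumes "y \<in> univ w" "\<nexists>j. sib w y j"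
  shows "right_sibs w y = {}"
proof -
  have y: "\<not> matched_call w y" using assms mu_univ unfolding matched_call_def sib_def by blast
  have "y + 1 \<notin> univ w \<or> matched_ret w (y + 1)" using assms y by (auto simp: sib_def)
  thus ?thesis
  proof
    assume "y + 1 \<notin> univ w"
    hence "k \<notin> univ w" if "y < k" for k using univ_convex[OF assms(1), of k "y + 1"] that by auto
    thus ?thesis using y by (auto simp: right_sibs_def hi_def)
  next
    assume "matched_ret w (y + 1)"
    then obtain c where c: "mu w c (y + 1)" by (auto simp: matched_ret_def)
    hence "encloses w c (y + 1) y" using y mu_univ[OF c] by (auto simp: encloses_def matched_call_def less_Suc_eq)
    thus ?thesis using y by (fastforce simp: right_sibs_def hi_def)
  qed
qed

lemma left_sibs_step:
  assumes "sib w j y"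
  shows "left_sibs w y = left_sibs w j \<union> itemB w j \<and> splits w (\<lambda>_. True) (left_sibs w j) (itemB w j)"
proof (cases "mu w j y")
  case True
  hence "matched_call w j" "lo w y = j" "lo w j = j"
    using mu_univ[OF True] call_of_eq[OF True] not_call_ret mu_univ
    by (auto simp: matched_ret_def matched_call_def lo_def)
  thus ?thesis using encloses_sib[OF assms] by (auto simp: left_sibs_def itemB_def splits_def)
next
  case False
  hence j: "\<not> matched_call w j" "\<not> matched_ret w y" "y = j + 1" "j \<in> univ w" using assms by (auto simp: sib_def)
  have h: "lo w y = y" "hi w j = j" using j by (auto simp: hi_def lo_def)
  have i: "itemB w j = {lo w j..hi w j}" using j h by (auto simp: itemB_def)
  have "left_sibs w y = left_sibs w j \<union> {lo w j..hi w j}"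
  proof (intro equalityI subsetI)
    fix k assume "k \<in> left_sibs w y"
    thus "k \<in> left_sibs w j \<union> {lo w j..hi w j}" using h j encloses_sib[OF assms] by (auto simp: left_sibs_def)
  next
    fix k assume "k \<in> left_sibs w j \<union> {lo w j..hi w j}"
    thus "k \<in> left_sibs w y"
    proof
      assume k: "k \<in> {lo w j..hi w j}"
      have "c < k" if "encloses w c d y" for c d
        using encloses_blk[OF _ k, of c d] encloses_sib[OF assms] that by (auto simp: encloses_def)
      thus ?thesis using k h j blk_univ[OF j(4)] by (auto simp: left_sibs_def)
    next
      assume "k \<in> left_sibs w j"
      thus ?thesis using h j encloses_sib[OF assms] lo_hi(1)[of j] by (auto simp: left_sibs_def)
    qed
  qed
  moreover have "splits w (\<lambda>_. True) (left_sibs w j) {lo w j..hi w j}"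
    using blk_closed[of _ _ j] unfolding splits_def left_sibs_def by fastforce
  ultimately show ?thesis using i by simp
qed

lemma sib_pred:
  assumes "y \<in> univ w" "y - 1 \<in> univ w" "\<nexists>j. sib w j y"
  shows "matched_call w (y - 1) \<and> \<not> matched_ret w y \<and> (\<exists>d. encloses w (y - 1) d y)"
proof -
  have y0: "y \<noteq> 0" using assms zero_notin by metis
  have r: "\<not> matched_ret w y" using assms mu_univ unfolding matched_ret_def sib_def by blast
  have c: "matched_call w (y - 1)" using assms r y0 by (auto simp: sib_def)
  then obtain d where d: "mu w (y - 1) d" by (auto simp: matched_call_def)
  have "d \<noteq> y" "y - 1 < d" using r d mu_univ by (auto simp: matched_ret_def)
  hence "y < d" using y0 by linarith
  thus ?thesis using r c d y0 by (auto simp: encloses_def intro!: exI[of _ d])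
qed

lemma left_sibs_end:
  assumes "y \<in> univ w" "\<nexists>j. sib w j y"
  shows "left_sibs w y = {}"
proof (cases "y - 1 \<in> univ w")
  case True
  then obtain d where "\<not> matched_ret w y" "encloses w (y - 1) d y" using sib_pred assms by blast
  thus ?thesis by (fastforce simp: left_sibs_def lo_def)
next
  case False
  have r: "\<not> matched_ret w y" using assms mu_univ unfolding matched_ret_def sib_def by blast
  have "k \<notin> univ w" if "k < y" for k using univ_convex[OF _ assms(1), of k "y - 1"] that False by (metis Suc_diff_1 diff_le_self less_Suc_eq_le gr_implies_not0 neq0_conv)
  thus ?thesis using r by (auto simp: left_sibs_def lo_def)
qed

definition outside :: "nat \<Rightarrow> nat set" where
  "outside y = univ w - {lo w y..hi w y}"

lemma splits_blk: "splits w (\<lambda>j. j < lo w y) (outside y) {lo w y..hi w y}"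
proof -
  have "\<not> mu w i j \<and> \<not> mu w j i" if "i \<notin> {lo w y..hi w y}" "j \<in> {lo w y..hi w y}" for i j
    using that blk_closed[of i j y] blk_closed[of j i y] by blast
  thus ?thesis using lo_hi[of y] unfolding splits_def outside_def by auto
qed

text \<open>An edge from left to right would be a pair enclosing \<open>y\<close>, and then its call
  would have to lie behind itself by the definition of \<open>left_sibs\<close>.\<close>

lemma splits_left_sibs_right_sibs: "splits w (\<lambda>j. j < y) (left_sibs w y) (right_sibs w y)"
proof -
  have "\<not> mu w a b" if "a \<in> left_sibs w y" "b \<in> right_sibs w y" for a b
  proof
    assume "mu w a b"
    hence "encloses w a b y" using that lo_hi[of y] by (auto simp: encloses_def left_sibs_def right_sibs_def)
    thus False using that by (auto simp: left_sibs_def)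
  qed
  moreover have "a < b" "a < y" if "a \<in> left_sibs w y" "b \<in> right_sibs w y" for a b
    using that lo_hi[of y] by (auto simp: left_sibs_def right_sibs_def)
  ultimately show ?thesis unfolding splits_def using mu_univ by (fastforce dest: order.asym)
qed

lemma outside_top: "top_pos w y \<Longrightarrow> outside y = left_sibs w y \<union> right_sibs w y"
  by (auto simp: outside_def left_sibs_def right_sibs_def top_pos_def)

text \<open>Any other pair around \<open>y\<close> also surrounds \<open>c\<close> and
  \<open>d\<close>, so the innermost pair alone bounds the two sets of siblings, and they fill the
  room between this pair and the block of \<open>y\<close>.\<close>

lemma parent_block:
  assumes p: "encloses w c d y" "\<forall>c' d'. encloses w c' d' y \<longrightarrow> c' \<le> c" and y: "y \<in> univ w"
  shows "{c..d} = ({c, d} \<union> (left_sibs w y \<union> right_sibs w y)) \<union> {lo w y..hi w y}"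
    "({c, d} \<union> (left_sibs w y \<union> right_sibs w y)) \<inter> {lo w y..hi w y} = {}"
    "splits w (\<lambda>j. j < y) {c, d} (left_sibs w y \<union> right_sibs w y)"
proof -
  note m = mu_univ[of c d]
  have cd: "mu w c d" "c < y" "y < d" using p by (auto simp: encloses_def)
  have lh: "c < lo w y" "hi w y < d"
    using encloses_blk[OF p(1), of "lo w y"] encloses_blk[OF p(1), of "hi w y"] lo_hi[of y] by (auto simp: encloses_def)
  have le: "c' < c \<and> d < d' \<or> c' = c \<and> d' = d" if "encloses w c' d' y" for c' d'
    using p(2)[rule_format, OF that] that p(1) nest[of c' d' c d] mu_fun[of c]
    by (cases "c' = c") (auto simp: encloses_def)
  have L: "left_sibs w y = {c<..<lo w y}"
  proof (intro equalityI subsetI)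
    fix k assume "k \<in> {c<..<lo w y}"
    thus "k \<in> left_sibs w y" using le lo_hi[of y] y cd m univ_convex[of c d k] by (fastforce simp: left_sibs_def)
  qed (use p in \<open>auto simp: left_sibs_def\<close>)
  have R: "right_sibs w y = {hi w y<..<d}"
  proof (intro equalityI subsetI)
    fix k assume "k \<in> {hi w y<..<d}"
    thus "k \<in> right_sibs w y" using le lo_hi[of y] y cd m univ_convex[of c d k] by (fastforce simp: right_sibs_def)
  qed (use p in \<open>auto simp: right_sibs_def\<close>)
  show "{c..d} = ({c, d} \<union> (left_sibs w y \<union> right_sibs w y)) \<union> {lo w y..hi w y}"
    "({c, d} \<union> (left_sibs w y \<union> right_sibs w y)) \<inter> {lo w y..hi w y} = {}"
    unfolding L R using lh lo_hi[of y] by auto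
  have "\<not> mu w a b \<and> \<not> mu w b a" if "a \<in> {c, d}" "b \<in> {c<..<lo w y} \<union> {hi w y<..<d}" for a b
  proof -
    have b: "c < b" "b < d" using that lh lo_hi[of y] by auto
    have "\<not> mu w c b" "\<not> mu w b d" using mu_fun[OF cd(1), of b] mu_inj[OF cd(1), of b] b by auto
    moreover have "\<not> mu w b c" "\<not> mu w d b" using mu_univ[of b c] mu_univ[of d b] b by auto
    ultimately show ?thesis using that by auto
  qed
  thus "splits w (\<lambda>j. j < y) {c, d} (left_sibs w y \<union> right_sibs w y)"
    unfolding splits_def L R using cd lh lo_hi[of y] by auto
qed

text \<open>The context of the enclosing call surrounds the whole block \<open>{c..d}\<close>.
  Iterated, this gives a product with one layer per enclosing pair, ordered from the outermost
  inwards.\<close>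

lemma outside_parent:
  assumes p: "encloses w c d y" "\<forall>c' d'. encloses w c' d' y \<longrightarrow> c' \<le> c" and y: "y \<in> univ w"
  shows "outside y = outside c \<union> ({c, d} \<union> (left_sibs w y \<union> right_sibs w y))"
    "splits w (\<lambda>j. j < y) (outside c) ({c, d} \<union> (left_sibs w y \<union> right_sibs w y))"
proof -
  have cd: "mu w c d" "c < y" "y < d" using p by (auto simp: encloses_def)
  have lh: "lo w c = c" "hi w c = d"
    using cd ret_of_eq[OF cd(1)] not_call_ret mu_univ by (auto simp: lo_def hi_def matched_ret_def matched_call_def)
  note b = parent_block[OF p y]
  have u: "{c..d} \<subseteq> univ w" using mu_univ[OF cd(1)] univ_interval by blast
  have sub: "({c, d} \<union> (left_sibs w y \<union> right_sibs w y)) \<subseteq> {c..d}" using b(1) by blast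
  show "outside y = outside c \<union> ({c, d} \<union> (left_sibs w y \<union> right_sibs w y))"
    unfolding outside_def lh using b(1,2) u by blast
  show "splits w (\<lambda>j. j < y) (outside c) ({c, d} \<union> (left_sibs w y \<union> right_sibs w y))"
    unfolding splits_def
  proof (intro conjI ballI)
    show "outside c \<inter> ({c, d} \<union> (left_sibs w y \<union> right_sibs w y)) = {}" using sub unfolding outside_def lh by blast
    fix i j assume i: "i \<in> outside c" and "j \<in> ({c, d} \<union> (left_sibs w y \<union> right_sibs w y))"
    hence j: "j \<in> {c..d}" using sub by blast
    have i': "i \<notin> {c..d}" using i unfolding outside_def lh by blast
    show "\<not> mu w i j" "\<not> mu w j i" using block_closed[OF cd(1)] i' j by blast+
    show "if i < y then i < j else j < i" using i' j cd by auto
  qed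
qed

lemma par_exists:
  assumes "encloses w c d y"
  obtains c' d' where "encloses w c' d' y" "\<And>c'' d''. encloses w c'' d'' y \<Longrightarrow> c'' \<le> c'"
proof -
  let ?C = "{c. \<exists>d. encloses w c d y}"
  have "?C \<subseteq> {..<y}" by (auto simp: encloses_def)
  hence f: "finite ?C" using finite_subset by blast
  have "?C \<noteq> {}" using assms by auto
  hence "Max ?C \<in> ?C" using f Max_in by blast
  then obtain d' where "encloses w (Max ?C) d' y" by auto
  thus thesis using that f Max_ge by blast
qed

lemma enclosing_call_iff:
  "enclosing_call w y c \<longleftrightarrow> (\<exists>d. encloses w c d y) \<and> (\<forall>c' d'. encloses w c' d' y \<longrightarrow> c' \<le> c)"
  unfolding enclosing_call_def encloses_def using matched_call_mu ret_of_eq by (metis matched_call_def)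

lemma enclosing_call_fun: "enclosing_call w y c \<Longrightarrow> enclosing_call w y c' \<Longrightarrow> c = c'"
  unfolding enclosing_call_iff by (meson le_antisym)

end

section \<open>Restriction to subwords\<close>

lemma good_induced:
  assumes g: "good w" and S: "\<And>i j k. i \<in> S \<Longrightarrow> k \<in> S \<Longrightarrow> i \<le> j \<Longrightarrow> j \<le> k \<Longrightarrow> j \<in> S"
  shows "good (induced w S)"
  unfolding good_def induced_def nword.simps
proof (intro conjI ballI subsetI)
  show "0 \<notin> univ w \<inter> S" using zero_notin[OF g] by auto
  show "x \<in> univ w \<inter> S" if "i \<in> univ w \<inter> S" "k \<in> univ w \<inter> S" "x \<in> {i..k}" for i k x
    using that univ_convex[OF g, of i k x] S[of i k x] by simp
  show "matching_on (univ w \<inter> S) (\<lambda>i j. mu w i j \<and> i \<in> S \<and> j \<in> S) (\<lambda>i. call w i \<and> i \<in> S) (\<lambda>i. ret w i \<and> i \<in> S)"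
    unfolding matching_on_def
  proof (intro conjI allI impI)
    fix i j assume a: "i \<le> j" "call w i \<and> i \<in> S" "ret w j \<and> j \<in> S"
    then obtain k where "i \<le> k" "k \<le> j" "mu w i k \<or> mu w k j" using mu_between[OF g] by blast
    thus "\<exists>k\<in>{i..j}. mu w i k \<and> i \<in> S \<and> k \<in> S \<or> mu w k j \<and> k \<in> S \<and> j \<in> S"
      using S[of i j k] a by (intro bexI[of _ k]) auto
  qed (auto dest: call_ret_univ[OF g] mu_univ[OF g] mu_fun[OF g] mu_inj[OF g])
qed

lemma good_subword: "good w \<Longrightarrow> good (subword w i j)"
  unfolding subword_def
proof (rule good_induced)
  fix x y z assume "x \<in> {k. i \<le> k \<and> enat k \<le> j}" "z \<in> {k. i \<le> k \<and> enat k \<le> j}" "x \<le> y" "y \<le> z"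
  thus "y \<in> {k. i \<le> k \<and> enat k \<le> j}" using order.trans[of "enat y" "enat z" j] by simp
qed

lemma good_nested_word:
  assumes "nested_word w"
  shows "good w"
proof -
  have "(\<exists>n. univ w = {1..n}) \<or> univ w = {1..}" and m: "matching_on (univ w) (mu w) (call w) (ret w)"
    using assms unfolding nested_word_def finite_nested_word_def nested_omega_word_def by blast+
  thus ?thesis unfolding good_def by (elim disjE exE) simp_all
qed

section \<open>Definability in the temporal logic\<close>

declare path_step.simps [simp del]

type_synonym 'a point = "'a nword \<times> nat"

definition good_point :: "'a point \<Rightarrow> bool" where
  "good_point p \<longleftrightarrow> good (fst p) \<and> snd p \<in> univ (fst p)"

text \<open>One formula has to serve all good words at once: under \<open>Within\<close> it is
  evaluated in a subword of the given word.\<close>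

definition ldef :: "('a point \<Rightarrow> bool) \<Rightarrow> bool" where
  "ldef P \<longleftrightarrow> (\<exists>\<phi>. \<forall>w i. good w \<longrightarrow> i \<in> univ w \<longrightarrow> (P (w, i) \<longleftrightarrow> ltl_sat \<phi> w i))"

lemma ldefI: "(\<And>w i. good w \<Longrightarrow> i \<in> univ w \<Longrightarrow> P (w, i) \<longleftrightarrow> ltl_sat \<phi> w i) \<Longrightarrow> ldef P"
  unfolding ldef_def by blast

lemma ldefE:
  assumes "ldef P"
  obtains \<phi> where "\<And>w i. good w \<Longrightarrow> i \<in> univ w \<Longrightarrow> P (w, i) \<longleftrightarrow> ltl_sat \<phi> w i"
  using assms unfolding ldef_def by blast

lemma ldef_cong: "(\<And>w i. good w \<Longrightarrow> i \<in> univ w \<Longrightarrow> P (w, i) = Q (w, i)) \<Longrightarrow> ldef P \<Longrightarrow> ldef Q"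
  unfolding ldef_def by simp

lemma ldef_True: "ldef (\<lambda>_. True)"
  by (rule ldefI[of _ TT]) simp

lemma ldef_Not: "ldef P \<Longrightarrow> ldef (\<lambda>p. \<not> P p)"
  by (erule ldefE, rule_tac \<phi> = "Not \<phi>" in ldefI) simp

lemma ldef_disj: "ldef P \<Longrightarrow> ldef Q \<Longrightarrow> ldef (\<lambda>p. P p \<or> Q p)"
  by (elim ldefE, rule_tac \<phi> = "Or \<phi> \<phi>'" in ldefI) simp

lemma ldef_conj: "ldef P \<Longrightarrow> ldef Q \<Longrightarrow> ldef (\<lambda>p. P p \<and> Q p)"
  using ldef_Not[OF ldef_disj[OF ldef_Not ldef_Not]] by force

lemma ldef_const: "ldef (\<lambda>_. b)"
  using ldef_True ldef_Not[OF ldef_True] by (cases b) simp_all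

lemma ldef_Bex: "finite I \<Longrightarrow> (\<And>i. i \<in> I \<Longrightarrow> ldef (P i)) \<Longrightarrow> ldef (\<lambda>p. \<exists>i\<in>I. P i p)"
  by (induction I rule: finite_induct) (simp_all add: ldef_const ldef_disj)

lemma ldef_Ball: "finite I \<Longrightarrow> (\<And>i. i \<in> I \<Longrightarrow> ldef (P i)) \<Longrightarrow> ldef (\<lambda>p. \<forall>i\<in>I. P i p)"
  by (induction I rule: finite_induct) (simp_all add: ldef_const ldef_conj)

lemma ldef_call: "ldef (\<lambda>p. call (fst p) (snd p))"
  by (rule ldefI[of _ IsCall]) simp

lemma ldef_ret: "ldef (\<lambda>p. ret (fst p) (snd p))"
  by (rule ldefI[of _ IsRet]) simp

lemma ldef_lab: "ldef (\<lambda>p. lab (fst p) (snd p) = a)"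
  by (rule ldefI[of _ "Letter a"]) simp

lemma ldef_next: "ldef P \<Longrightarrow> ldef (\<lambda>p. snd p + 1 \<in> univ (fst p) \<and> P (fst p, snd p + 1))"
  by (erule ldefE, rule_tac \<phi> = "Next \<phi>" in ldefI) auto

lemma ldef_prev:
  assumes "ldef P"
  shows "ldef (\<lambda>p. \<exists>j. snd p = j + 1 \<and> j \<in> univ (fst p) \<and> P (fst p, j))"
  using assms by (rule ldefE) (rule_tac \<phi> = "Prev \<phi>" in ldefI, auto)

lemma ldef_next_mu:
  fixes P :: "'a point \<Rightarrow> bool"
  shows "ldef P \<Longrightarrow> ldef (\<lambda>p. \<exists>j. mu (fst p) (snd p) j \<and> P (fst p, j))"
proof (erule ldefE, rule_tac \<phi> = "NextMu \<phi>" in ldefI)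
  fix \<phi> and w :: "'a nword" and i assume *: "\<And>w i. good w \<Longrightarrow> i \<in> univ w \<Longrightarrow> P (w, i) = ltl_sat \<phi> w i" "good w"
  have "P (w, j) = ltl_sat \<phi> w (ret_of w i)" if "mu w i j" for j
    using * mu_univ[OF *(2) that] ret_of_eq[OF *(2) that] by simp
  thus "(\<exists>j. mu (fst (w, i)) (snd (w, i)) j \<and> P (fst (w, i), j)) = ltl_sat (NextMu \<phi>) w i"
    by (auto simp: matched_call_def)
qed

lemma ldef_prev_mu:
  fixes P :: "'a point \<Rightarrow> bool"
  shows "ldef P \<Longrightarrow> ldef (\<lambda>p. \<exists>j. mu (fst p) j (snd p) \<and> P (fst p, j))"
proof (erule ldefE, rule_tac \<phi> = "PrevMu \<phi>" in ldefI)
  fix \<phi> and w :: "'a nword" and i assume *: "\<And>w i. good w \<Longrightarrow> i \<in> univ w \<Longrightarrow> P (w, i) = ltl_sat \<phi> w i" "good w"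
  have "P (w, j) = ltl_sat \<phi> w j" if "mu w j i" for j
    using * mu_univ[OF *(2) that] by simp
  thus "(\<exists>j. mu (fst (w, i)) j (snd (w, i)) \<and> P (fst (w, i), j)) = ltl_sat (PrevMu \<phi>) w i" by auto
qed

lemma ldef_matched_call: "ldef (\<lambda>p. matched_call (fst p) (snd p))"
  using ldef_next_mu[OF ldef_True] by (simp add: matched_call_def)

lemma ldef_matched_ret: "ldef (\<lambda>p. matched_ret (fst p) (snd p))"
  using ldef_prev_mu[OF ldef_True] by (simp add: matched_ret_def)

lemma ldef_within:
  fixes P :: "'a point \<Rightarrow> bool"
  shows "ldef P \<Longrightarrow> ldef (\<lambda>p. matched_call (fst p) (snd p) \<and>
     P (induced (fst p) {snd p..ret_of (fst p) (snd p)}, snd p))"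
proof (erule ldefE)
  fix \<phi> assume *: "\<And>w i. good w \<Longrightarrow> i \<in> univ w \<Longrightarrow> P (w, i) = ltl_sat \<phi> w i"
  have "ldef (\<lambda>p. ltl_sat (Within \<phi>) (fst p) (snd p))"
    by (rule ldefI[of _ "Within \<phi>"]) simp
  from ldef_conj[OF ldef_matched_call this] show ?thesis
  proof (rule ldef_cong[rotated])
    fix w :: "'a nword" and i assume g: "good w" "i \<in> univ w"
    show "(matched_call (fst (w, i)) (snd (w, i)) \<and> ltl_sat (Within \<phi>) (fst (w, i)) (snd (w, i))) =
       (matched_call (fst (w, i)) (snd (w, i)) \<and> P (induced (fst (w, i)) {snd (w, i)..ret_of (fst (w, i)) (snd (w, i))}, snd (w, i)))"
    proof (cases "matched_call w i")
      case True
      hence m: "mu w i (ret_of w i)" using matched_call_mu[OF g(1)] by simp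
      have e: "subword w i (within_end w i) = induced w {i..ret_of w i}"
        using True by (auto simp: subword_def within_end_def atLeastAtMost_def atLeast_def atMost_def Int_def)
      have "good (induced w {i..ret_of w i})" using good_subword[OF g(1)] e by metis
      moreover have "i \<in> univ (induced w {i..ret_of w i})" using g mu_univ[OF g(1) m] by (simp add: induced_def)
      ultimately show ?thesis using True mu_univ[OF g(1) m] * e by simp
    qed simp
  qed
qed

section \<open>Until and since as reachability\<close>

definition ustep :: "'a nword \<Rightarrow> path_kind \<Rightarrow> nat \<Rightarrow> nat \<Rightarrow> bool" where
  "ustep w K a b \<longleftrightarrow> a \<in> univ w \<and> b \<in> univ w \<and> path_step w K a b"

lemma ustep_less: "good w \<Longrightarrow> ustep w K a b \<Longrightarrow> a < b"
  unfolding ustep_def by (cases K) (auto simp: path_step.simps enclosing_call_def matched_call_mu dest: mu_univ)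

lemma is_path_Cons2: "good w \<Longrightarrow> is_path w K (a # b # p) \<longleftrightarrow> ustep w K a b \<and> is_path w K (b # p)"
  using ustep_less[of w K a b] by (fastforce simp: is_path_def ustep_def)

lemma is_path_single: "is_path w K [a] \<longleftrightarrow> a \<in> univ w"
  by (auto simp: is_path_def)

lemma ustep_rtranclp_univ: "(\<lambda>a b. ustep w K a b \<and> R a b)\<^sup>*\<^sup>* i j \<Longrightarrow> i \<in> univ w \<Longrightarrow> j \<in> univ w"
  by (induction rule: rtranclp_induct) (auto simp: ustep_def)

lemma ustep_rtranclp_univ': "(\<lambda>a b. ustep w K a b \<and> R a b)\<^sup>*\<^sup>* i j \<Longrightarrow> j \<in> univ w \<Longrightarrow> i \<in> univ w"
  by (induction rule: converse_rtranclp_induct) (auto simp: ustep_def)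

lemma until_iff:
  assumes g: "good w" and i: "i \<in> univ w"
  shows "ltl_sat (Until K \<phi> \<psi>) w i \<longleftrightarrow> (\<exists>j. (\<lambda>a b. ustep w K a b \<and> ltl_sat \<phi> w a)\<^sup>*\<^sup>* i j \<and> ltl_sat \<psi> w j)"
proof -
  let ?R = "\<lambda>a b. ustep w K a b \<and> ltl_sat \<phi> w a"
  have 1: "is_path w K p \<Longrightarrow> \<forall>k\<in>set (butlast p). ltl_sat \<phi> w k \<Longrightarrow> ?R\<^sup>*\<^sup>* (hd p) (last p)" for p
  proof (induction p rule: induct_list012)
    case (3 a b p)
    then show ?case using is_path_Cons2[OF g] by (auto intro: converse_rtranclp_into_rtranclp)
  qed (auto simp: is_path_def)
  have 2: "?R\<^sup>*\<^sup>* i j \<Longrightarrow> j \<in> univ w \<Longrightarrow>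
     \<exists>p. is_path w K p \<and> hd p = i \<and> last p = j \<and> (\<forall>k\<in>set (butlast p). ltl_sat \<phi> w k)" for i j
  proof (induction rule: converse_rtranclp_induct)
    case base
    then show ?case by (intro exI[of _ "[j]"]) (simp add: is_path_single)
  next
    case (step y z)
    then obtain p where p: "is_path w K p" "hd p = z" "last p = j" "\<forall>k\<in>set (butlast p). ltl_sat \<phi> w k" by blast
    then obtain p' where "p = z # p'" by (cases p) (auto simp: is_path_def)
    thus ?case using p step is_path_Cons2[OF g, of K y z p'] by (intro exI[of _ "y # p"]) auto
  qed
  show ?thesis
  proof
    assume "ltl_sat (Until K \<phi> \<psi>) w i"
    then obtain p where "is_path w K p" "hd p = i" "ltl_sat \<psi> w (last p)" "\<forall>k\<in>set (butlast p). ltl_sat \<phi> w k"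
      by auto
    thus "\<exists>j. ?R\<^sup>*\<^sup>* i j \<and> ltl_sat \<psi> w j" using 1[of p] by blast
  next
    assume "\<exists>j. ?R\<^sup>*\<^sup>* i j \<and> ltl_sat \<psi> w j"
    then obtain j where j: "?R\<^sup>*\<^sup>* i j" "ltl_sat \<psi> w j" by blast
    have "j \<in> univ w" using ustep_rtranclp_univ[OF j(1) i] .
    from 2[OF j(1) this] j(2) show "ltl_sat (Until K \<phi> \<psi>) w i" by auto
  qed
qed

lemma since_iff:
  assumes g: "good w" and i: "i \<in> univ w"
  shows "ltl_sat (Since K \<phi> \<psi>) w i \<longleftrightarrow> (\<exists>j. (\<lambda>a b. ustep w K a b \<and> ltl_sat \<phi> w b)\<^sup>*\<^sup>* j i \<and> ltl_sat \<psi> w j)"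
proof -
  let ?R = "\<lambda>a b. ustep w K a b \<and> ltl_sat \<phi> w b"
  have 1: "is_path w K p \<Longrightarrow> \<forall>k\<in>set (tl p). ltl_sat \<phi> w k \<Longrightarrow> ?R\<^sup>*\<^sup>* (hd p) (last p)" for p
  proof (induction p rule: induct_list012)
    case (3 a b p)
    then show ?case using is_path_Cons2[OF g] by (auto intro: converse_rtranclp_into_rtranclp)
  qed (auto simp: is_path_def)
  have 2: "?R\<^sup>*\<^sup>* j i \<Longrightarrow> i \<in> univ w \<Longrightarrow>
     \<exists>p. is_path w K p \<and> hd p = j \<and> last p = i \<and> (\<forall>k\<in>set (tl p). ltl_sat \<phi> w k)" for j
  proof (induction rule: converse_rtranclp_induct)
    case base
    then show ?case by (intro exI[of _ "[i]"]) (simp add: is_path_single)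
  next
    case (step y z)
    then obtain p where p: "is_path w K p" "hd p = z" "last p = i" "\<forall>k\<in>set (tl p). ltl_sat \<phi> w k" by blast
    then obtain p' where "p = z # p'" by (cases p) (auto simp: is_path_def)
    thus ?case using p step is_path_Cons2[OF g, of K y z p'] by (intro exI[of _ "y # p"]) auto
  qed
  show ?thesis
  proof
    assume "ltl_sat (Since K \<phi> \<psi>) w i"
    then obtain p where "is_path w K p" "last p = i" "ltl_sat \<psi> w (hd p)" "\<forall>k\<in>set (tl p). ltl_sat \<phi> w k"
      by auto
    thus "\<exists>j. ?R\<^sup>*\<^sup>* j i \<and> ltl_sat \<psi> w j" using 1[of p] by blast
  next
    assume "\<exists>j. ?R\<^sup>*\<^sup>* j i \<and> ltl_sat \<psi> w j"
    then obtain j where j: "?R\<^sup>*\<^sup>* j i" "ltl_sat \<psi> w j" by blast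
    from 2[OF j(1) i] j(2) show "ltl_sat (Since K \<phi> \<psi>) w i" by auto
  qed
qed

section \<open>Deterministic relations as paths through points\<close>

definition on_points :: "('a nword \<Rightarrow> nat \<Rightarrow> nat \<Rightarrow> bool) \<Rightarrow> 'a point \<Rightarrow> 'a point \<Rightarrow> bool" where
  "on_points r p q \<longleftrightarrow> good_point p \<and> good_point q \<and> fst q = fst p \<and> r (fst p) (snd p) (snd q)"

definition succ_of :: "('p \<Rightarrow> 'p \<Rightarrow> bool) \<Rightarrow> 'p \<Rightarrow> 'p option" where
  "succ_of R p = (if \<exists>q. R p q then Some (SOME q. R p q) else None)"

definition det :: "('a nword \<Rightarrow> nat \<Rightarrow> nat \<Rightarrow> bool) \<Rightarrow> bool" where
  "det r \<longleftrightarrow> (\<forall>w i j j'. good w \<longrightarrow> r w i j \<longrightarrow> r w i j' \<longrightarrow> j = j')"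

lemma succ_of_Some: "det r \<Longrightarrow> succ_of (on_points r) p = Some q \<longleftrightarrow> on_points r p q"
proof -
  assume "det r"
  hence u: "on_points r p q \<Longrightarrow> on_points r p q' \<Longrightarrow> q' = q" for q q'
    unfolding det_def on_points_def good_point_def by (auto simp: prod_eq_iff)
  show ?thesis
  proof (cases "\<exists>q. on_points r p q")
    case True
    then obtain q' where q': "on_points r p q'" by blast
    hence "(SOME q. on_points r p q) = q'" by (rule some_equality) (rule u[OF q'])
    moreover have "on_points r p q \<longleftrightarrow> q' = q" using q' u[OF q', of q] by metis
    ultimately show ?thesis using True unfolding succ_of_def by simp
  next
    case False
    hence "(\<exists>q. on_points r p q) = False" "on_points r p q = False" by blast+
    thus ?thesis unfolding succ_of_def by simp
  qed
qed

lemma nextp_succ_of: "det r \<Longrightarrow> nextp (succ_of (on_points r)) P p \<longleftrightarrow> (\<exists>q. on_points r p q \<and> P q)"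
  by (auto simp: nextp_def succ_of_Some)

lemma untilp_succ_of:
  assumes "det r"
  shows "untilp (succ_of (on_points r)) P Q (w, i) \<longleftrightarrow> (\<exists>j. (\<lambda>a b. on_points r (w, a) (w, b) \<and> P (w, a))\<^sup>*\<^sup>* i j \<and> Q (w, j))"
    (is "_ \<longleftrightarrow> (\<exists>j. ?R\<^sup>*\<^sup>* i j \<and> _)")
proof
  have "untilp (succ_of (on_points r)) P Q p \<Longrightarrow> fst p = w \<Longrightarrow> \<exists>j. ?R\<^sup>*\<^sup>* (snd p) j \<and> Q (w, j)" for p
  proof (induction rule: untilp.induct)
    case (untilp_now p)
    then show ?case by (cases p) auto
  next
    case (untilp_step p q)
    have l: "on_points r p q" using untilp_step(2) succ_of_Some[OF assms] by blast
    hence "fst q = w" using untilp_step by (simp add: on_points_def)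
    then obtain j where "?R\<^sup>*\<^sup>* (snd q) j" "Q (w, j)" using untilp_step by blast
    moreover have "?R (snd p) (snd q)" using l untilp_step \<open>fst q = w\<close> by (cases p; cases q) auto
    ultimately show ?case using converse_rtranclp_into_rtranclp[of ?R] by blast
  qed
  thus "untilp (succ_of (on_points r)) P Q (w, i) \<Longrightarrow> \<exists>j. ?R\<^sup>*\<^sup>* i j \<and> Q (w, j)" by force
  assume "\<exists>j. ?R\<^sup>*\<^sup>* i j \<and> Q (w, j)"
  then obtain j where "?R\<^sup>*\<^sup>* i j" "Q (w, j)" by blast
  thus "untilp (succ_of (on_points r)) P Q (w, i)"
  proof (induction rule: converse_rtranclp_induct)
    case (step y z)
    hence "succ_of (on_points r) (w, y) = Some (w, z)" using succ_of_Some[OF assms] by blast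
    then show ?case using step by (auto intro: untilp_step)
  qed (rule untilp_now)
qed

text \<open>Determinism turns the choice of a path in \<open>Until\<close> into the unique path that
  \<open>untilp\<close> follows.\<close>

lemma ldef_until:
  fixes P Q :: "'a point \<Rightarrow> bool"
  assumes d: "det (\<lambda>w :: 'a nword. path_step w K)" and P: "ldef P" and Q: "ldef Q"
  shows "ldef (untilp (succ_of (on_points (\<lambda>w. path_step w K))) P Q)"
proof -
  from P obtain \<phi> where \<phi>: "\<And>w i. good w \<Longrightarrow> i \<in> univ w \<Longrightarrow> P (w, i) \<longleftrightarrow> ltl_sat \<phi> w i" by (rule ldefE) blast
  from Q obtain \<psi> where \<psi>: "\<And>w i. good w \<Longrightarrow> i \<in> univ w \<Longrightarrow> Q (w, i) \<longleftrightarrow> ltl_sat \<psi> w i" by (rule ldefE) blast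
  show ?thesis
  proof (rule ldefI[of _ "Until K \<phi> \<psi>"])
    fix w :: "'a nword" and i assume g: "good w" "i \<in> univ w"
    have e: "(\<lambda>a b. on_points (\<lambda>w. path_step w K) (w, a) (w, b) \<and> P (w, a)) = (\<lambda>a b. ustep w K a b \<and> ltl_sat \<phi> w a)"
      using g \<phi> by (intro ext) (auto simp: on_points_def ustep_def good_point_def)
    have "Q (w, j) \<longleftrightarrow> ltl_sat \<psi> w j" if "(\<lambda>a b. ustep w K a b \<and> ltl_sat \<phi> w a)\<^sup>*\<^sup>* i j" for j
      by (rule \<psi>[OF g(1) ustep_rtranclp_univ[OF that g(2)]])
    thus "untilp (succ_of (on_points (\<lambda>w. path_step w K))) P Q (w, i) = ltl_sat (Until K \<phi> \<psi>) w i"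
      unfolding untilp_succ_of[OF d] e until_iff[OF g] by auto
  qed
qed

text \<open>A since is an until along the reversed steps. For call paths only this direction is
  deterministic: it leads from a position to its enclosing call.\<close>

lemma ldef_since:
  fixes P Q :: "'a point \<Rightarrow> bool"
  assumes d: "det (\<lambda>(w :: 'a nword) i j. path_step w K j i)" and P: "ldef P" and Q: "ldef Q"
  shows "ldef (untilp (succ_of (on_points (\<lambda>w i j. path_step w K j i))) P Q)"
proof -
  from P obtain \<phi> where \<phi>: "\<And>w i. good w \<Longrightarrow> i \<in> univ w \<Longrightarrow> P (w, i) \<longleftrightarrow> ltl_sat \<phi> w i" by (rule ldefE) blast
  from Q obtain \<psi> where \<psi>: "\<And>w i. good w \<Longrightarrow> i \<in> univ w \<Longrightarrow> Q (w, i) \<longleftrightarrow> ltl_sat \<psi> w i" by (rule ldefE) blast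
  show ?thesis
  proof (rule ldefI[of _ "Since K \<phi> \<psi>"])
    fix w :: "'a nword" and i assume g: "good w" "i \<in> univ w"
    have e: "(\<lambda>a b. on_points (\<lambda>w i j. path_step w K j i) (w, a) (w, b) \<and> P (w, a)) = (\<lambda>a b. ustep w K a b \<and> ltl_sat \<phi> w b)\<inverse>\<inverse>"
      using g \<phi> by (intro ext) (auto simp: on_points_def ustep_def good_point_def)
    have "Q (w, j) \<longleftrightarrow> ltl_sat \<psi> w j" if "(\<lambda>a b. ustep w K a b \<and> ltl_sat \<phi> w b)\<^sup>*\<^sup>* j i" for j
      by (rule \<psi>[OF g(1) ustep_rtranclp_univ'[OF that g(2)]])
    thus "untilp (succ_of (on_points (\<lambda>w i j. path_step w K j i))) P Q (w, i) = ltl_sat (Since K \<phi> \<psi>) w i"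
      unfolding untilp_succ_of[OF d] e since_iff[OF g] rtranclp_conversep conversep_iff by auto
  qed
qed

lemma closed_ldefI:
  "(\<And>P. ldef P \<Longrightarrow> ldef (nextp s P)) \<Longrightarrow> (\<And>P Q. ldef P \<Longrightarrow> ldef Q \<Longrightarrow> ldef (untilp s P Q)) \<Longrightarrow> closed (Collect ldef) s"
  by (simp add: closed_def ldef_True ldef_Not ldef_disj)

abbreviation "linF \<equiv> succ_of (on_points (\<lambda>w. path_step w Linear))"
abbreviation "linB \<equiv> succ_of (on_points (\<lambda>w i j. path_step w Linear j i))"
abbreviation "absF \<equiv> succ_of (on_points (\<lambda>w. path_step w Abstract))"
abbreviation "absB \<equiv> succ_of (on_points (\<lambda>w i j. path_step w Abstract j i))"
abbreviation "sibF \<equiv> succ_of (on_points sib)"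
abbreviation "sibB \<equiv> succ_of (on_points (\<lambda>w i j. sib w j i))"
abbreviation "parS \<equiv> succ_of (on_points (\<lambda>w i j. path_step w CallPath j i))"

lemma det_linF: "det (\<lambda>w. path_step w Linear)" and det_linB: "det (\<lambda>w i j. path_step w Linear j i)"
  by (auto simp: det_def path_step.simps)

lemma abstract_sib:
  "ustep w Abstract i j \<Longrightarrow> good w \<Longrightarrow> sib w i j"
  unfolding ustep_def sib_def path_step.simps using matched_call_mu[of w i] mu_univ[of w i] by (auto simp: matched_call_def)

lemma abstract_step: "good w \<Longrightarrow> path_step w Abstract i j \<longleftrightarrow>
   mu w i j \<or> \<not> call w i \<and> \<not> matched_ret w (i + 1) \<and> j = i + 1"
  using matched_call_mu[of w i] ret_of_eq[of w i] by (auto simp: matched_call_def path_step.simps)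

lemma det_absF: "det (\<lambda>w. path_step w Abstract)"
  unfolding det_def using abstract_step mu_fun mu_univ by metis

lemma det_absB: "det (\<lambda>w i j. path_step w Abstract j i)"
  unfolding det_def
proof (intro allI impI)
  fix w :: "'a nword" and i j j'
  assume g: "good w" and s: "path_step w Abstract j i" "path_step w Abstract j' i"
  show "j = j'" using s unfolding abstract_step[OF g] using mu_inj[OF g] by (auto simp: matched_ret_def)
qed

lemma det_sibF: "det sib" and det_sibB: "det (\<lambda>w i j. sib w j i)"
  using sib_fun sib_inj by (auto simp: det_def)

lemma det_parS: "det (\<lambda>w i j. path_step w CallPath j i)"
  using enclosing_call_fun by (auto simp: det_def path_step.simps)

lemma closed_linF: "closed (Collect ldef) linF"
proof (rule closed_ldefI)
  fix P :: "'a point \<Rightarrow> bool" assume "ldef P"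
  from ldef_next[OF this] show "ldef (nextp linF P)"
    by (rule ldef_cong[rotated]) (auto simp: nextp_succ_of[OF det_linF] on_points_def good_point_def path_step.simps)
qed (rule ldef_until[OF det_linF])

lemma closed_linB: "closed (Collect ldef) linB"
proof (rule closed_ldefI)
  fix P :: "'a point \<Rightarrow> bool" assume "ldef P"
  from ldef_prev[OF this] show "ldef (nextp linB P)"
    by (rule ldef_cong[rotated]) (unfold nextp_succ_of[OF det_linB], auto simp: on_points_def good_point_def path_step.simps)
qed (rule ldef_since[OF det_linB])

lemma closed_absF: "closed (Collect ldef) absF"
proof (rule closed_ldefI)
  fix P :: "'a point \<Rightarrow> bool" assume P: "ldef P"
  have "ldef (\<lambda>p. (\<exists>j. mu (fst p) (snd p) j \<and> P (fst p, j)) \<or> \<not> call (fst p) (snd p) \<and>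
     (snd p + 1 \<in> univ (fst p) \<and> (\<not> matched_ret (fst (fst p, snd p + 1)) (snd (fst p, snd p + 1)) \<and> P (fst p, snd p + 1))))"
    by (intro ldef_disj ldef_next_mu ldef_conj ldef_Not ldef_call ldef_next[of "\<lambda>p. \<not> matched_ret (fst p) (snd p) \<and> P p"] ldef_matched_ret P)
  thus "ldef (nextp absF P)"
    by (rule ldef_cong[rotated])
      (auto simp: nextp_succ_of[OF det_absF] on_points_def good_point_def abstract_step dest: mu_univ)
qed (rule ldef_until[OF det_absF])

lemma closed_absB: "closed (Collect ldef) absB"
proof (rule closed_ldefI)
  fix P :: "'a point \<Rightarrow> bool" assume P: "ldef P"
  have "ldef (\<lambda>p. (\<exists>j. mu (fst p) j (snd p) \<and> P (fst p, j)) \<or> \<not> matched_ret (fst p) (snd p) \<and>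
     (\<exists>j. snd p = j + 1 \<and> j \<in> univ (fst p) \<and> (\<not> call (fst (fst p, j)) (snd (fst p, j)) \<and> P (fst p, j))))"
    by (intro ldef_disj ldef_prev_mu ldef_conj ldef_Not ldef_call ldef_prev[of "\<lambda>p. \<not> call (fst p) (snd p) \<and> P p"] ldef_matched_ret P)
  thus "ldef (nextp absB P)"
    by (rule ldef_cong[rotated])
      (auto simp: nextp_succ_of[OF det_absB] on_points_def good_point_def abstract_step dest: mu_univ)
qed (rule ldef_since[OF det_absB])

section \<open>The enclosing call\<close>

lemma parent_first_sib:
  assumes g: "good w"
  shows "encloses w c d i \<Longrightarrow> \<forall>c' d'. encloses w c' d' i \<longrightarrow> c' \<le> c \<Longrightarrow> i \<in> univ w \<Longrightarrow>
    (\<lambda>a b. ustep w Abstract a b)\<^sup>*\<^sup>* (c + 1) i \<and> \<not> matched_ret w (c + 1) \<and> c + 1 \<in> univ w"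
proof (induction i rule: less_induct)
  case (less i)
  have cd: "mu w c d" "c < i" "i < d" using less.prems by (auto simp: encloses_def)
  show ?case
  proof (cases "i = c + 1")
    case True
    have "\<not> matched_ret w i"
    proof
      assume "matched_ret w i"
      then obtain c' where c': "mu w c' i" by (auto simp: matched_ret_def)
      have "c' \<noteq> c" using mu_fun[OF g c', of d] cd by auto
      hence "c' < c" using mu_univ[OF g c'] True by linarith
      thus False using nest[OF g c' cd(1)] cd by simp
    qed
    thus ?thesis using True less.prems by simp
  next
    case False
    have "\<exists>j. ustep w Abstract j i"
    proof (cases "matched_ret w i")
      case True
      then obtain j where "mu w j i" by (auto simp: matched_ret_def)
      thus ?thesis using mu_univ[OF g] by (auto simp: ustep_def abstract_step[OF g])
    next
      case r: False
      have u: "i - 1 \<in> univ w"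
        using univ_convex[OF g, of c i "i - 1"] mu_univ[OF g cd(1)] less.prems cd by auto
      have e: "encloses w c d (i - 1)" using cd False by (auto simp: encloses_def)
      \<comment> \<open>A call at \<open>i - 1\<close> would be matched as it lies inside a pair.
        Its return is not \<open>i\<close>, so it would enclose \<open>i\<close> more tightly than
        \<open>c\<close>.\<close>
      have "\<not> call w (i - 1)"
      proof
        assume "call w (i - 1)"
        then obtain e' where e': "mu w (i - 1) e'" using inside_call[OF g e] by (auto simp: matched_call_def)
        have "e' \<noteq> i" "i - 1 < e'" using r e' mu_univ[OF g e'] by (auto simp: matched_ret_def)
        hence "encloses w (i - 1) e' i" using e' cd by (auto simp: encloses_def)
        hence "i - 1 \<le> c" using less.prems by blast
        thus False using False cd by simp
      qed
      hence "ustep w Abstract (i - 1) i" using u r less.prems cd by (auto simp: ustep_def path_step.simps)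
      thus ?thesis by blast
    qed
    then obtain j where j: "ustep w Abstract j i" by blast
    have s: "sib w j i" using abstract_sib[OF j g] .
    have "j < i" "j \<in> univ w" using ustep_less[OF g j] j by (auto simp: ustep_def)
    hence "(\<lambda>a b. ustep w Abstract a b)\<^sup>*\<^sup>* (c + 1) j \<and> \<not> matched_ret w (c + 1) \<and> c + 1 \<in> univ w"
      using less.IH[of j] less.prems encloses_sib[OF g s] by blast
    thus ?thesis using j by (meson rtranclp.rtrancl_into_rtrancl)
  qed
qed

text \<open>The enclosing call directly precedes the first sibling. That sibling is found backwards
  along the abstract path and recognised by following a matched call without being a matched return.
  So one abstract since and one step back define the enclosing call.\<close>

lemma parent_iff:
  assumes g: "good w" and i: "i \<in> univ w"
  shows "enclosing_call w i c \<longleftrightarrow> (\<exists>j. (\<lambda>a b. ustep w Abstract a b)\<^sup>*\<^sup>* j i \<and> \<not> matched_ret w j \<and> j = c + 1 \<and> matched_call w c)"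
proof
  assume "enclosing_call w i c"
  then obtain d where e: "encloses w c d i" "\<forall>c' d'. encloses w c' d' i \<longrightarrow> c' \<le> c" unfolding enclosing_call_iff[OF g] by blast
  thus "\<exists>j. (\<lambda>a b. ustep w Abstract a b)\<^sup>*\<^sup>* j i \<and> \<not> matched_ret w j \<and> j = c + 1 \<and> matched_call w c"
    using parent_first_sib[OF g e i] by (auto simp: encloses_def matched_call_def)
next
  assume "\<exists>j. (\<lambda>a b. ustep w Abstract a b)\<^sup>*\<^sup>* j i \<and> \<not> matched_ret w j \<and> j = c + 1 \<and> matched_call w c"
  then obtain j d where j: "(\<lambda>a b. ustep w Abstract a b)\<^sup>*\<^sup>* j i" "\<not> matched_ret w j" "j = c + 1" "mu w c d"
    by (auto simp: matched_call_def)
  have "encloses w c' d' j \<longleftrightarrow> encloses w c' d' i" for c' d'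
    using j(1) by (induction rule: rtranclp_induct) (auto dest: abstract_sib[OF _ g] encloses_sib[OF g])
  moreover have "encloses w c d j" 
  proof -
    have "d \<noteq> j" "c < d" using j mu_univ[OF g j(4)] by (auto simp: matched_ret_def)
    thus ?thesis using j by (auto simp: encloses_def)
  qed
  moreover have "c' \<le> c" if "encloses w c' d' j" for c' d' using that j by (auto simp: encloses_def)
  ultimately show "enclosing_call w i c" unfolding enclosing_call_iff[OF g] by blast
qed

lemma closed_parS: "closed (Collect ldef) parS"
proof (rule closed_ldefI)
  fix P :: "'a point \<Rightarrow> bool" assume P: "ldef P"
  let ?Q = "\<lambda>p. \<not> matched_ret (fst p) (snd p) \<and>
     (\<exists>c. snd p = c + 1 \<and> c \<in> univ (fst p) \<and> (matched_call (fst (fst p, c)) (snd (fst p, c)) \<and> P (fst p, c)))"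
  have "ldef ?Q"
    by (intro ldef_conj ldef_Not ldef_matched_ret ldef_prev[of "\<lambda>p. matched_call (fst p) (snd p) \<and> P p"] ldef_matched_call P)
  hence "ldef (untilp absB (\<lambda>_. True) ?Q)" by (intro ldef_since det_absB ldef_True)
  thus "ldef (nextp parS P)"
  proof (rule ldef_cong[rotated])
    fix w :: "'a nword" and i assume g: "good w" "i \<in> univ w"
    have e: "(\<lambda>a b. on_points (\<lambda>w i j. path_step w Abstract j i) (w, a) (w, b) \<and> True) = (\<lambda>a b. ustep w Abstract a b)\<inverse>\<inverse>"
      using g by (intro ext) (auto simp: on_points_def ustep_def good_point_def)
    have "untilp absB (\<lambda>_. True) ?Q (w, i) \<longleftrightarrow> (\<exists>c. enclosing_call w i c \<and> c \<in> univ w \<and> P (w, c))"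
      unfolding untilp_succ_of[OF det_absB] e rtranclp_conversep parent_iff[OF g] by (auto simp: matched_call_def)
    also have "\<dots> \<longleftrightarrow> nextp parS P (w, i)"
      unfolding nextp_succ_of[OF det_parS] on_points_def good_point_def using g by (auto simp: path_step.simps)
    finally show "untilp absB (\<lambda>_. True) ?Q (w, i) = nextp parS P (w, i)" .
  qed
qed (rule ldef_since[OF det_parS])

section \<open>Top positions and the path of siblings\<close>

definition topP :: "'a point \<Rightarrow> bool" where
  "topP p \<longleftrightarrow> top_pos (fst p) (snd p)"

lemma enclosing_call_ex: "good w \<Longrightarrow> (\<exists>c. enclosing_call w i c) \<longleftrightarrow> \<not> top_pos w i"
  unfolding enclosing_call_iff top_pos_def using par_exists by metis

lemma ldef_topP: "ldef topP"
proof -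
  have "ldef (\<lambda>p. \<not> nextp parS (\<lambda>_. True) p)"
    using closed_nextp[OF closed_parS, of "\<lambda>_. True"] ldef_True by (intro ldef_Not) simp
  thus ?thesis
  proof (rule ldef_cong[rotated])
    fix w :: "'a nword" and i assume g: "good w" "i \<in> univ w"
    have "c \<in> univ w" if "enclosing_call w i c" for c
      using that mu_univ[OF g(1)] unfolding enclosing_call_iff[OF g(1)] encloses_def by blast
    thus "(\<not> nextp parS (\<lambda>_. True) (w, i)) = topP (w, i)"
      using enclosing_call_ex[OF g(1), of i] g
      unfolding nextp_succ_of[OF det_parS] on_points_def good_point_def topP_def by (auto simp: path_step.simps)
  qed
qed

text \<open>A path that never crosses the boundary of \<open>D\<close> follows \<open>s1\<close>
  throughout or \<open>s2\<close> throughout, so next and until split into two guarded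
  cases.\<close>

lemma closed_cases:
  assumes "closed F s1" "closed F s2" "D \<in> F"
    "\<And>p. D p \<Longrightarrow> s p = s1 p" "\<And>p. \<not> D p \<Longrightarrow> s p = s2 p" "\<And>p q. s p = Some q \<Longrightarrow> D p = D q"
  shows "closed F s"
proof -
  note c = closed_disj[OF assms(1)] closed_conj[OF assms(1)] closed_Not[OF assms(1)]
  have X: "nextp s P = (\<lambda>p. D p \<and> nextp s1 P p \<or> \<not> D p \<and> nextp s2 P p)" for P
    by (rule ext) (metis assms(4,5) nextp_def)
  have U1: "untilp s P Q p \<Longrightarrow> (D p \<longrightarrow> untilp s1 P Q p) \<and> (\<not> D p \<longrightarrow> untilp s2 P Q p)" for P Q p
    by (induction rule: untilp.induct) (metis untilp_now, metis untilp_step assms(4-6))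
  have U2: "untilp s1 P Q p \<Longrightarrow> D p \<Longrightarrow> untilp s P Q p" for P Q p
    by (induction rule: untilp.induct) (metis untilp_now, metis untilp_step assms(4-6))
  have U3: "untilp s2 P Q p \<Longrightarrow> \<not> D p \<Longrightarrow> untilp s P Q p" for P Q p
    by (induction rule: untilp.induct) (metis untilp_now, metis untilp_step assms(4-6))
  have U: "untilp s P Q = (\<lambda>p. D p \<and> untilp s1 P Q p \<or> \<not> D p \<and> untilp s2 P Q p)" for P Q
    using U1 U2 U3 by (intro ext) blast
  show ?thesis unfolding closed_def X U
    using assms(1-3) c by (auto intro!: c closed_nextp closed_untilp simp: closed_True)
qed

lemma top_sib: "good w \<Longrightarrow> sib w i j \<Longrightarrow> top_pos w i \<longleftrightarrow> top_pos w j"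
  unfolding top_pos_def using encloses_sib by blast

lemma hit_linF:
  assumes g: "good w" "j \<in> univ w" "top_pos w j"
  shows "i \<in> univ w \<Longrightarrow> i \<le> j \<Longrightarrow> \<forall>k. i \<le> k \<and> k < j \<longrightarrow> \<not> top_pos w k \<Longrightarrow> hit linF topP (w, i) (w, j)"
proof (induction "j - i" arbitrary: i)
  case 0
  then show ?case using g by (auto intro: hit_here simp: topP_def)
next
  case (Suc n)
  hence ij: "i < j" by simp
  have u: "i + 1 \<in> univ w" using univ_convex[OF g(1) Suc.prems(1) g(2), of "i + 1"] ij by simp
  have "hit linF topP (w, i + 1) (w, j)" using Suc.hyps(2) Suc.prems(3) ij u by (intro Suc.hyps(1)) auto
  moreover have "linF (w, i) = Some (w, i + 1)"
    using Suc.prems(1) u g by (subst succ_of_Some[OF det_linF]) (auto simp: on_points_def good_point_def path_step.simps)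
  moreover have "\<not> topP (w, i)" using Suc.prems ij by (simp add: topP_def)
  ultimately show ?case by (rule_tac hit_step)
qed

lemma hit_linB:
  assumes g: "good w" "j \<in> univ w" "top_pos w j"
  shows "i \<in> univ w \<Longrightarrow> j \<le> i \<Longrightarrow> \<forall>k. j < k \<and> k \<le> i \<longrightarrow> \<not> top_pos w k \<Longrightarrow> hit linB topP (w, i) (w, j)"
proof (induction "i - j" arbitrary: i)
  case 0
  then show ?case using g by (auto intro: hit_here simp: topP_def)
next
  case (Suc n)
  hence ij: "j < i" by simp
  then obtain i' where i': "i = i' + 1" by (metis Suc_eq_plus1 less_imp_Suc_add)
  have u: "i' \<in> univ w" using univ_convex[OF g(1,2) Suc.prems(1), of i'] ij i' by simp
  have "hit linB topP (w, i') (w, j)" using Suc.hyps(2) Suc.prems(3) ij u i' by (intro Suc.hyps(1)) auto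
  moreover have "linB (w, i) = Some (w, i')"
    using Suc.prems(1) u g i' by (subst succ_of_Some[OF det_linB]) (auto simp: on_points_def good_point_def path_step.simps)
  moreover have "\<not> topP (w, i)" using Suc.prems ij by (simp add: topP_def)
  ultimately show ?case by (rule_tac hit_step)
qed

lemma sib_between:
  assumes "sib w i j" "i < k" "k < j"
  shows "\<not> top_pos w k"
  using assms unfolding sib_def top_pos_def encloses_def by auto

lemma good_point_on_points: "\<not> good_point p \<Longrightarrow> det r \<Longrightarrow> succ_of (on_points r) p = None"
  by (metis on_points_def not_None_eq succ_of_Some)

text \<open>At the top level the next sibling is the next top position, since whatever is skipped
  lies inside a matched pair. If there is no next sibling, the word ends, because a return at
  \<open>i + 1\<close> would enclose \<open>i\<close>.\<close>

lemma sibF_top: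
  assumes t: "topP p"
  shows "sibF p = next_hit linF topP p"
proof (cases "good_point p")
  case True
  obtain w i where p: "p = (w, i)" by (cases p)
  hence g: "good w" "i \<in> univ w" using True by (auto simp: good_point_def)
  have ti: "top_pos w i" using t p by (simp add: topP_def)
  show ?thesis
  proof (cases "\<exists>j. sib w i j")
    case True
    then obtain j where j: "sib w i j" by blast
    have ij: "i < j" "j \<in> univ w" using sib_less[OF g(1) j] j by (auto simp: sib_def)
    have u: "i + 1 \<in> univ w" using univ_convex[OF g ij(2), of "i + 1"] ij by simp
    have "hit linF topP (w, i + 1) (w, j)"
      using sib_between[OF j] top_sib[OF g(1) j] ti ij u by (intro hit_linF[OF g(1)]) auto
    moreover have "linF (w, i) = Some (w, i + 1)"
      using u g by (subst succ_of_Some[OF det_linF]) (auto simp: on_points_def good_point_def path_step.simps)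
    ultimately have "next_hit linF topP p = Some (w, j)" unfolding next_hit_Some p by blast
    moreover have "sibF p = Some (w, j)"
      using j g ij p by (subst succ_of_Some[OF det_sibF]) (auto simp: on_points_def good_point_def)
    ultimately show ?thesis by simp
  next
    case False
    have mc: "\<not> matched_call w i"
      using False mu_univ[OF g(1)] unfolding matched_call_def sib_def by blast
    have "i + 1 \<notin> univ w"
    proof
      assume "i + 1 \<in> univ w"
      hence "matched_ret w (i + 1)" using False mc g by (auto simp: sib_def)
      then obtain c where c: "mu w c (i + 1)" by (auto simp: matched_ret_def)
      hence "encloses w c (i + 1) i" using mc mu_univ[OF g(1) c] by (auto simp: encloses_def matched_call_def less_Suc_eq)
      thus False using ti by (auto simp: top_pos_def)
    qed
    hence "linF p = None" using p by (simp add: succ_of_def on_points_def good_point_def path_step.simps)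
    moreover have "sibF p = None" using False p by (simp add: succ_of_def on_points_def)
    ultimately show ?thesis by (simp add: next_hit_def nextp_def)
  qed
next
  case False
  thus ?thesis using good_point_on_points[OF False det_sibF] good_point_on_points[OF False det_linF] by (simp add: next_hit_def nextp_def)
qed

lemma sibB_top:
  assumes t: "topP p"
  shows "sibB p = next_hit linB topP p"
proof (cases "good_point p")
  case True
  obtain w i where p: "p = (w, i)" by (cases p)
  hence g: "good w" "i \<in> univ w" using True by (auto simp: good_point_def)
  have ti: "top_pos w i" using t p by (simp add: topP_def)
  show ?thesis
  proof (cases "\<exists>j. sib w j i")
    case True
    then obtain j where j: "sib w j i" by blast
    have ij: "j < i" "j \<in> univ w" using sib_less[OF g(1) j] j by (auto simp: sib_def)
    then obtain i' where i': "i = i' + 1" by (metis Suc_eq_plus1 less_imp_Suc_add)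
    have u: "i' \<in> univ w" using univ_convex[OF g(1) ij(2) g(2), of i'] ij i' by simp
    have "hit linB topP (w, i') (w, j)"
      using sib_between[OF j] top_sib[OF g(1) j] ti ij u i' by (intro hit_linB[OF g(1)]) auto
    moreover have "linB (w, i) = Some (w, i')"
      using u g i' by (subst succ_of_Some[OF det_linB]) (auto simp: on_points_def good_point_def path_step.simps)
    ultimately have "next_hit linB topP p = Some (w, j)" unfolding next_hit_Some p by blast
    moreover have "sibB p = Some (w, j)"
      using j g ij p by (subst succ_of_Some[OF det_sibB]) (auto simp: on_points_def good_point_def)
    ultimately show ?thesis by simp
  next
    case False
    have "i - 1 \<notin> univ w"
      using sib_pred[OF g _ False] ti by (auto simp: top_pos_def)
    hence "linB p = None" using p by (auto simp: succ_of_def on_points_def good_point_def path_step.simps)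
    moreover have "sibB p = None" using False p by (simp add: succ_of_def on_points_def)
    ultimately show ?thesis by (simp add: next_hit_def nextp_def)
  qed
next
  case False
  thus ?thesis using good_point_on_points[OF False det_sibB] good_point_on_points[OF False det_linB] by (simp add: next_hit_def nextp_def)
qed

text \<open>Inside a matched pair every call is matched, so the conditions
  \<open>\<not> call\<close> and \<open>\<not> matched_call\<close> coincide.\<close>

lemma nontop_sib:
  assumes "good w" "\<not> top_pos w i"
  shows "sib w i j \<longleftrightarrow> i \<in> univ w \<and> j \<in> univ w \<and> path_step w Abstract i j"
  using assms inside_call[OF assms(1), of _ _ i] mu_univ[OF assms(1), of i]
  unfolding sib_def abstract_step[OF assms(1)] top_pos_def matched_call_def by blast

lemma sib_topP: "succ_of (on_points sib) p = Some q \<Longrightarrow> topP p = topP q"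
  unfolding succ_of_Some[OF det_sibF] on_points_def good_point_def topP_def using top_sib by metis

lemma sibB_topP: "sibB p = Some q \<Longrightarrow> topP p = topP q"
  unfolding succ_of_Some[OF det_sibB] on_points_def good_point_def topP_def using top_sib by metis

lemma closed_sibF: "closed (Collect ldef) sibF"
proof (rule closed_cases)
  show "closed (Collect ldef) (next_hit linF topP)" by (rule closed_next_hit[OF closed_linF]) (simp add: ldef_topP)
  show "sibF p = absF p" if "\<not> topP p" for p
  proof -
    have "on_points sib p = on_points (\<lambda>w. path_step w Abstract) p"
    proof (rule ext)
      fix q
      show "on_points sib p q = on_points (\<lambda>w. path_step w Abstract) p q"
        using nontop_sib[OF _ that[unfolded topP_def], of "snd q"] unfolding on_points_def good_point_def by metis
    qed
    thus ?thesis by (simp add: succ_of_def)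
  qed
qed (simp_all add: closed_absF ldef_topP sibF_top sib_topP)

lemma closed_sibB: "closed (Collect ldef) sibB"
proof (rule closed_cases)
  show "closed (Collect ldef) (next_hit linB topP)" by (rule closed_next_hit[OF closed_linB]) (simp add: ldef_topP)
  show "sibB p = absB p" if "\<not> topP p" for p
  proof -
    have "on_points (\<lambda>w i j. sib w j i) p q = on_points (\<lambda>w i j. path_step w Abstract j i) p q" for q
    proof (cases "on_points (\<lambda>w i j. sib w j i) p q \<or> on_points (\<lambda>w i j. path_step w Abstract j i) p q")
      case True
      hence g: "good (fst p)" "fst q = fst p" by (auto simp: on_points_def good_point_def)
      have "sib (fst p) (snd q) (snd p)"
        using True abstract_sib[of "fst p" "snd q" "snd p"] by (auto simp: on_points_def good_point_def ustep_def)
      hence "\<not> top_pos (fst p) (snd q)" using top_sib[OF g(1)] that by (auto simp: topP_def)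
      thus ?thesis using nontop_sib[OF g(1), of "snd q" "snd p"] g by (auto simp: on_points_def good_point_def)
    qed simp
    hence "on_points (\<lambda>w i j. sib w j i) p = on_points (\<lambda>w i j. path_step w Abstract j i) p" by blast
    thus ?thesis by (simp add: succ_of_def)
  qed
qed (simp_all add: closed_absB ldef_topP sibB_top sibB_topP)

section \<open>Types of sibling sequences\<close>

definition ldefv :: "('a point \<Rightarrow> 'v) \<Rightarrow> bool" where
  "ldefv f \<longleftrightarrow> (\<exists>V. finite V \<and> (\<forall>p. good_point p \<longrightarrow> f p \<in> V)) \<and> (\<forall>v. ldef (\<lambda>p. f p = v))"

lemma ldef_cong_good_point: "(\<And>p. good_point p \<Longrightarrow> P p = Q p) \<Longrightarrow> ldef P \<Longrightarrow> ldef Q"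
  by (rule ldef_cong[of P]) (auto simp: good_point_def)

lemma ldefvE:
  assumes "ldefv f"
  obtains V where "finite V" "\<And>p. good_point p \<Longrightarrow> f p \<in> V" "\<And>v. ldef (\<lambda>p. f p = v)"
  using assms unfolding ldefv_def by blast

lemma ldefvI: "finite V \<Longrightarrow> (\<And>p. good_point p \<Longrightarrow> f p \<in> V) \<Longrightarrow> (\<And>v. ldef (\<lambda>p. f p = v)) \<Longrightarrow> ldefv f"
  unfolding ldefv_def by blast

lemma ldefv_const: "ldefv (\<lambda>_. c)"
  unfolding ldefv_def using ldef_const by (auto intro!: exI[of _ "{c}"])

lemma ldefv_bool:
  assumes "ldef P"
  shows "ldefv P"
proof -
  have "ldef (\<lambda>p. P p = v)" for v using assms ldef_Not[OF assms] by (cases v) simp_all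
  thus ?thesis unfolding ldefv_def by (auto intro!: exI[of _ UNIV])
qed

lemma ldefv_pair:
  assumes "ldefv f" "ldefv g"
  shows "ldefv (\<lambda>p. (f p, g p))"
proof -
  from assms(1) obtain V where V: "finite V" "\<And>p. good_point p \<Longrightarrow> f p \<in> V" "\<And>v. ldef (\<lambda>p. f p = v)" by (rule ldefvE) blast
  from assms(2) obtain W where W: "finite W" "\<And>p. good_point p \<Longrightarrow> g p \<in> W" "\<And>v. ldef (\<lambda>p. g p = v)" by (rule ldefvE) blast
  have "ldef (\<lambda>p. (f p, g p) = v)" for v
    using ldef_conj[OF V(3)[of "fst v"] W(3)[of "snd v"]] by (simp add: prod_eq_iff)
  thus ?thesis unfolding ldefv_def using V W by (intro conjI exI[of _ "V \<times> W"]) auto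
qed

lemma ldefv_mem:
  assumes "ldefv f"
  shows "ldef (\<lambda>p. f p \<in> S)"
proof -
  from assms obtain V where V: "finite V" "\<And>p. good_point p \<Longrightarrow> f p \<in> V" "\<And>v. ldef (\<lambda>p. f p = v)" by (rule ldefvE) blast
  have "ldef (\<lambda>p. \<exists>v\<in>V \<inter> S. f p = v)" using V by (intro ldef_Bex) auto
  thus ?thesis by (rule ldef_cong_good_point[rotated]) (use V in auto)
qed

text \<open>On good points each fibre of \<open>g\<close> is a finite union of fibres of
  \<open>f\<close>; a chosen point of each fibre of \<open>f\<close> supplies the value of
  \<open>g\<close> on it.\<close>

lemma ldefv_det:
  assumes f: "ldefv f" and g: "\<And>p q. good_point p \<Longrightarrow> good_point q \<Longrightarrow> f p = f q \<Longrightarrow> g p = g q"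
  shows "ldefv g"
proof -
  from f obtain V where V: "finite V" "\<And>p. good_point p \<Longrightarrow> f p \<in> V" "\<And>v. ldef (\<lambda>p. f p = v)" by (rule ldefvE) blast
  let ?h = "\<lambda>v. g (SOME p. good_point p \<and> f p = v)"
  have h: "g p = ?h (f p)" if "good_point p" for p
  proof -
    have "good_point (SOME q. good_point q \<and> f q = f p) \<and> f (SOME q. good_point q \<and> f q = f p) = f p"
      by (rule someI[of _ p]) (use that in simp)
    thus ?thesis using g[OF that] by metis
  qed
  have "ldef (\<lambda>p. g p = v)" for v
    using ldefv_mem[OF f, of "{u. ?h u = v}"] by (rule ldef_cong_good_point[rotated]) (use h in simp)
  moreover have "\<exists>V. finite V \<and> (\<forall>p. good_point p \<longrightarrow> g p \<in> V)"
    using V h by (intro exI[of _ "?h ` V"]) auto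
  ultimately show ?thesis unfolding ldefv_def by blast
qed

lemma ldefv_cong: "(\<And>p. good_point p \<Longrightarrow> f p = g p) \<Longrightarrow> ldefv f \<Longrightarrow> ldefv g"
  by (rule ldefv_det[of f]) auto

lemma ldefv_comp: "ldefv f \<Longrightarrow> ldefv (\<lambda>p. h (f p))"
  by (rule ldefv_det[of f]) auto

lemma ldefv_comp2: "ldefv f \<Longrightarrow> ldefv g \<Longrightarrow> ldefv (\<lambda>p. h (f p) (g p))"
  using ldefv_comp[OF ldefv_pair, of f g "\<lambda>(x, y). h x y"] by simp

lemma ldefv_if: "ldef P \<Longrightarrow> ldefv f \<Longrightarrow> ldefv g \<Longrightarrow> ldefv (\<lambda>p. if P p then f p else g p)"
  using ldefv_comp[OF ldefv_pair[OF ldefv_bool ldefv_pair], of P f g "\<lambda>(b, x, y). if b then x else y"] by simp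

lemma ldefv_step:
  assumes X: "\<And>P. ldef P \<Longrightarrow> ldef (nextp s P)" and s: "\<And>p q. s p = Some q \<Longrightarrow> good_point q" and f: "ldefv f"
  shows "ldefv (\<lambda>p. case s p of None \<Rightarrow> d | Some q \<Rightarrow> f q)"
proof -
  from f obtain V where V: "finite V" "\<And>p. good_point p \<Longrightarrow> f p \<in> V" "\<And>v. ldef (\<lambda>p. f p = v)" by (rule ldefvE) blast
  have "ldef (\<lambda>p. nextp s (\<lambda>q. f q = v) p \<or> \<not> nextp s (\<lambda>_. True) p \<and> d = v)" for v
    by (intro ldef_disj ldef_conj ldef_Not X V ldef_True ldef_const)
  moreover have "(\<lambda>p. nextp s (\<lambda>q. f q = v) p \<or> \<not> nextp s (\<lambda>_. True) p \<and> d = v) =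
     (\<lambda>p. (case s p of None \<Rightarrow> d | Some q \<Rightarrow> f q) = v)" for v
    by (rule ext) (auto simp: nextp_def split: option.splits)
  ultimately have "ldef (\<lambda>p. (case s p of None \<Rightarrow> d | Some q \<Rightarrow> f q) = v)" for v by simp
  moreover have "(case s p of None \<Rightarrow> d | Some q \<Rightarrow> f q) \<in> insert d V" for p
    using V(2) s by (auto split: option.splits)
  ultimately show ?thesis unfolding ldefv_def using V(1) by (intro conjI exI[of _ "insert d V"]) auto
qed

lemma ldefv_lab: "ldefv (\<lambda>p. lab (fst p) (snd p) :: 'a::finite)"
  unfolding ldefv_def using ldef_lab by (auto intro!: exI[of _ UNIV])

abbreviation "muF \<equiv> succ_of (on_points mu)"
abbreviation "muB \<equiv> succ_of (on_points (\<lambda>w i j. mu w j i))"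

lemma det_muF: "det mu" and det_muB: "det (\<lambda>w i j. mu w j i)"
  using mu_fun mu_inj by (auto simp: det_def)

lemma ldef_nextp_muF: "ldef P \<Longrightarrow> ldef (nextp muF P)"
  by (drule ldef_next_mu, erule ldef_cong[rotated])
    (unfold nextp_succ_of[OF det_muF], auto simp: on_points_def good_point_def dest: mu_univ)

lemma ldef_nextp_muB: "ldef P \<Longrightarrow> ldef (nextp muB P)"
  by (drule ldef_prev_mu, erule ldef_cong[rotated])
    (unfold nextp_succ_of[OF det_muB], auto simp: on_points_def good_point_def dest: mu_univ)

lemma muF_Some: "good w \<Longrightarrow> mu w i j \<Longrightarrow> muF (w, i) = Some (w, j)"
  by (subst succ_of_Some[OF det_muF]) (auto simp: on_points_def good_point_def dest: mu_univ)

lemma muB_Some: "good w \<Longrightarrow> mu w i j \<Longrightarrow> muB (w, j) = Some (w, i)"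
  by (subst succ_of_Some[OF det_muB]) (auto simp: on_points_def good_point_def dest: mu_univ)

lemma succ_of_good_point: "succ_of (on_points r) p = Some q \<Longrightarrow> det r \<Longrightarrow> good_point q"
  by (simp add: succ_of_Some on_points_def)

lemma ldefv_muF: "ldefv f \<Longrightarrow> ldefv (\<lambda>p. case muF p of None \<Rightarrow> d | Some q \<Rightarrow> f q)"
  by (rule ldefv_step[OF ldef_nextp_muF]) (auto dest: succ_of_good_point[OF _ det_muF])

lemma ldefv_muB: "ldefv f \<Longrightarrow> ldefv (\<lambda>p. case muB p of None \<Rightarrow> d | Some q \<Rightarrow> f q)"
  by (rule ldefv_step[OF ldef_nextp_muB]) (auto dest: succ_of_good_point[OF _ det_muB])

lemma ldefv_closed:
  assumes "closed (Collect ldef) (succ_of (on_points r))" "det r" "ldefv f"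
  shows "ldefv (\<lambda>p. case succ_of (on_points r) p of None \<Rightarrow> d | Some q \<Rightarrow> f q)"
  by (rule ldefv_step) (use assms closed_nextp[OF assms(1)] succ_of_good_point in auto)

text \<open>The forward and the backward linear path from a position together visit the whole
  word.\<close>

lemma ldef_Ex_univ:
  assumes P: "ldef P"
  shows "ldef (\<lambda>p. \<exists>b\<in>univ (fst p). P (fst p, b))"
proof -
  have "ldef (\<lambda>p. untilp linF (\<lambda>_. True) P p \<or> untilp linB (\<lambda>_. True) P p)"
    using closed_untilp[OF closed_linF, of "\<lambda>_. True" P] closed_untilp[OF closed_linB, of "\<lambda>_. True" P] P ldef_True
    by (intro ldef_disj) auto
  thus ?thesis
  proof (rule ldef_cong_good_point[rotated])
    fix p :: "'a point" assume g: "good_point p"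
    have F: "untilp linF (\<lambda>_. True) P p \<Longrightarrow> good_point p \<Longrightarrow> \<exists>b\<in>univ (fst p). P (fst p, b)" for p
    proof (induction rule: untilp.induct)
      case (untilp_now p) then show ?case by (cases p) (auto simp: good_point_def)
    next
      case (untilp_step p q) then show ?case unfolding succ_of_Some[OF det_linF] by (auto simp: on_points_def)
    qed
    have B: "untilp linB (\<lambda>_. True) P p \<Longrightarrow> good_point p \<Longrightarrow> \<exists>b\<in>univ (fst p). P (fst p, b)" for p
    proof (induction rule: untilp.induct)
      case (untilp_now p) then show ?case by (cases p) (auto simp: good_point_def)
    next
      case (untilp_step p q) then show ?case unfolding succ_of_Some[OF det_linB] by (auto simp: on_points_def)
    qed
    have F': "good w \<Longrightarrow> i \<in> univ w \<Longrightarrow> b \<in> univ w \<Longrightarrow> P (w, b) \<Longrightarrow> i \<le> b \<Longrightarrow> untilp linF (\<lambda>_. True) P (w, i)" for w i b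
    proof (induction "b - i" arbitrary: i)
      case 0
      then show ?case by (auto intro: untilp_now)
    next
      case (Suc n)
      have u: "i + 1 \<in> univ w" using univ_convex[OF Suc.prems(1-3), of "i + 1"] Suc.hyps by simp
      have "untilp linF (\<lambda>_. True) P (w, i + 1)" using Suc.hyps Suc.prems u by (intro Suc.hyps(1)) auto
      moreover have "linF (w, i) = Some (w, i + 1)"
        using Suc.prems u by (subst succ_of_Some[OF det_linF]) (auto simp: on_points_def good_point_def path_step.simps)
      ultimately show ?case by (rule_tac untilp_step) auto
    qed
    have B': "good w \<Longrightarrow> i \<in> univ w \<Longrightarrow> b \<in> univ w \<Longrightarrow> P (w, b) \<Longrightarrow> b \<le> i \<Longrightarrow> untilp linB (\<lambda>_. True) P (w, i)" for w i b
    proof (induction "i - b" arbitrary: i)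
      case 0
      then show ?case by (auto intro: untilp_now)
    next
      case (Suc n)
      then obtain i' where i': "i = i' + 1" by (cases i) auto
      have u: "i' \<in> univ w" using univ_convex[OF Suc.prems(1,3,2), of i'] Suc.hyps i' by simp
      have "untilp linB (\<lambda>_. True) P (w, i')" using Suc.hyps Suc.prems u i' by (intro Suc.hyps(1)) auto
      moreover have "linB (w, i) = Some (w, i')"
        using Suc.prems u i' by (subst succ_of_Some[OF det_linB]) (auto simp: on_points_def good_point_def path_step.simps)
      ultimately show ?case by (rule_tac untilp_step) auto
    qed
    show "(untilp linF (\<lambda>_. True) P p \<or> untilp linB (\<lambda>_. True) P p) = (\<exists>b\<in>univ (fst p). P (fst p, b))"
    proof
      assume "\<exists>b\<in>univ (fst p). P (fst p, b)"
      then obtain b where b: "b \<in> univ (fst p)" "P (fst p, b)" by blast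
      show "untilp linF (\<lambda>_. True) P p \<or> untilp linB (\<lambda>_. True) P p"
        using F'[of "fst p" "snd p" b] B'[of "fst p" "snd p" b] b g nat_le_linear[of "snd p" b] by (auto simp: good_point_def)
    qed (use F B g in blast)
  qed
qed

section \<open>Types of the pieces around a position\<close>

abbreviation unmarked :: "nat \<Rightarrow> nat" where "unmarked \<equiv> \<lambda>_. 0"

text \<open>Position \<open>0\<close> never belongs to a word, so \<open>unmarked\<close> leaves every mark unset.\<close>

definition sentence_type :: "nat \<Rightarrow> nat \<Rightarrow> 'a point \<Rightarrow> 'a wty" where
  "sentence_type K k p = wtype K k (fst p) (\<lambda>_. True) (univ (fst p)) unmarked"

definition unary_type :: "nat \<Rightarrow> nat \<Rightarrow> 'a point \<Rightarrow> 'a wty" where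
  "unary_type K k p = wtype K k (fst p) (\<lambda>_. True) (univ (fst p)) (unmarked(k := snd p))"

definition itemF_type :: "nat \<Rightarrow> nat \<Rightarrow> 'a point \<Rightarrow> 'a wty" where
  "itemF_type K k p = wtype K k (fst p) (\<lambda>_. True) (itemF (fst p) (snd p)) unmarked"

definition itemB_type :: "nat \<Rightarrow> nat \<Rightarrow> 'a point \<Rightarrow> 'a wty" where
  "itemB_type K k p = wtype K k (fst p) (\<lambda>_. True) (itemB (fst p) (snd p)) unmarked"

definition right_type :: "nat \<Rightarrow> nat \<Rightarrow> 'a point \<Rightarrow> 'a wty" where
  "right_type K k p = wtype K k (fst p) (\<lambda>_. True) (right_sibs (fst p) (snd p)) unmarked"

definition left_type :: "nat \<Rightarrow> nat \<Rightarrow> 'a point \<Rightarrow> 'a wty" where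
  "left_type K k p = wtype K k (fst p) (\<lambda>_. True) (left_sibs (fst p) (snd p)) unmarked"

text \<open>The context of \<open>p\<close> surrounds the block of \<open>p\<close>, so its sides
  are taken relative to \<open>p\<close>. The pieces above carry the constant side
  \<open>True\<close>, which is overwritten where another side is wanted.\<close>

definition outside_type :: "nat \<Rightarrow> nat \<Rightarrow> 'a point \<Rightarrow> 'a wty" where
  "outside_type K k p = wtype K k (fst p) (\<lambda>j. j < snd p) (outside (fst p) (snd p)) unmarked"

text \<open>The type of a single position is fixed by its letter and its call and return flags, as
  no edge joins it to itself. \<open>m\<close> decides whether it carries the mark
  \<open>k\<close>.\<close>

lemma ldefv_single:
  fixes m :: bool and c :: bool
  shows "ldefv (\<lambda>p :: 'a::finite point. if matched_call (fst p) (snd p) \<or> matched_ret (fst p) (snd p) then tone k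
    else wtype K k (fst p) (\<lambda>_. c) {snd p} (if m then unmarked(k := snd p) else unmarked))"
    (is "ldefv ?g")
proof (rule ldefv_det)
  show "ldefv (\<lambda>p :: 'a point. ((matched_call (fst p) (snd p) \<or> matched_ret (fst p) (snd p)),
     (lab (fst p) (snd p), (call (fst p) (snd p), ret (fst p) (snd p)))))"
    by (intro ldefv_pair ldefv_bool ldef_disj ldef_matched_call ldef_matched_ret ldefv_lab ldef_call ldef_ret)
next
  fix p q :: "'a point"
  assume g: "good_point p" "good_point q" and e: "((matched_call (fst p) (snd p) \<or> matched_ret (fst p) (snd p)),
     (lab (fst p) (snd p), (call (fst p) (snd p), ret (fst p) (snd p)))) =
     ((matched_call (fst q) (snd q) \<or> matched_ret (fst q) (snd q)),
     (lab (fst q) (snd q), (call (fst q) (snd q), ret (fst q) (snd q))))"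
  have "\<not> mu (fst p) (snd p) (snd p)" "\<not> mu (fst q) (snd q) (snd q)" "snd p \<noteq> 0" "snd q \<noteq> 0"
    using g mu_univ zero_notin unfolding good_point_def by (metis less_irrefl)+
  hence "wtype K k (fst p) (\<lambda>_. c) {snd p} (if m then unmarked(k := snd p) else unmarked) =
    wtype K k (fst q) (\<lambda>_. c) {snd q} (if m then unmarked(k := snd q) else unmarked)"
    using e by (intro wtype_iso[where h = "\<lambda>_. snd q"]) (auto simp: bij_betw_def split: if_splits)
  thus "?g p = ?g q" using e by simp
qed

text \<open>In a matched pair the flags, the order and the edge are known, so only the two letters
  vary. \<open>m1\<close> and \<open>m2\<close> place the mark \<open>k\<close> on the call or on
  the return. The call is on the left side and the return on the right, because further factors are
  placed between them.\<close>

lemma ldefv_pairT: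
  fixes m1 m2 :: bool
  shows "ldefv (\<lambda>p :: 'a::finite point. if matched_call (fst p) (snd p) then
    wtype K k (fst p) (\<lambda>j. j \<noteq> ret_of (fst p) (snd p)) {snd p, ret_of (fst p) (snd p)}
      (if m1 then unmarked(k := snd p) else if m2 then unmarked(k := ret_of (fst p) (snd p)) else unmarked) else tone k)"
    (is "ldefv ?g")
proof (rule ldefv_det)
  let ?l = "\<lambda>p :: 'a point. lab (fst p) (snd p)"
  let ?r = "\<lambda>p :: 'a point. case muF p of None \<Rightarrow> undefined | Some q \<Rightarrow> ?l q"
  show "ldefv (\<lambda>p :: 'a point. (matched_call (fst p) (snd p), (?l p, ?r p)))"
    by (intro ldefv_pair ldefv_bool ldef_matched_call ldefv_muF ldefv_lab)
  fix p q :: "'a point"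
  assume g: "good_point p" "good_point q" and e: "(matched_call (fst p) (snd p), (?l p, ?r p)) = (matched_call (fst q) (snd q), (?l q, ?r q))"
  show "?g p = ?g q"
  proof (cases "matched_call (fst p) (snd p)")
    case True
    obtain w i w' i' where pq: "p = (w, i)" "q = (w', i')" by (cases p; cases q) auto
    have G: "good w" "good w'" using g pq by (auto simp: good_point_def)
    have m: "mu w i (ret_of w i)" "mu w' i' (ret_of w' i')"
      using True e pq matched_call_mu[OF G(1)] matched_call_mu[OF G(2)] by auto
    let ?d = "ret_of w i" and ?d' = "ret_of w' i'"
    note u = mu_univ[OF G(1) m(1)] mu_univ[OF G(2) m(2)]
    have ls: "lab w i = lab w' i'" "lab w ?d = lab w' ?d'"
      using e pq muF_Some[OF G(1) m(1)] muF_Some[OF G(2) m(2)] by auto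
    have nz: "i \<noteq> 0" "i' \<noteq> 0" "?d \<noteq> 0" "?d' \<noteq> 0" using u zero_notin[OF G(1)] zero_notin[OF G(2)] by metis+
    have nm: "\<not> mu w i i" "\<not> mu w ?d i" "\<not> mu w ?d ?d" "\<not> mu w' i' i'" "\<not> mu w' ?d' i'" "\<not> mu w' ?d' ?d'"
      using u mu_univ[OF G(1), of i i] mu_univ[OF G(1), of ?d i] mu_univ[OF G(1), of ?d ?d]
        mu_univ[OF G(2), of i' i'] mu_univ[OF G(2), of ?d' i'] mu_univ[OF G(2), of ?d' ?d'] by auto
    have nc: "\<not> ret w i" "\<not> call w ?d" "\<not> ret w' i'" "\<not> call w' ?d'"
      using u not_call_ret[OF G(1)] not_call_ret[OF G(2)] by blast+
    have "wtype K k w (\<lambda>j. j \<noteq> ?d) {i, ?d} (if m1 then unmarked(k := i) else if m2 then unmarked(k := ?d) else unmarked) =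
      wtype K k w' (\<lambda>j. j \<noteq> ?d') {i', ?d'} (if m1 then unmarked(k := i') else if m2 then unmarked(k := ?d') else unmarked)"
    proof (rule wtype_iso[where h = "\<lambda>x. if x = i then i' else ?d'"])
      show "bij_betw (\<lambda>x. if x = i then i' else ?d') {i, ?d} {i', ?d'}"
        using u by (auto simp: bij_betw_def inj_on_def)
    qed (use u m ls nz nm nc in \<open>auto split: if_splits\<close>)
    moreover have "matched_call w i" "matched_call w' i'" using True e pq by auto
    ultimately show ?thesis unfolding pq fst_conv snd_conv by (simp only: if_True)
  qed (use e in simp)
qed

text \<open>This is where \<open>Within\<close> enters: a block is a word of its own, whose bare
  type is definable by assumption, and a type depends only on the substructure of its
  component.\<close>

lemma ldefv_blkT:
  fixes K k
  assumes S: "ldefv (sentence_type K k :: 'a::finite point \<Rightarrow> 'a wty)"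
  shows "ldefv (\<lambda>p :: 'a point. if matched_call (fst p) (snd p) then
     wtype K k (fst p) (\<lambda>_. True) {snd p..ret_of (fst p) (snd p)} unmarked else tone k)" (is "ldefv ?g")
proof -
  have "?g p \<in> wtypes K k" for p using wtype_wtypes tone_wtypes by auto
  moreover have "ldef (\<lambda>p. ?g p = v)" for v
  proof -
    have "ldef (\<lambda>p. (matched_call (fst p) (snd p) \<and> sentence_type K k (induced (fst p) {snd p..ret_of (fst p) (snd p)}, snd p) = v)
      \<or> \<not> matched_call (fst p) (snd p) \<and> tone k = v)"
      using ldef_within[of "\<lambda>p. sentence_type K k p = v"] S
      by (intro ldef_disj ldef_conj[of "\<lambda>p. \<not> _ p"] ldef_Not ldef_matched_call ldef_const) (auto elim: ldefvE)
    thus ?thesis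
    proof (rule ldef_cong[rotated])
      fix w :: "'a nword" and i assume g: "good w" "i \<in> univ w"
      have "univ (induced w {i..ret_of w i}) = {i..ret_of w i}" if "matched_call w i"
      proof -
        have "{i..ret_of w i} \<subseteq> univ w"
          using that matched_call_mu[OF g(1), of i] mu_univ[OF g(1), of i "ret_of w i"]
          by (intro univ_interval[OF g(1)]) auto
        thus ?thesis by (auto simp: induced_def)
      qed
      thus "((matched_call (fst (w, i)) (snd (w, i)) \<and> sentence_type K k (induced (fst (w, i)) {snd (w, i)..ret_of (fst (w, i)) (snd (w, i))}, snd (w, i)) = v)
        \<or> \<not> matched_call (fst (w, i)) (snd (w, i)) \<and> tone k = v) = (?g (w, i) = v)"
        by (auto simp: sentence_type_def wtype_induced)
    qed
  qed
  ultimately show ?thesis by (intro ldefvI[OF finite_wtypes])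
qed

lemma low_itemF_type: "low (itemF_type K (Suc j) p) = itemF_type K j p"
  by (simp add: itemF_type_def)

lemma ldefv_itemF_type:
  assumes S: "ldefv (sentence_type K k :: 'a::finite point \<Rightarrow> 'a wty)"
  shows "ldefv (itemF_type K k :: 'a point \<Rightarrow> 'a wty)"
  using ldefv_if[OF ldef_matched_ret ldefv_const[of "tone k"] ldefv_if[OF ldef_matched_call ldefv_blkT[OF S] ldefv_single[of k K True False]]]
proof (rule ldefv_cong[rotated])
  fix p :: "'a point" assume "good_point p"
  thus "(if matched_ret (fst p) (snd p) then tone k else if matched_call (fst p) (snd p) then
      if matched_call (fst p) (snd p) then wtype K k (fst p) (\<lambda>_. True) {snd p..ret_of (fst p) (snd p)} unmarked else tone k
      else if matched_call (fst p) (snd p) \<or> matched_ret (fst p) (snd p) then tone k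
      else wtype K k (fst p) (\<lambda>_. True) {snd p} (if False then unmarked(k := snd p) else unmarked)) = itemF_type K k p"
    by (auto simp: itemF_type_def itemF_def hi_def wtype_empty)
qed

lemma ldefv_itemB_type:
  assumes S: "ldefv (sentence_type K k :: 'a::finite point \<Rightarrow> 'a wty)"
  shows "ldefv (itemB_type K k :: 'a point \<Rightarrow> 'a wty)"
  using ldefv_if[OF ldef_matched_call ldefv_const[of "tone k"] ldefv_if[OF ldef_matched_ret ldefv_muB[OF ldefv_blkT[OF S]] ldefv_single[of k K True False]]]
proof (rule ldefv_cong[rotated])
  fix p :: "'a point" assume "good_point p"
  then obtain w i where p: "p = (w, i)" "good w" by (cases p) (auto simp: good_point_def)
  show "(if matched_call (fst p) (snd p) then tone k else if matched_ret (fst p) (snd p) then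
      (case muB p of None \<Rightarrow> tone k | Some p \<Rightarrow> if matched_call (fst p) (snd p) then wtype K k (fst p) (\<lambda>_. True) {snd p..ret_of (fst p) (snd p)} unmarked else tone k)
      else if matched_call (fst p) (snd p) \<or> matched_ret (fst p) (snd p) then tone k
      else wtype K k (fst p) (\<lambda>_. True) {snd p} (if False then unmarked(k := snd p) else unmarked)) = itemB_type K k p"
  proof (cases "matched_ret w i \<and> \<not> matched_call w i")
    case True
    then obtain c where c: "mu w c i" by (auto simp: matched_ret_def)
    thus ?thesis using True p muB_Some[OF p(2) c] ret_of_eq[OF p(2) c] call_of_eq[OF p(2) c]
      by (auto simp: itemB_type_def itemB_def lo_def matched_call_def)
  qed (use p in \<open>auto simp: itemB_type_def itemB_def lo_def wtype_empty\<close>)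
qed

lemma sibF_Some: "sibF p = Some q \<longleftrightarrow> good_point p \<and> good_point q \<and> fst q = fst p \<and> sib (fst p) (snd p) (snd q)"
  by (simp add: succ_of_Some[OF det_sibF] on_points_def)

lemma sibB_Some: "sibB p = Some q \<longleftrightarrow> good_point p \<and> good_point q \<and> fst q = fst p \<and> sib (fst p) (snd q) (snd p)"
  by (simp add: succ_of_Some[OF det_sibB] on_points_def)

lemma parS_Some: "parS p = Some q \<longleftrightarrow> good_point p \<and> good_point q \<and> fst q = fst p \<and> enclosing_call (fst p) (snd p) (snd q)"
  unfolding succ_of_Some[OF det_parS] by (simp add: on_points_def path_step.simps)

text \<open>Positions decrease along the path, so it stops, and \<open>F\<close> is a finite product
  of labels times the value of \<open>c\<close> at the end of the path. Such products are covered by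
  \<open>reach_definable\<close>.\<close>

lemma ldefv_foldF:
  fixes s :: "'a point \<Rightarrow> 'a point option" and lb c F :: "'a point \<Rightarrow> 'm"
  assumes cl: "closed (Collect ldef) s" and M: "aperiodic_monoid M f e" and lb: "ldefv lb" and c: "ldefv c"
    and inM: "\<And>p. lb p \<in> M" "\<And>p. c p \<in> M"
    and None: "\<And>p. good_point p \<Longrightarrow> s p = None \<Longrightarrow> F p = c p"
    and Some: "\<And>p q. good_point p \<Longrightarrow> s p = Some q \<Longrightarrow> good_point q \<and> F p = f (lb p) (F q) \<and> snd q < snd p"
  shows "ldefv F"
proof -
  note mm = apmonD[OF M]
  have ex: "good_point p \<Longrightarrow> \<exists>xs q. walk s lb M p xs q \<and> s q = None" for p
  proof (induction "snd p" arbitrary: p rule: less_induct)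
    case less
    show ?case
    proof (cases "s p")
      case (Some q)
      hence "good_point q" "snd q < snd p" using assms(8)[OF less.prems] by auto
      then obtain xs r where "walk s lb M q xs r" "s r = None" using less.hyps by blast
      thus ?thesis using Some inM by (blast intro: walk_Cons)
    next
      case None
      thus ?thesis by (blast intro: walk_Nil)
    qed
  qed
  have FM: "good_point p \<Longrightarrow> F p \<in> M" for p
  proof (induction "snd p" arbitrary: p rule: less_induct)
    case less
    show ?case
    proof (cases "s p")
      case (Some q)
      thus ?thesis using assms(8)[OF less.prems Some] less.hyps[of q] inM mm by auto
    qed (use None[OF less.prems] inM in auto)
  qed
  have w: "walk s lb M p xs q \<Longrightarrow> good_point p \<Longrightarrow> good_point q \<and> F p = f (foldr f xs e) (F q)" for p xs q
  proof (induction rule: walk.induct)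
    case (walk_Nil p)
    then show ?case using FM mm by simp
  next
    case (walk_Cons p q xs r)
    note q = Some[OF walk_Cons.prems walk_Cons.hyps(2)]
    hence r: "good_point r" "F q = f (foldr f xs e) (F r)" using walk_Cons.IH by auto
    have "foldr f xs e \<in> M" using foldr_in[OF M walk_set[OF walk_Cons.hyps(3)] mm(2)] .
    thus ?case using q r FM[of r] inM(1)[of p] mm by simp
  qed
  have lF: "(\<lambda>p. lb p = a) \<in> Collect ldef" for a using lb by (auto elim: ldefvE)
  have "ldef (\<lambda>p. F p = v)" for v
  proof -
    \<comment> \<open>The condition \<open>\<not> nextp s (\<lambda>_. True)\<close> says that the
      path ends here.\<close>
    have "(\<lambda>q. \<not> nextp s (\<lambda>_. True) q \<and> c q = b) \<in> Collect ldef" for b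
      using closed_nextp[OF cl, of "\<lambda>_. True"] c ldef_True by (auto intro!: ldef_conj ldef_Not elim: ldefvE)
    hence "ldef (reach s lb M f e a (\<lambda>q. \<not> nextp s (\<lambda>_. True) q \<and> c q = b))" for a b
      using reach_definable[OF M order.refl cl lF] by blast
    hence "ldef (\<lambda>p. \<exists>a\<in>M. \<exists>b\<in>{b\<in>M. f a b = v}. reach s lb M f e a (\<lambda>q. \<not> nextp s (\<lambda>_. True) q \<and> c q = b) p)"
      using mm(1) by (intro ldef_Bex) auto
    thus ?thesis
    proof (rule ldef_cong_good_point[rotated])
      fix p :: "'a point" assume g: "good_point p"
      show "(\<exists>a\<in>M. \<exists>b\<in>{b\<in>M. f a b = v}. reach s lb M f e a (\<lambda>q. \<not> nextp s (\<lambda>_. True) q \<and> c q = b) p) = (F p = v)"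
      proof
        assume "\<exists>a\<in>M. \<exists>b\<in>{b\<in>M. f a b = v}. reach s lb M f e a (\<lambda>q. \<not> nextp s (\<lambda>_. True) q \<and> c q = b) p"
        then obtain xs q where *: "f (foldr f xs e) (c q) = v" "walk s lb M p xs q" "\<not> nextp s (\<lambda>_. True) q"
          unfolding reach_def by blast
        have "s q = None" using *(3) by (cases "s q") (auto simp: nextp_def)
        thus "F p = v" using w[OF *(2) g] None[of q] *(1) by auto
      next
        assume v: "F p = v"
        obtain xs q where q: "walk s lb M p xs q" "s q = None" using ex[OF g] by blast
        have "good_point q" "v = f (foldr f xs e) (c q)" using w[OF q(1) g] None[of q] q(2) v by auto
        moreover have "foldr f xs e \<in> M" using foldr_in[OF M walk_set[OF q(1)] mm(2)] .
        moreover have "reach s lb M f e (foldr f xs e) (\<lambda>q'. \<not> nextp s (\<lambda>_. True) q' \<and> c q' = c q) p"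
          unfolding reach_def nextp_def using q by (intro exI[of _ xs] exI[of _ q]) simp
        ultimately show "\<exists>a\<in>M. \<exists>b\<in>{b\<in>M. f a b = v}. reach s lb M f e a (\<lambda>q. \<not> nextp s (\<lambda>_. True) q \<and> c q = b) p"
          using inM by blast
      qed
    qed
  qed
  thus ?thesis using FM by (intro ldefvI[OF mm(1)])
qed

lemma unmarked_notin: "good w \<Longrightarrow> S \<subseteq> univ w \<Longrightarrow> unmarked j \<notin> S"
  using zero_notin by auto

lemma sub_univ: "good w \<Longrightarrow> y \<in> univ w \<Longrightarrow> left_sibs w y \<subseteq> univ w \<and> right_sibs w y \<subseteq> univ w \<and> itemF w y \<subseteq> univ w \<and> itemB w y \<subseteq> univ w"
proof -
  assume g: "good w" "y \<in> univ w"
  have "{y..hi w y} \<subseteq> {lo w y..hi w y}" "{lo w y..y} \<subseteq> {lo w y..hi w y}" using lo_hi[OF g(1), of y] by auto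
  hence "{y..hi w y} \<subseteq> univ w" "{lo w y..y} \<subseteq> univ w" using blk_univ[OF g] by blast+
  thus ?thesis by (auto simp: left_sibs_def right_sibs_def itemF_def itemB_def)
qed

text \<open>On the way back the nearest item comes first although it stands last in the word, hence
  the opposite product. The label of a point is the item of its previous sibling, since
  \<open>left_sibs\<close> omits the block of the point itself.\<close>

lemma ldefv_left_type:
  assumes S: "ldefv (sentence_type K k :: 'a::finite point \<Rightarrow> 'a wty)"
  shows "ldefv (left_type K k :: 'a point \<Rightarrow> 'a wty)"
proof (rule ldefv_foldF[OF closed_sibB aperiodic_monoid_opp[OF aperiodic_monoid_wtypes]])
  show "ldefv (\<lambda>p :: 'a point. case sibB p of None \<Rightarrow> tone k | Some q \<Rightarrow> itemB_type K k q)"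
    by (rule ldefv_closed[OF closed_sibB det_sibB ldefv_itemB_type[OF S]])
  show "ldefv (\<lambda>_ :: 'a point. tone k :: 'a wty)" by (rule ldefv_const)
  show "(case sibB p of None \<Rightarrow> tone k | Some q \<Rightarrow> itemB_type K k q) \<in> wtypes K k" for p :: "'a point"
    by (auto simp: itemB_type_def tone_wtypes wtype_wtypes split: option.splits)
  show "(tone k :: 'a wty) \<in> wtypes K k" by (rule tone_wtypes)
  fix p :: "'a point" assume g: "good_point p"
  then obtain w i where p: "p = (w, i)" "good w" "i \<in> univ w" by (cases p) (auto simp: good_point_def)
  show "left_type K k p = tone k" if "sibB p = None"
  proof -
    have "\<nexists>j. sib w j i"
    proof
      assume "\<exists>j. sib w j i"
      then obtain j where "sib w j i" by blast
      hence "sibB p = Some (w, j)" unfolding sibB_Some using p by (auto simp: good_point_def sib_def)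
      thus False using that by simp
    qed
    thus ?thesis using left_sibs_end[OF p(2,3)] p(1) by (simp add: left_type_def wtype_empty)
  qed
  fix q assume s: "sibB p = Some q"
  then obtain j where q: "q = (w, j)" "good_point q" "sib w j i" using p by (cases q) (auto simp: sibB_Some)
  have "wtype K k w (\<lambda>_. True) (left_sibs w j \<union> itemB w j) unmarked = tmult k (left_type K k q) (itemB_type K k q)"
    unfolding left_type_def itemB_type_def q(1) fst_conv snd_conv
    using left_sibs_step[OF p(2) q(3)] sub_univ[OF p(2), of j] zero_notin[OF p(2)] q(2)[unfolded good_point_def q(1)]
    by (intro wtype_Un) auto
  moreover have "left_sibs w i = left_sibs w j \<union> itemB w j" using left_sibs_step[OF p(2) q(3)] by simp
  ultimately show "good_point q \<and> left_type K k p = tmult k (left_type K k q) (case sibB p of None \<Rightarrow> tone k | Some q \<Rightarrow> itemB_type K k q) \<and> snd q < snd p"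
    using s q p sib_less[OF p(2) q(3)] by (simp add: left_type_def)
qed

text \<open>Every fact of rank \<open>0\<close> mentions a mark, and none is set.\<close>

lemma wtype_zero:
  assumes "good (w :: 'a::finite nword)" "S \<subseteq> univ w"
  shows "wtype K 0 w sd S unmarked = tone 0"
proof -
  have "fo_fv a \<noteq> {}" if "a \<in> atoms K" for a :: "'a fo" using that by (rule atoms_cases) auto
  thus ?thesis using unmarked_notin[OF assms] by (auto simp: facts_def)
qed

section \<open>Right siblings, possibly infinitely many\<close>

definition next_item :: "nat \<Rightarrow> nat \<Rightarrow> 'a point \<Rightarrow> 'a wty" where
  "next_item K j p = (case sibF p of None \<Rightarrow> tone j | Some z \<Rightarrow> itemF_type K j z)"

lemma next_item_wtypes: "next_item K j (p :: 'a::finite point) \<in> wtypes K j"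
  by (auto simp: next_item_def itemF_type_def tone_wtypes wtype_wtypes split: option.splits)

text \<open>A mark behind the end of the walk leaves the prefix unmarked. The prefix thus
  contributes the product of its item types, and only the suffix sees the mark.\<close>

lemma right_sibs_walk:
  fixes w :: "'a::finite nword"
  assumes "walk sibF (next_item K j) A p xs q" "good_point p" "fst p = w"
  shows "good_point q \<and> fst q = w \<and> right_sibs w (snd q) \<subseteq> right_sibs w (snd p) \<and>
     (\<forall>b\<in>right_sibs w (snd q). wtype K j w (\<lambda>_. True) (right_sibs w (snd p)) (unmarked(j := b)) =
        tmult j (foldr (tmult j) xs (tone j)) (wtype K j w (\<lambda>_. True) (right_sibs w (snd q)) (unmarked(j := b))))"
  using assms
proof (induction rule: walk.induct)
  case (walk_Nil p)
  then show ?case by (simp add: tmult_tone[OF wtype_wtypes])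
next
  case (walk_Cons p q xs r)
  let ?z = "snd q"
  have q: "good_point q" "fst q = w" "sib w (snd p) ?z" using walk_Cons.hyps walk_Cons.prems by (auto simp: sibF_Some)
  have g: "good w" "?z \<in> univ w" using q by (auto simp: good_point_def)
  have R: "right_sibs w (snd p) = itemF w ?z \<union> right_sibs w ?z" "splits w (\<lambda>_. True) (itemF w ?z) (right_sibs w ?z)"
    using right_sibs_step[OF g(1) q(3)] by auto
  have IH: "good_point r" "fst r = w" "right_sibs w (snd r) \<subseteq> right_sibs w ?z"
    "b \<in> right_sibs w (snd r) \<Longrightarrow> wtype K j w (\<lambda>_. True) (right_sibs w ?z) (unmarked(j := b)) =
        tmult j (foldr (tmult j) xs (tone j)) (wtype K j w (\<lambda>_. True) (right_sibs w (snd r)) (unmarked(j := b)))" for b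
    using walk_Cons.IH[OF q(1,2)] by blast+
  have "walk s lb A p xs q \<Longrightarrow> set xs \<subseteq> range lb" for s lb A p xs and q :: "'a point"
    by (induction rule: walk.induct) auto
  from this[OF walk_Cons.hyps(3)] have xs: "set xs \<subseteq> wtypes K j" using next_item_wtypes by blast
  have "wtype K j w (\<lambda>_. True) (right_sibs w (snd p)) (unmarked(j := b)) =
     tmult j (foldr (tmult j) (next_item K j p # xs) (tone j)) (wtype K j w (\<lambda>_. True) (right_sibs w (snd r)) (unmarked(j := b)))"
    if b: "b \<in> right_sibs w (snd r)" for b
  proof -
    have bz: "b \<in> right_sibs w ?z" using b IH by auto
    have nz: "0 \<notin> itemF w ?z \<union> right_sibs w ?z" using sub_univ[OF g] zero_notin[OF g(1)] by auto
    have "wtype K j w (\<lambda>_. True) (right_sibs w (snd p)) (unmarked(j := b)) =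
      tmult j (wtype K j w (\<lambda>_. True) (itemF w ?z) (unmarked(j := b))) (wtype K j w (\<lambda>_. True) (right_sibs w ?z) (unmarked(j := b)))"
      unfolding R(1) using R(2) nz by (intro wtype_Un) auto
    also have "wtype K j w (\<lambda>_. True) (itemF w ?z) (unmarked(j := b)) = itemF_type K j q"
      unfolding itemF_type_def q(2) using R(2) bz nz by (intro wtype_cong) (auto simp: splits_def)
    finally show ?thesis using walk_Cons.hyps(2) IH(4)[OF b]
      tmult_assoc[of "itemF_type K j q" K j "foldr (tmult j) xs (tone j)" "wtype K j w (\<lambda>_. True) (right_sibs w (snd r)) (unmarked(j := b))"]
      foldr_in[OF aperiodic_monoid_wtypes xs tone_wtypes] by (simp add: next_item_def itemF_type_def wtype_wtypes del: fun_upd_apply)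
  qed
  thus ?case using IH(1-3) R(1) by blast
qed

text \<open>The distance to \<open>b\<close> shrinks with every step, so the item of
  \<open>b\<close> is met after finitely many siblings even if the sequence is infinite.\<close>

lemma right_sibs_reach:
  fixes w :: "'a::finite nword"
  assumes "good w"
  shows "i \<in> univ w \<Longrightarrow> b \<in> right_sibs w i \<Longrightarrow> \<exists>xs q z. walk sibF (next_item K j) (wtypes K j) (w, i) xs q
     \<and> sibF q = Some z \<and> b \<in> itemF w (snd z)"
proof (induction "b - i" arbitrary: i rule: less_induct)
  case less
  obtain z where z: "sib w i z" using right_sibs_end[OF assms less.prems(1)] less.prems(2) by blast
  have zu: "z \<in> univ w" "i < z" using z sib_less[OF assms z] by (auto simp: sib_def)
  have s: "sibF (w, i) = Some (w, z)" using z zu assms less.prems by (simp add: sibF_Some good_point_def)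
  show ?case
  proof (cases "b \<in> itemF w z")
    case True
    thus ?thesis using s by (intro exI[of _ "[]"] exI[of _ "(w, i)"] exI[of _ "(w, z)"]) (auto intro: walk_Nil)
  next
    case False
    hence bz: "b \<in> right_sibs w z" using right_sibs_step[OF assms z] less.prems by auto
    hence "z < b" using lo_hi(2)[OF assms, of z] by (auto simp: right_sibs_def)
    then obtain xs q z' where "walk sibF (next_item K j) (wtypes K j) (w, z) xs q"
      "sibF q = Some z'" "b \<in> itemF w (snd z')"
      using less.hyps[OF diff_less_mono2[OF zu(2) order.strict_trans[OF zu(2) \<open>z < b\<close>]] zu(1) bz] by blast
    moreover have "next_item K j (w, i) \<in> wtypes K j"
      by (rule next_item_wtypes)
    ultimately show ?thesis
      using walk_Cons[of "next_item K j" "(w, i)" "wtypes K j" sibF "(w, z)" xs q]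
        s by blast
  qed
qed

text \<open>
  The sequence of right siblings may be infinite. Induction on the rank avoids infinite products:
  a position \<open>b\<close> splits the sequence into a finite prefix, the item of \<open>b\<close>, and a suffix whose
  type of the lower rank is already definable.
\<close>

lemma ldefv_right_type_Suc:
  fixes K j
  assumes I: "ldefv (itemF_type K (Suc j) :: 'a::finite point \<Rightarrow> 'a wty)"
    and R: "ldefv (right_type K j :: 'a point \<Rightarrow> 'a wty)"
  shows "ldefv (right_type K (Suc j) :: 'a point \<Rightarrow> 'a wty)"
proof -
  let ?lb = "next_item K j :: 'a point \<Rightarrow> 'a wty"
  let ?M = "wtypes K j :: 'a wty set"
  let ?S = "\<lambda>p :: 'a point. (\<lambda>b. wtype K j (fst p) (\<lambda>_. True) (right_sibs (fst p) (snd p)) (unmarked(j := b))) ` right_sibs (fst p) (snd p)"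
  have I': "ldefv (itemF_type K j :: 'a point \<Rightarrow> 'a wty)"
    using ldefv_comp[OF I, of low] unfolding low_itemF_type .
  have lb: "ldefv ?lb" unfolding next_item_def[abs_def] by (rule ldefv_closed[OF closed_sibF det_sibF I'])
  have lF: "(\<lambda>p. ?lb p = a) \<in> Collect ldef" for a using lb by (auto elim: ldefvE)
  \<comment> \<open>\<open>?Q s b\<close> holds just before the item that contains the marked
    position: \<open>s\<close> is a type of this item with the mark placed, and \<open>b\<close> is
    the unmarked type of everything behind it.\<close>
  let ?Q = "\<lambda>s b. nextp sibF (\<lambda>z :: 'a point. s \<in> subs (itemF_type K (Suc j) z) \<and> right_type K j z = b)"
  have Q: "ldef (?Q s b)" for s b
  proof -
    have "ldef (\<lambda>z. s \<in> subs (itemF_type K (Suc j) z))" using ldefv_mem[OF I, of "{t. s \<in> subs t}"] by simp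
    hence "ldef (\<lambda>z. s \<in> subs (itemF_type K (Suc j) z) \<and> right_type K j z = b)" using R by (intro ldef_conj) (auto elim: ldefvE)
    thus ?thesis using closed_nextp[OF closed_sibF] by auto
  qed
  have rd: "ldef (reach sibF ?lb ?M (tmult j) (tone j) a (?Q s b))" for a s b
    using reach_definable[OF aperiodic_monoid_wtypes order.refl closed_sibF lF] Q by auto
  have mem: "v \<in> ?S p \<longleftrightarrow> (\<exists>a\<in>?M. \<exists>s\<in>?M. \<exists>b\<in>{b\<in>?M. tmult j a (tmult j s b) = v}. reach sibF ?lb ?M (tmult j) (tone j) a (?Q s b) p)"
    if g: "good_point p" for p v
  proof -
    obtain w i where p: "p = (w, i)" "good w" "i \<in> univ w" using g by (cases p) (auto simp: good_point_def)
    have dec: "wtype K j w (\<lambda>_. True) (right_sibs w i) (unmarked(j := b)) =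
       tmult j (foldr (tmult j) xs (tone j)) (tmult j (wtype K j w (\<lambda>_. True) (itemF w (snd z)) (unmarked(j := b))) (right_type K j z)) \<and> b \<in> right_sibs w i
       \<and> foldr (tmult j) xs (tone j) \<in> ?M"
      if w: "walk sibF ?lb ?M p xs q" and z: "sibF q = Some z" and b: "b \<in> itemF w (snd z)" for xs q z b
    proof -
      have q: "good_point q" "fst q = w" using right_sibs_walk[OF w g] p by auto
      have zz: "good_point z" "fst z = w" "sib w (snd q) (snd z)" using z q by (auto simp: sibF_Some)
      have st: "right_sibs w (snd q) = itemF w (snd z) \<union> right_sibs w (snd z)" "splits w (\<lambda>_. True) (itemF w (snd z)) (right_sibs w (snd z))"
        using right_sibs_step[OF p(2) zz(3)] by auto
      have bq: "b \<in> right_sibs w (snd q)" using st b by simp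
      have nz: "0 \<notin> itemF w (snd z) \<union> right_sibs w (snd z)"
        using sub_univ[OF p(2), of "snd z"] zz zero_notin[OF p(2)] by (auto simp: good_point_def)
      have "wtype K j w (\<lambda>_. True) (right_sibs w (snd q)) (unmarked(j := b)) =
        tmult j (wtype K j w (\<lambda>_. True) (itemF w (snd z)) (unmarked(j := b))) (wtype K j w (\<lambda>_. True) (right_sibs w (snd z)) (unmarked(j := b)))"
        unfolding st(1) using st(2) nz by (intro wtype_Un) auto
      also have "wtype K j w (\<lambda>_. True) (right_sibs w (snd z)) (unmarked(j := b)) = right_type K j z"
        unfolding right_type_def zz(2) using st(2) b nz by (intro wtype_cong) (auto simp: splits_def)
      finally have "wtype K j w (\<lambda>_. True) (right_sibs w i) (unmarked(j := b)) =
         tmult j (foldr (tmult j) xs (tone j)) (tmult j (wtype K j w (\<lambda>_. True) (itemF w (snd z)) (unmarked(j := b))) (right_type K j z))"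
        using right_sibs_walk[OF w g, of w] p bq by (simp del: fun_upd_apply)
      moreover have "b \<in> right_sibs w i" using right_sibs_walk[OF w g, of w] p bq by auto
      ultimately show ?thesis using foldr_in[OF aperiodic_monoid_wtypes walk_set[OF w] tone_wtypes] by (simp del: fun_upd_apply)
    qed
    show ?thesis
    proof
      assume "v \<in> ?S p"
      then obtain b where b: "b \<in> right_sibs w i" "v = wtype K j w (\<lambda>_. True) (right_sibs w i) (unmarked(j := b))" using p by auto
      obtain xs q z where w: "walk sibF ?lb ?M p xs q" "sibF q = Some z" "b \<in> itemF w (snd z)"
        using right_sibs_reach[OF p(2,3) b(1)] p by blast
      have zw: "fst z = w" using w(2) right_sibs_walk[OF w(1) g] p by (auto simp: sibF_Some)
      let ?s = "wtype K j w (\<lambda>_. True) (itemF w (snd z)) (unmarked(j := b))"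
      have "?s \<in> subs (itemF_type K (Suc j) z)" unfolding itemF_type_def wtype_subs zw using w(3) by blast
      hence "reach sibF ?lb ?M (tmult j) (tone j) (foldr (tmult j) xs (tone j)) (?Q ?s (right_type K j z)) p"
        using w(1,2) unfolding reach_def nextp_def by blast
      moreover have "right_type K j z \<in> ?M" "?s \<in> ?M" by (auto simp: right_type_def wtype_wtypes)
      ultimately show "\<exists>a\<in>?M. \<exists>s\<in>?M. \<exists>b\<in>{b\<in>?M. tmult j a (tmult j s b) = v}. reach sibF ?lb ?M (tmult j) (tone j) a (?Q s b) p"
        using dec[OF w] b(2)
        by (intro bexI[of _ "foldr (tmult j) xs (tone j)"] bexI[of _ ?s] bexI[of _ "right_type K j z"]) (simp_all del: fun_upd_apply)
    next
      assume "\<exists>a\<in>?M. \<exists>s\<in>?M. \<exists>b\<in>{b\<in>?M. tmult j a (tmult j s b) = v}. reach sibF ?lb ?M (tmult j) (tone j) a (?Q s b) p"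
      then obtain s xs q z where *: "tmult j (foldr (tmult j) xs (tone j)) (tmult j s (right_type K j z)) = v"
        "walk sibF ?lb ?M p xs q" "sibF q = Some z" "s \<in> subs (itemF_type K (Suc j) z)"
        unfolding reach_def nextp_def by blast
      have zw: "fst z = w" using *(3) right_sibs_walk[OF *(2) g] p by (auto simp: sibF_Some)
      obtain b where b: "b \<in> itemF w (snd z)" "s = wtype K j w (\<lambda>_. True) (itemF w (snd z)) (unmarked(j := b))"
        using *(4) unfolding itemF_type_def wtype_subs zw by blast
      have "v = wtype K j w (\<lambda>_. True) (right_sibs w i) (unmarked(j := b))" "b \<in> right_sibs w i"
        using dec[OF *(2,3) b(1)] *(1) b(2) by simp_all
      thus "v \<in> ?S p" unfolding p(1) fst_conv snd_conv by (rule image_eqI)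
    qed
  qed
  have memd: "ldef (\<lambda>p. v \<in> ?S p)" for v
  proof (rule ldef_cong_good_point)
    show "ldef (\<lambda>p. \<exists>a\<in>?M. \<exists>s\<in>?M. \<exists>b\<in>{b\<in>?M. tmult j a (tmult j s b) = v}. reach sibF ?lb ?M (tmult j) (tone j) a (?Q s b) p)"
      by (intro ldef_Bex rd) (simp_all add: finite_wtypes)
  qed (use mem in simp)
  have "?S p \<subseteq> ?M" for p by (auto simp: wtype_wtypes)
  \<comment> \<open>A set of types is determined by which of the finitely many types it contains, so
    an equation between sets becomes a finite conjunction.\<close>
  hence e: "?S p = X \<longleftrightarrow> X \<subseteq> ?M \<and> (\<forall>v\<in>?M. v \<in> ?S p \<longleftrightarrow> v \<in> X)" for p X by blast
  have Sd: "ldefv ?S"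
  proof (rule ldefvI)
    show "finite (Pow ?M)" by (simp add: finite_wtypes)
    show "?S p \<in> Pow ?M" for p using \<open>\<And>p. ?S p \<subseteq> ?M\<close> by blast
    fix X
    have "ldef (\<lambda>p. (v \<in> ?S p) = (v \<in> X))" for v using memd[of v] ldef_Not[OF memd[of v]] by (cases "v \<in> X") simp_all
    thus "ldef (\<lambda>p. ?S p = X)" unfolding e by (intro ldef_conj ldef_Ball ldef_const finite_wtypes)
  qed
  have "right_type K (Suc j) p = node (right_type K j p) (?S p)" for p :: "'a point"
    by (simp add: right_type_def)
  thus ?thesis using ldefv_comp2[OF R Sd, of node] by presburger
qed

lemma ldefv_right_type:
  assumes S: "ldefv (sentence_type K k :: 'a::finite point \<Rightarrow> 'a wty)"
  shows "ldefv (right_type K k :: 'a point \<Rightarrow> 'a wty)"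
proof -
  have I: "ldefv (itemF_type K k :: 'a point \<Rightarrow> 'a wty) \<Longrightarrow> ldefv (right_type K k :: 'a point \<Rightarrow> 'a wty)"
  proof (induction k)
    case 0
    show ?case
    proof (rule ldefv_cong)
      show "ldefv (\<lambda>_ :: 'a point. tone 0 :: 'a wty)" by (rule ldefv_const)
      fix p :: "'a point" assume "good_point p"
      thus "tone 0 = right_type K 0 p"
        using wtype_zero[of "fst p" "right_sibs (fst p) (snd p)"] sub_univ[of "fst p" "snd p"] by (simp add: right_type_def good_point_def del: wtype.simps)
    qed
  next
    case (Suc k)
    have "ldefv (itemF_type K k :: 'a point \<Rightarrow> 'a wty)"
      using ldefv_comp[OF Suc.prems, of low] unfolding low_itemF_type .
    then show ?case using ldefv_right_type_Suc[OF Suc.prems] Suc.IH by blast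
  qed
  thus ?thesis using ldefv_itemF_type[OF S] by blast
qed

section \<open>From first-order logic to the temporal logic\<close>

definition pair_type :: "nat \<Rightarrow> nat \<Rightarrow> bool \<Rightarrow> bool \<Rightarrow> 'a point \<Rightarrow> 'a wty" where
  "pair_type K k m1 m2 p = (if matched_call (fst p) (snd p) then
    wtype K k (fst p) (\<lambda>j. j \<noteq> ret_of (fst p) (snd p)) {snd p, ret_of (fst p) (snd p)}
      (if m1 then unmarked(k := snd p) else if m2 then unmarked(k := ret_of (fst p) (snd p)) else unmarked) else tone k)"

lemma ldefv_pair_type: "ldefv (pair_type K k m1 m2 :: 'a::finite point \<Rightarrow> 'a wty)"
  using ldefv_pairT[of K k m1 m2] unfolding pair_type_def[abs_def] .

lemma pair_type_wtypes: "pair_type K k m1 m2 (p :: 'a::finite point) \<in> wtypes K k"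
  by (simp add: pair_type_def tone_wtypes wtype_wtypes)

lemma pair_type_eq:
  "good w \<Longrightarrow> mu w c d \<Longrightarrow> pair_type K k m1 m2 (w, c) = wtype K k w (\<lambda>j. j \<noteq> d) {c, d}
     (if m1 then unmarked(k := c) else if m2 then unmarked(k := d) else unmarked)"
  using ret_of_eq[of w c d] by (auto simp: pair_type_def matched_call_def)

text \<open>The left siblings already have side \<open>True\<close>. The right ones get side
  \<open>False\<close>, since they follow \<open>y\<close> and all that is placed between the two
  sequences.\<close>

definition sibs_type :: "nat \<Rightarrow> nat \<Rightarrow> 'a point \<Rightarrow> 'a wty" where
  "sibs_type K k p = tmult k (left_type K k p) (set_side False k (right_type K k p))"

lemma sibs_type_wtypes: "sibs_type K k (p :: 'a::finite point) \<in> wtypes K k"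
  unfolding sibs_type_def left_type_def right_type_def wtype_set_side[symmetric] by (intro tmult_wtypes wtype_wtypes)

lemma sibs_type_eq:
  fixes w :: "'a::finite nword"
  assumes "good w" "y \<in> univ w"
  shows "sibs_type K k (w, y) = wtype K k w (\<lambda>j. j < y) (left_sibs w y \<union> right_sibs w y) unmarked"
proof -
  note lh = lo_hi[OF assms(1), of y]
  have "wtype K k w (\<lambda>j. j < y) (left_sibs w y \<union> right_sibs w y) unmarked =
    tmult k (wtype K k w (\<lambda>j. j < y) (left_sibs w y) unmarked) (wtype K k w (\<lambda>j. j < y) (right_sibs w y) unmarked)"
    using splits_left_sibs_right_sibs[OF assms(1)] sub_univ[OF assms] zero_notin[OF assms(1)] by (intro wtype_Un) auto
  also have "wtype K k w (\<lambda>j. j < y) (left_sibs w y) unmarked = left_type K k (w, y)"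
    unfolding left_type_def fst_conv snd_conv using lh by (intro wtype_cong) (auto simp: left_sibs_def)
  also have "wtype K k w (\<lambda>j. j < y) (right_sibs w y) unmarked = wtype K k w (\<lambda>_. False) (right_sibs w y) unmarked"
    using lh by (intro wtype_cong) (auto simp: right_sibs_def)
  also have "\<dots> = set_side False k (right_type K k (w, y))" unfolding right_type_def fst_conv snd_conv by (rule wtype_set_side)
  finally show ?thesis by (simp add: sibs_type_def)
qed

text \<open>Along the enclosing calls the context unfolds outwards until the top level, where only
  siblings remain. The current layer is the innermost one and therefore the last factor, hence the
  opposite product.\<close>

lemma ldefv_outside_type:
  assumes S: "ldefv (sentence_type K k :: 'a::finite point \<Rightarrow> 'a wty)"
  shows "ldefv (outside_type K k :: 'a point \<Rightarrow> 'a wty)"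
proof (rule ldefv_foldF[OF closed_parS aperiodic_monoid_opp[OF aperiodic_monoid_wtypes]])
  \<comment> \<open>The enclosing pair is read off at its call. At the top level there is none, and
    \<open>tone k\<close> merely makes the label total.\<close>
  let ?P = "\<lambda>p :: 'a point. case parS p of None \<Rightarrow> tone k | Some c \<Rightarrow> pair_type K k False False c"
  have Q: "ldefv (sibs_type K k :: 'a point \<Rightarrow> 'a wty)"
    using ldefv_comp2[OF ldefv_left_type[OF S] ldefv_right_type[OF S], of "\<lambda>x y. tmult k x (set_side False k y)"] unfolding sibs_type_def[abs_def] .
  show "ldefv (\<lambda>p. tmult k (?P p) (sibs_type K k p))"
    by (rule ldefv_comp2[OF ldefv_closed[OF closed_parS det_parS ldefv_pair_type] Q])
  show "ldefv (sibs_type K k :: 'a point \<Rightarrow> 'a wty)" by fact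
  have "?P p \<in> wtypes K k" for p by (cases "parS p") (simp_all add: pair_type_wtypes tone_wtypes)
  thus "tmult k (?P p) (sibs_type K k p) \<in> wtypes K k" for p by (intro tmult_wtypes sibs_type_wtypes)
  show "sibs_type K k p \<in> wtypes K k" for p :: "'a point" by (rule sibs_type_wtypes)
  fix p :: "'a point" assume gp: "good_point p"
  then obtain w y where p: "p = (w, y)" and g: "good w" "y \<in> univ w" by (cases p) (auto simp: good_point_def)
  show "outside_type K k p = sibs_type K k p" if "parS p = None"
  proof -
    have "top_pos w y"
    proof (rule ccontr)
      assume "\<not> top_pos w y"
      then obtain c where c: "enclosing_call w y c" using enclosing_call_ex[OF g(1)] by blast
      hence "c \<in> univ w" using mu_univ[OF g(1)] unfolding enclosing_call_iff[OF g(1)] encloses_def by blast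
      hence "parS p = Some (w, c)" unfolding parS_Some using c g p by (simp add: good_point_def)
      thus False using that by simp
    qed
    thus ?thesis unfolding p sibs_type_eq[OF g] outside_type_def fst_conv snd_conv outside_top[OF g(1) \<open>top_pos w y\<close>] by simp
  qed
  fix q assume s: "parS p = Some q"
  then obtain c where q: "q = (w, c)" "good_point q" "enclosing_call w y c" using p by (cases q) (auto simp: parS_Some)
  then obtain d where e: "encloses w c d y" "\<forall>c' d'. encloses w c' d' y \<longrightarrow> c' \<le> c" unfolding enclosing_call_iff[OF g(1)] by blast
  have cd: "mu w c d" "c < y" "y < d" using e by (auto simp: encloses_def)
  have lh: "lo w c = c" "hi w c = d"
    using cd ret_of_eq[OF g(1) cd(1)] not_call_ret[OF g(1)] mu_univ[OF g(1)]
    by (auto simp: lo_def hi_def matched_ret_def matched_call_def)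
  note O = outside_parent[OF g(1) e g(2)] and B = parent_block[OF g(1) e g(2)]
  have nz: "0 \<notin> univ w" using zero_notin[OF g(1)] .
  have su: "left_sibs w y \<union> right_sibs w y \<subseteq> univ w" "c \<in> univ w" "d \<in> univ w" "outside w c \<subseteq> univ w"
    using sub_univ[OF g] mu_univ[OF g(1) cd(1)] by (auto simp: outside_def[OF g(1)])
  hence nz': "0 \<notin> outside w c \<union> ({c, d} \<union> (left_sibs w y \<union> right_sibs w y))" using nz by (metis Un_iff insert_iff empty_iff subsetD)
  have "outside_type K k p = wtype K k w (\<lambda>j. j < y) (outside w c \<union> ({c, d} \<union> (left_sibs w y \<union> right_sibs w y))) unmarked"
    unfolding outside_type_def p fst_conv snd_conv O(1) ..
  also have "\<dots> = tmult k (wtype K k w (\<lambda>j. j < y) (outside w c) unmarked) (wtype K k w (\<lambda>j. j < y) ({c, d} \<union> (left_sibs w y \<union> right_sibs w y)) unmarked)"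
    using nz' by (intro wtype_Un[OF O(2)]) simp
  also have "wtype K k w (\<lambda>j. j < y) ({c, d} \<union> (left_sibs w y \<union> right_sibs w y)) unmarked =
     tmult k (wtype K k w (\<lambda>j. j < y) {c, d} unmarked) (sibs_type K k p)"
    unfolding p sibs_type_eq[OF g] using nz' by (intro wtype_Un[OF B(3)]) simp
  also have "wtype K k w (\<lambda>j. j < y) {c, d} unmarked = pair_type K k False False q"
    unfolding q(1) pair_type_eq[OF g(1) cd(1)] using cd by (simp, intro wtype_cong) auto
  \<comment> \<open>No position of this context lies in \<open>{c..d}\<close>, so being left of
    \<open>y\<close> and being left of \<open>c\<close> agree on it.\<close>
  also have "wtype K k w (\<lambda>j. j < y) (outside w c) unmarked = outside_type K k q"
    unfolding outside_type_def q(1) fst_conv snd_conv using cd lh by (intro wtype_cong) (auto simp: outside_def[OF g(1)])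
  finally show "good_point q \<and> outside_type K k p = tmult k (outside_type K k q) (tmult k (?P p) (sibs_type K k p)) \<and> snd q < snd p"
    using s q p cd by simp
qed

section \<open>The block of the marked position\<close>

definition interior_type :: "nat \<Rightarrow> nat \<Rightarrow> 'a point \<Rightarrow> 'a wty" where
  "interior_type K k p = (case linF p of None \<Rightarrow> tone k | Some z \<Rightarrow>
     if matched_ret (fst z) (snd z) then tone k else tmult k (itemF_type K k z) (right_type K k z))"

lemma ldefv_interior_type:
  assumes S: "ldefv (sentence_type K k :: 'a::finite point \<Rightarrow> 'a wty)"
  shows "ldefv (interior_type K k :: 'a point \<Rightarrow> 'a wty)"
  unfolding interior_type_def[abs_def]
  by (intro ldefv_closed[OF closed_linF det_linF] ldefv_if ldef_matched_ret ldefv_const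
      ldefv_comp2[OF ldefv_itemF_type[OF S] ldefv_right_type[OF S]])

lemma splits_item_right_sibs:
  assumes g: "good w" and z: "z \<in> univ w" and "\<not> matched_ret w z"
  shows "itemF w z = {z..hi w z}" "lo w z = z" "splits w (\<lambda>_. True) (itemF w z) (right_sibs w z)"
proof -
  show i: "itemF w z = {z..hi w z}" and l: "lo w z = z" using assms by (auto simp: itemF_def lo_def)
  have "\<not> mu w i j \<and> \<not> mu w j i" if "i \<in> {z..hi w z}" "j \<notin> {z..hi w z}" for i j
    using that blk_closed[OF g, of i j z] blk_closed[OF g, of j i z] l by auto
  moreover have "j \<notin> {z..hi w z}" if "j \<in> right_sibs w z" for j using that by (auto simp: right_sibs_def)
  ultimately show "splits w (\<lambda>_. True) (itemF w z) (right_sibs w z)"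
    unfolding splits_def i by (fastforce simp: right_sibs_def)
qed

text \<open>The interior consists of the item of its first position and the right siblings of that
  position. If \<open>c + 1\<close> is a matched return, nesting forces it to be \<open>d\<close>,
  and the interior is empty.\<close>

lemma interior_type_eq:
  fixes w :: "'a::finite nword"
  assumes g: "good w" and cd: "mu w c d"
  shows "interior_type K k (w, c) = wtype K k w (\<lambda>_. True) {c<..<d} unmarked"
proof -
  note u = mu_univ[OF g cd]
  have z: "c + 1 \<in> univ w" using univ_convex[OF g, of c d "c + 1"] u by simp
  have l: "linF (w, c) = Some (w, c + 1)"
    using g u z by (subst succ_of_Some[OF det_linF]) (auto simp: on_points_def good_point_def path_step.simps)
  show ?thesis
  proof (cases "matched_ret w (c + 1)")
    case True
    then obtain c' where c': "mu w c' (c + 1)" by (auto simp: matched_ret_def)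
    note u' = mu_univ[OF g c']
    have "\<not> c' < c" using nest[OF g c' cd] u by auto
    hence "c' = c" using u' by auto
    hence "d = c + 1" using mu_fun[OF g c'] cd by auto
    hence "{c<..<d} = {}" by auto
    thus ?thesis using True l by (simp add: interior_type_def wtype_empty)
  next
    case False
    let ?z = "c + 1"
    have zd: "?z < d" using False u cd by (metis Suc_eq_plus1 Suc_lessI matched_ret_def)
    have ez: "encloses w c d ?z" using cd zd by (simp add: encloses_def)
    have hd: "hi w ?z < d" using encloses_blk[OF g ez, of "hi w ?z"] lo_hi[OF g, of ?z] by (auto simp: encloses_def)
    note sp = splits_item_right_sibs[OF g z False]
    have le: "d \<le> d'" if "encloses w c' d' ?z" for c' d'
    proof (cases "c' = c")
      case True thus ?thesis using that mu_fun[OF g cd, of d'] by (simp add: encloses_def)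
    next
      case False
      thus ?thesis using that nest[OF g, of c' d' c d] cd by (auto simp: encloses_def)
    qed
    have R: "right_sibs w ?z = {hi w ?z<..<d}"
    proof (intro equalityI subsetI)
      fix x assume "x \<in> {hi w ?z<..<d}"
      moreover hence "x \<in> univ w" using univ_convex[OF g, of c d x] u lo_hi(2)[OF g, of ?z] by auto
      ultimately show "x \<in> right_sibs w ?z" using le by (fastforce simp: right_sibs_def)
    qed (use ez in \<open>auto simp: right_sibs_def\<close>)
    have "{c<..<d} = itemF w ?z \<union> right_sibs w ?z" unfolding R sp(1) using hd lo_hi(2)[OF g, of ?z] by auto
    moreover have "wtype K k w (\<lambda>_. True) (itemF w ?z \<union> right_sibs w ?z) unmarked = tmult k (itemF_type K k (w, ?z)) (right_type K k (w, ?z))"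
      unfolding itemF_type_def right_type_def fst_conv snd_conv
      using sp(3) sub_univ[OF g z] zero_notin[OF g] by (intro wtype_Un) auto
    ultimately show ?thesis using False l by (simp add: interior_type_def)
  qed
qed

text \<open>The interior sits between call and return, so the pair is the outer factor of the
  product, with the return as its only position on the right side.\<close>

lemma pair_type_interior_type_eq:
  fixes w :: "'a::finite nword"
  assumes g: "good w" and cd: "mu w c d"
  shows "tmult k (pair_type K k m1 m2 (w, c)) (interior_type K k (w, c)) = wtype K k w (\<lambda>j. j \<noteq> d) {c..d}
     (if m1 then unmarked(k := c) else if m2 then unmarked(k := d) else unmarked)" (is "_ = wtype _ _ _ _ _ ?\<sigma>")
proof -
  note u = mu_univ[OF g cd]
  have nz: "0 \<notin> univ w" using zero_notin[OF g] .
  have S: "{c..d} = {c, d} \<union> {c<..<d}" using u by auto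
  have "splits w (\<lambda>j. j \<noteq> d) {c, d} {c<..<d}"
  proof -
    have "\<not> mu w c b \<and> \<not> mu w b d \<and> \<not> mu w b c \<and> \<not> mu w d b" if "b \<in> {c<..<d}" for b
      using that mu_fun[OF g cd, of b] mu_inj[OF g cd, of b] mu_univ[OF g, of b c] mu_univ[OF g, of d b] by auto
    thus ?thesis using u unfolding splits_def by auto
  qed
  moreover have "?\<sigma> j \<notin> {c, d} \<union> {c<..<d}" if "j < k" for j
  proof -
    have "?\<sigma> j = 0" using that by simp
    moreover have "0 \<notin> {c, d} \<union> {c<..<d}" using u nz by (metis Un_iff empty_iff greaterThanLessThan_iff insert_iff not_less_zero)
    ultimately show ?thesis by simp
  qed
  ultimately have "wtype K k w (\<lambda>j. j \<noteq> d) {c..d} ?\<sigma> =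
    tmult k (wtype K k w (\<lambda>j. j \<noteq> d) {c, d} ?\<sigma>) (wtype K k w (\<lambda>j. j \<noteq> d) {c<..<d} ?\<sigma>)"
    unfolding S by (rule wtype_Un)
  moreover have "wtype K k w (\<lambda>j. j \<noteq> d) {c<..<d} ?\<sigma> = wtype K k w (\<lambda>_. True) {c<..<d} unmarked"
    by (rule wtype_cong) (auto split: if_splits)
  ultimately show ?thesis unfolding pair_type_eq[OF g cd] interior_type_eq[OF g cd] by simp
qed

definition block_type :: "nat \<Rightarrow> nat \<Rightarrow> 'a point \<Rightarrow> 'a wty" where
  "block_type K k p = wtype K k (fst p) (\<lambda>j. j \<noteq> hi (fst p) (snd p)) {lo (fst p) (snd p)..hi (fst p) (snd p)} (unmarked(k := snd p))"

text \<open>A position is an end of its own block or all of it. So the mark never falls into the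
  interior, and the unmarked type of the interior suffices.\<close>

lemma ldefv_block_type:
  assumes S: "ldefv (sentence_type K k :: 'a::finite point \<Rightarrow> 'a wty)"
  shows "ldefv (block_type K k :: 'a point \<Rightarrow> 'a wty)"
proof (rule ldefv_cong)
  let ?B = "\<lambda>m1 m2 p :: 'a point. tmult k (pair_type K k m1 m2 p) (interior_type K k p)"
  let ?s = "\<lambda>p :: 'a point. if matched_call (fst p) (snd p) \<or> matched_ret (fst p) (snd p) then tone k
    else wtype K k (fst p) (\<lambda>_. False) {snd p} (if True then unmarked(k := snd p) else unmarked)"
  let ?f = "\<lambda>p. if matched_call (fst p) (snd p) then ?B True False p
     else if matched_ret (fst p) (snd p) then (case muB p of None \<Rightarrow> tone k | Some c \<Rightarrow> ?B False True c) else ?s p"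
  have "ldefv (?B m1 m2)" for m1 m2 by (rule ldefv_comp2[OF ldefv_pair_type ldefv_interior_type[OF S]])
  thus "ldefv ?f" by (intro ldefv_if ldef_matched_call ldef_matched_ret ldefv_muB ldefv_single)
  fix p :: "'a point" assume "good_point p"
  then obtain w y where p: "p = (w, y)" and g: "good w" "y \<in> univ w" by (cases p) (auto simp: good_point_def)
  show "?f p = block_type K k p"
  proof (rule blk_cases[OF g(1), of y])
    assume "\<not> matched_call w y" "\<not> matched_ret w y" "lo w y = y" "hi w y = y"
    moreover have "wtype K k w (\<lambda>_. False) {y} (unmarked(k := y)) = wtype K k w (\<lambda>j. j \<noteq> y) {y} (unmarked(k := y))"
      by (rule wtype_cong) auto
    ultimately show ?thesis using p by (simp add: block_type_def del: fun_upd_apply)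
  next
    fix d assume "mu w y d" "\<not> matched_ret w y" "lo w y = y" "hi w y = d"
    thus ?thesis using p pair_type_interior_type_eq[OF g(1), of y d k K True False]
      by (auto simp: block_type_def matched_call_def simp del: fun_upd_apply)
  next
    fix c assume "mu w c y" "\<not> matched_call w y" "lo w y = c" "hi w y = y"
    thus ?thesis using p pair_type_interior_type_eq[OF g(1), of c y k K False True] muB_Some[OF g(1), of c y]
      by (auto simp: block_type_def matched_ret_def simp del: fun_upd_apply)
  qed
qed

text \<open>The mark lies in the block, and the context surrounds it unmarked. The sides served only
  to form the product; \<open>set_side\<close> forgets them afterwards.\<close>

lemma unary_type_eq:
  fixes p :: "'a::finite point"
  assumes "good_point p"
  shows "unary_type K k p = set_side True k (tmult k (outside_type K k p) (block_type K k p))"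
proof -
  obtain w y where p: "p = (w, y)" and g: "good w" "y \<in> univ w" using assms by (cases p) (auto simp: good_point_def)
  let ?I = "{lo w y..hi w y}"
  \<comment> \<open>Context and block come with different notions of side, which are glued together
    along the partition of the word.\<close>
  let ?sd = "\<lambda>j. if j \<in> ?I then j \<noteq> hi w y else j < y"
  let ?\<sigma> = "unmarked(k := y)"
  have lh: "lo w y \<le> y" "y \<le> hi w y" using lo_hi[OF g(1)] by auto
  have U: "univ w = outside w y \<union> ?I" using blk_univ[OF g] by (auto simp: outside_def[OF g(1)])
  have nz: "0 \<notin> univ w" using zero_notin[OF g(1)] .
  have "splits w ?sd (outside w y) ?I"
  proof -
    have "?sd i \<longleftrightarrow> i < lo w y" if "i \<in> outside w y" for i using that lh by (auto simp: outside_def[OF g(1)])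
    thus ?thesis using splits_blk[OF g(1), of y] unfolding splits_def by simp
  qed
  hence "wtype K k w ?sd (univ w) ?\<sigma> = tmult k (wtype K k w ?sd (outside w y) ?\<sigma>) (wtype K k w ?sd ?I ?\<sigma>)"
    unfolding U using nz U by (intro wtype_Un) auto
  also have "wtype K k w ?sd (outside w y) ?\<sigma> = outside_type K k p"
    unfolding outside_type_def p fst_conv snd_conv
  proof (rule wtype_cong)
    have o: "0 \<notin> outside w y" "y \<notin> outside w y" using nz lh by (auto simp: outside_def[OF g(1)])
    show "unmarked m = ?\<sigma> m" if "?\<sigma> m \<in> outside w y \<or> unmarked m \<in> outside w y" for m using that o by (cases "m = k") auto
    show "i < y \<longleftrightarrow> ?sd i" if "i \<in> outside w y" for i using that by (auto simp: outside_def[OF g(1)])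
  qed
  also have "wtype K k w ?sd ?I ?\<sigma> = block_type K k p"
    unfolding block_type_def p fst_conv snd_conv by (intro wtype_cong) auto
  finally show ?thesis unfolding unary_type_def p fst_conv snd_conv wtype_set_side[of K k w True "univ w" ?\<sigma> ?sd] by (rule arg_cong)
qed

lemma ldefv_unary_type:
  assumes S: "ldefv (sentence_type K k :: 'a::finite point \<Rightarrow> 'a wty)"
  shows "ldefv (unary_type K k :: 'a point \<Rightarrow> 'a wty)"
  using ldefv_comp2[OF ldefv_outside_type[OF S] ldefv_block_type[OF S], of "\<lambda>x y. set_side True k (tmult k x y)"]
  by (rule ldefv_cong[rotated]) (simp add: unary_type_eq)

text \<open>Whether a marked type of rank \<open>k\<close> occurs anywhere in the word is asked by
  linear until and since from the current position, so the set of occurring types is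
  definable.\<close>

lemma ldefv_sentence_type: "ldefv (sentence_type K k :: 'a::finite point \<Rightarrow> 'a wty)"
proof (induction k)
  case 0
  have "ldefv (\<lambda>_ :: 'a point. tone 0 :: 'a wty)" by (rule ldefv_const)
  thus ?case
    by (rule ldefv_cong[rotated]) (auto simp: sentence_type_def good_point_def wtype_zero simp del: wtype.simps tone.simps)
next
  case (Suc k)
  let ?U = "unary_type K k :: 'a point \<Rightarrow> 'a wty" and ?M = "wtypes K k :: 'a wty set"
  let ?S = "\<lambda>p :: 'a point. (\<lambda>b. ?U (fst p, b)) ` univ (fst p)"
  have U: "ldefv ?U" by (rule ldefv_unary_type[OF Suc])
  have m: "ldef (\<lambda>p. v \<in> ?S p)" for v
  proof -
    have "ldef (\<lambda>p. ?U p = v)" using U by (rule ldefvE) blast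
    from ldef_Ex_univ[OF this] show ?thesis by (rule ldef_cong[rotated]) auto
  qed
  have sub: "?S p \<subseteq> ?M" for p by (auto simp: unary_type_def wtype_wtypes)
  hence e: "?S p = X \<longleftrightarrow> X \<subseteq> ?M \<and> (\<forall>v\<in>?M. v \<in> ?S p \<longleftrightarrow> v \<in> X)" for p X by blast
  have Sd: "ldefv ?S"
  proof (rule ldefvI)
    show "finite (Pow ?M)" by (simp add: finite_wtypes)
    show "?S p \<in> Pow ?M" for p using sub by blast
    fix X
    have "ldef (\<lambda>p. (v \<in> ?S p) = (v \<in> X))" for v using m[of v] ldef_Not[OF m[of v]] by (cases "v \<in> X") simp_all
    thus "ldef (\<lambda>p. ?S p = X)" unfolding e by (intro ldef_conj ldef_Ball ldef_const finite_wtypes)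
  qed
  have "sentence_type K (Suc k) p = node (sentence_type K k p) (?S p)" for p :: "'a point"
    by (simp add: sentence_type_def unary_type_def)
  thus ?case using ldefv_comp2[OF Suc Sd, of node] by presburger
qed

text \<open>By \<open>fo_sat_wtype\<close> truth is a function of the unary type, so the formula
  holds exactly at the points whose type lies in a fixed finite set.\<close>

theorem fo_to_ltl:
  fixes \<psi> :: "'a::finite fo"
  assumes fv: "fo_fv \<psi> \<subseteq> {x}"
  shows "\<exists>\<psi>'. \<forall>(w :: 'a nword) i \<sigma>. good w \<and> i \<in> univ w \<longrightarrow> (fo_sat \<psi> w (\<sigma>(x := i)) \<longleftrightarrow> ltl_sat \<psi>' w i)"
proof -
  \<comment> \<open>The marks below the quantifier rank serve the quantifiers, and the mark
    \<open>qrank \<psi>\<close> stands for the free variable, so the bound \<open>K\<close> is one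
    larger.\<close>
  let ?k = "qrank \<psi>" and ?K = "Suc (qrank \<psi>)"
  let ?U = "unary_type ?K ?k :: 'a point \<Rightarrow> 'a wty"
  let ?s = "\<lambda>p :: 'a point. fo_sat \<psi> (fst p) (unmarked(?k := snd p) \<circ> (\<lambda>_. ?k))"
  have "ldef (\<lambda>p. ?U p \<in> {?U p | p. good_point p \<and> ?s p})"
    by (rule ldefv_mem[OF ldefv_unary_type[OF ldefv_sentence_type]])
  hence "ldef ?s"
  proof (rule ldef_cong_good_point[rotated])
    fix p :: "'a point" assume p: "good_point p"
    have "?s q = ?s p" if "good_point q" "?U q = ?U p" for q
      using that p by (intro fo_sat_wtype[where k = ?k and K = ?K]) (auto simp: unary_type_def good_point_def)
    thus "(?U p \<in> {?U p | p. good_point p \<and> ?s p}) = ?s p" using p unfolding mem_Collect_eq by metis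
  qed
  then obtain \<psi>' where \<psi>': "\<And>w i. good w \<Longrightarrow> i \<in> univ w \<Longrightarrow> ?s (w, i) \<longleftrightarrow> ltl_sat \<psi>' w i" by (rule ldefE) blast
  have "fo_sat \<psi> w (\<sigma>(x := i)) = ?s (w, i)" for w i \<sigma>
    unfolding fst_conv snd_conv by (rule fo_sat_cong) (use fv in auto)
  thus ?thesis using \<psi>' by (intro exI[of _ \<psi>']) simp
qed

section \<open>From the temporal logic to first-order logic\<close>

definition reachable :: "'a nword \<Rightarrow> path_kind \<Rightarrow> nat \<Rightarrow> nat \<Rightarrow> bool" where
  "reachable w K = (ustep w K)\<^sup>*\<^sup>*"

lemma reachable_le: "good w \<Longrightarrow> reachable w K i j \<Longrightarrow> i \<le> j"
  unfolding reachable_def by (rotate_tac, induction rule: rtranclp_induct) (use ustep_less in fastforce)+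

text \<open>Call paths branch forwards, as one call encloses many positions; backwards all three
  kinds are deterministic.\<close>

lemma ustep_inj: "good w \<Longrightarrow> ustep w K i j \<Longrightarrow> ustep w K i' j \<Longrightarrow> i = i'"
  using det_linB det_absB det_parS unfolding det_def ustep_def by (cases K) blast+

lemma reachable_last:
  assumes g: "good w" and k: "reachable w K k j" "k \<noteq> j" and y: "ustep w K y j"
  shows "reachable w K k y"
proof -
  obtain y' where "(ustep w K)\<^sup>*\<^sup>* k y'" "ustep w K y' j"
    using k unfolding reachable_def by (metis rtranclp.cases)
  thus ?thesis using ustep_inj[OF g y] by (simp add: reachable_def)
qed

lemma until_reachable:
  assumes g: "good w" and i: "i \<in> univ w"
  shows "ltl_sat (Until K \<phi> \<psi>) w i \<longleftrightarrow>
    (\<exists>j. reachable w K i j \<and> ltl_sat \<psi> w j \<and> (\<forall>k. reachable w K i k \<longrightarrow> reachable w K k j \<longrightarrow> k \<noteq> j \<longrightarrow> ltl_sat \<phi> w k))"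
proof -
  let ?R = "\<lambda>a b. ustep w K a b \<and> ltl_sat \<phi> w a"
  have 1: "?R\<^sup>*\<^sup>* i j \<Longrightarrow> reachable w K i j \<and> (\<forall>k. reachable w K i k \<longrightarrow> reachable w K k j \<longrightarrow> k \<noteq> j \<longrightarrow> ltl_sat \<phi> w k)" for j
  proof (induction rule: rtranclp_induct)
    case base
    have "k = i" if "reachable w K i k" "reachable w K k i" for k
      using reachable_le[OF g that(1)] reachable_le[OF g that(2)] by simp
    then show ?case by (auto simp: reachable_def)
  next
    case (step y z)
    have "reachable w K i z" using step unfolding reachable_def by (meson rtranclp.rtrancl_into_rtrancl)
    moreover have "ltl_sat \<phi> w k" if "reachable w K i k" "reachable w K k z" "k \<noteq> z" for k
      using reachable_last[OF g that(2,3)] step that by (cases "k = y") auto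
    ultimately show ?case by blast
  qed
  have 2: "(ustep w K)\<^sup>*\<^sup>* i j \<Longrightarrow> (\<forall>k. reachable w K i k \<longrightarrow> reachable w K k j \<longrightarrow> k \<noteq> j \<longrightarrow> ltl_sat \<phi> w k) \<Longrightarrow> ?R\<^sup>*\<^sup>* i j" for j
  proof (induction rule: rtranclp_induct)
    case (step y z)
    have yz: "y < z" "reachable w K y z" using ustep_less[OF g] step(2) by (auto simp: reachable_def)
    have "ltl_sat \<phi> w k" if "reachable w K i k" "reachable w K k y" for k
    proof -
      have "reachable w K k z" "k \<noteq> z" using that yz reachable_le[OF g that(2)] unfolding reachable_def by (auto intro: rtranclp_trans)
      thus ?thesis using step.prems that by blast
    qed
    moreover have "reachable w K i y" "reachable w K y y" using step(1) by (auto simp: reachable_def)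
    ultimately show ?case using step by (auto intro: rtranclp.rtrancl_into_rtrancl)
  qed simp
  show ?thesis unfolding until_iff[OF assms] using 1 2 unfolding reachable_def by blast
qed

lemma since_reachable:
  assumes g: "good w" and i: "i \<in> univ w"
  shows "ltl_sat (Since K \<phi> \<psi>) w i \<longleftrightarrow>
    (\<exists>j. reachable w K j i \<and> ltl_sat \<psi> w j \<and> (\<forall>k. reachable w K j k \<longrightarrow> reachable w K k i \<longrightarrow> k \<noteq> j \<longrightarrow> ltl_sat \<phi> w k))"
proof -
  let ?R = "\<lambda>a b. ustep w K a b \<and> ltl_sat \<phi> w b"
  have 1: "?R\<^sup>*\<^sup>* j i \<Longrightarrow> reachable w K j i \<and> (\<forall>k. reachable w K j k \<longrightarrow> reachable w K k i \<longrightarrow> k \<noteq> j \<longrightarrow> ltl_sat \<phi> w k)" for i j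
  proof (induction rule: rtranclp_induct)
    case base
    have "k = j" if "reachable w K j k" "reachable w K k j" for k
      using reachable_le[OF g that(1)] reachable_le[OF g that(2)] by simp
    then show ?case by (auto simp: reachable_def)
  next
    case (step y z)
    have "reachable w K j z" using step unfolding reachable_def by (meson rtranclp.rtrancl_into_rtrancl)
    moreover have "ltl_sat \<phi> w k" if "reachable w K j k" "reachable w K k z" "k \<noteq> j" for k
      using reachable_last[OF g that(2)] step that by (cases "k = z") auto
    ultimately show ?case by blast
  qed
  have 2: "(ustep w K)\<^sup>*\<^sup>* j i \<Longrightarrow> (\<forall>k. reachable w K j k \<longrightarrow> reachable w K k i \<longrightarrow> k \<noteq> j \<longrightarrow> ltl_sat \<phi> w k) \<Longrightarrow> ?R\<^sup>*\<^sup>* j i" for i j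
  proof (induction rule: rtranclp_induct)
    case (step y z)
    have yz: "y < z" "reachable w K y z" using ustep_less[OF g] step(2) by (auto simp: reachable_def)
    have jy: "reachable w K j y" "reachable w K j z" "reachable w K z z" using step(1,2) by (auto simp: reachable_def)
    have "reachable w K k z" if "reachable w K k y" for k using that yz(2) unfolding reachable_def by (rule rtranclp_trans)
    hence "?R\<^sup>*\<^sup>* j y" using step.IH step.prems by blast
    moreover have "ltl_sat \<phi> w z" using step.prems jy reachable_le[OF g jy(1)] yz by auto
    ultimately show ?case using step(2) by (auto intro: rtranclp.rtrancl_into_rtrancl)
  qed simp
  show ?thesis unfolding since_iff[OF assms] using 1 2 unfolding reachable_def by blast
qed

lemma reachable_Linear:
  assumes g: "good w" and u: "i \<in> univ w" "j \<in> univ w"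
  shows "reachable w Linear i j \<longleftrightarrow> i \<le> j"
proof
  assume "i \<le> j"
  thus "reachable w Linear i j" using u(2)
  proof (induction rule: dec_induct)
    case (step n)
    have "n \<in> univ w" using univ_convex[OF g u(1) step.prems, of n] step.hyps by simp
    hence "ustep w Linear n (Suc n)" using step.prems by (simp add: ustep_def path_step.simps)
    thus ?case using step.IH[OF \<open>n \<in> univ w\<close>] unfolding reachable_def by (rule_tac rtranclp.rtrancl_into_rtrancl)
  qed (simp add: reachable_def)
qed (rule reachable_le[OF g])

text \<open>The calls enclosing \<open>j\<close> form a chain under nesting, and the path runs
  through this chain inwards without omitting any of them.\<close>

lemma reachable_CallPath:
  assumes g: "good w" and u: "j \<in> univ w"
  shows "reachable w CallPath i j \<longleftrightarrow> i = j \<or> (\<exists>d. encloses w i d j)"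
proof
  assume "reachable w CallPath i j"
  thus "i = j \<or> (\<exists>d. encloses w i d j)"
    unfolding reachable_def
  proof (induction rule: rtranclp_induct)
    case (step y z)
    then obtain d where d: "encloses w y d z" by (auto simp: ustep_def path_step.simps enclosing_call_iff[OF g])
    from step.IH show ?case
    proof (elim disjE exE)
      fix d' assume d': "encloses w i d' y"
      hence "d < d'" using nest[OF g, of i d' y d] d by (auto simp: encloses_def)
      thus ?thesis using d d' by (auto simp: encloses_def)
    qed (use d in blast)
  qed simp
next
  assume "i = j \<or> (\<exists>d. encloses w i d j)"
  thus "reachable w CallPath i j" using u
  proof (induction j rule: less_induct)
    case (less j)
    show ?case
    proof (cases "i = j")
      case False
      then obtain d where d: "encloses w i d j" using less by blast
      then obtain c d' where c: "encloses w c d' j" "\<And>c' d''. encloses w c' d'' j \<Longrightarrow> c' \<le> c" using par_exists[OF g d] by metis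
      have cu: "c \<in> univ w" "c < j" using c(1) mu_univ[OF g, of c d'] by (auto simp: encloses_def)
      have s: "ustep w CallPath c j"
        using c cu less.prems by (auto simp: ustep_def path_step.simps enclosing_call_iff[OF g])
      have "i = c \<or> encloses w i d c" using c(2)[OF d] d cu by (auto simp: encloses_def)
      hence "reachable w CallPath i c" using less.IH[OF cu(2)] cu by blast
      thus ?thesis using s unfolding reachable_def by (rule_tac rtranclp.rtrancl_into_rtrancl)
    qed (simp add: reachable_def)
  qed
qed

text \<open>A path jumps over the blocks it meets, so it cannot end strictly inside one; it never
  steps onto the return of a pair around it; and it cannot continue from an unmatched call. These
  obstructions are the only ones, because under them the last step into \<open>j\<close> can be
  traced back.\<close>

lemma reachable_Abstract:
  assumes g: "good w" and u: "i \<in> univ w" "j \<in> univ w"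
  shows "reachable w Abstract i j \<longleftrightarrow> i \<le> j \<and>
    (\<forall>c d. mu w c d \<longrightarrow> \<not> (i \<le> c \<and> c < j \<and> j < d) \<and> \<not> (c < i \<and> i < d \<and> d \<le> j)) \<and>
    (\<forall>k. i \<le> k \<and> k < j \<longrightarrow> call w k \<longrightarrow> matched_call w k)" (is "_ \<longleftrightarrow> ?C j")
proof
  assume "reachable w Abstract i j"
  thus "?C j" unfolding reachable_def
  proof (induction rule: rtranclp_induct)
    case (step y j)
    have iy: "i \<le> y" using step.IH by simp
    have IH1: "\<not> (i \<le> c \<and> c < y \<and> y < d)" and IH2: "\<not> (c < i \<and> i < d \<and> d \<le> y)" if "mu w c d" for c d
      using step.IH that by blast+
    have IH3: "matched_call w k" if "i \<le> k" "k < y" "call w k" for k using step.IH that by blast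
    from step(2) have "mu w y j \<or> \<not> call w y \<and> \<not> matched_ret w (y + 1) \<and> j = y + 1"
      unfolding ustep_def abstract_step[OF g] by blast
    thus ?case
    proof
      assume m: "mu w y j"
      note um = mu_univ[OF g m]
      have "\<not> (i \<le> c \<and> c < j \<and> j < d)" if "mu w c d" for c d
        using IH1[OF that] mu_fun[OF g m, of d] that nest[OF g m that] um by (metis linorder_neqE_nat less_trans not_less_iff_gr_or_eq)
      moreover have "\<not> (c < i \<and> i < d \<and> d \<le> j)" if "mu w c d" for c d
        using IH2[OF that] block_closed[OF g m that] iy um by auto
      moreover have "matched_call w k" if "i \<le> k" "k < j" "call w k" for k
      proof (cases k y rule: linorder_cases)
        case equal thus ?thesis using m by (auto simp: matched_call_def)
      next
        case greater thus ?thesis using inside_call[OF g, of y j k] m that by (simp add: encloses_def)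
      qed (use IH3 that in simp)
      ultimately show ?thesis using iy um by auto
    next
      assume m: "\<not> call w y \<and> \<not> matched_ret w (y + 1) \<and> j = y + 1"
      have nc: "c \<noteq> y" "d \<noteq> j" if "mu w c d" for c d
        using m that mu_univ[OF g that] by (auto simp: matched_ret_def)
      have "\<not> (i \<le> c \<and> c < j \<and> j < d)" if "mu w c d" for c d using IH1[OF that] nc[OF that] m by auto
      moreover have "\<not> (c < i \<and> i < d \<and> d \<le> j)" if "mu w c d" for c d using IH2[OF that] nc[OF that] m by auto
      moreover have "matched_call w k" if "i \<le> k" "k < j" "call w k" for k
        using IH3[OF that(1) _ that(3)] m that by (auto simp: less_Suc_eq)
      ultimately show ?thesis using iy m by auto
    qed
  qed (auto dest: mu_univ[OF g])
next
  assume "?C j"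
  thus "reachable w Abstract i j" using u(2)
  proof (induction j rule: less_induct)
    case (less j)
    have C1: "\<not> (i \<le> c \<and> c < j \<and> j < d)" and C2: "\<not> (c < i \<and> i < d \<and> d \<le> j)" if "mu w c d" for c d
      using less.prems that by blast+
    have C3: "matched_call w k" if "i \<le> k" "k < j" "call w k" for k using less.prems that by blast
    show ?case
    proof (cases "i = j")
      case False
      hence ij: "i < j" using less.prems by simp
      \<comment> \<open>A matched return is entered from its call. Any other \<open>j\<close> is
        entered from \<open>j - 1\<close>, which is no call: its return would lie behind
        \<open>j\<close>, so that \<open>j\<close> would be inside its block.\<close>
      have "\<exists>y. ustep w Abstract y j \<and> i \<le> y \<and> (\<forall>c d. mu w c d \<longrightarrow> \<not> (i \<le> c \<and> c < y \<and> y < d))"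
      proof (cases "matched_ret w j")
        case True
        then obtain y where y: "mu w y j" by (auto simp: matched_ret_def)
        have iy: "i \<le> y" using C2[OF y] ij by auto
        have "\<not> (i \<le> c \<and> c < y \<and> y < d)" if "mu w c d" for c d
          using C1[OF that] nest[OF g that y] mu_univ[OF g y] by auto
        thus ?thesis using y iy mu_univ[OF g y] by (auto simp: ustep_def abstract_step[OF g])
      next
        case nr: False
        obtain y where y: "j = y + 1" using ij by (cases j) auto
        have yu: "y \<in> univ w" using univ_convex[OF g u(1) less.prems(2), of y] ij y by simp
        have nc: "\<not> call w y"
        proof
          assume "call w y"
          then obtain d where d: "mu w y d" using C3[of y] ij y by (auto simp: matched_call_def)
          have "d \<noteq> j" using nr d by (auto simp: matched_ret_def)
          hence "j < d" using mu_univ[OF g d] y by linarith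
          thus False using C1[OF d] y ij by simp
        qed
        have "\<not> (i \<le> c \<and> c < y \<and> y < d)" if "mu w c d" for c d
          using C1[OF that] nr that y by (auto simp: matched_ret_def) (metis Suc_lessI)
        thus ?thesis using y yu nc nr less.prems ij by (intro exI[of _ y]) (auto simp: ustep_def abstract_step[OF g])
      qed
      then obtain y where y: "ustep w Abstract y j" "i \<le> y" "\<forall>c d. mu w c d \<longrightarrow> \<not> (i \<le> c \<and> c < y \<and> y < d)" by blast
      have yj: "y < j" "y \<in> univ w" using ustep_less[OF g y(1)] y(1) by (auto simp: ustep_def)
      have "reachable w Abstract i y"
        using y(2,3) C2 C3 yj by (intro less.IH) (auto, (meson le_trans less_imp_le)+)
      thus ?thesis using y(1) unfolding reachable_def by (rule_tac rtranclp.rtrancl_into_rtrancl)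
    qed (simp add: reachable_def)
  qed
qed

section \<open>First-order definable relations between positions\<close>

definition fdef :: "nat set \<Rightarrow> ('a nword \<Rightarrow> (nat \<Rightarrow> nat) \<Rightarrow> bool) \<Rightarrow> bool" where
  "fdef V P \<longleftrightarrow> (\<exists>\<psi>. fo_fv \<psi> \<subseteq> V \<and> (\<forall>w \<sigma>. good w \<longrightarrow> \<sigma> ` V \<subseteq> univ w \<longrightarrow> (P w \<sigma> \<longleftrightarrow> fo_sat \<psi> w \<sigma>)))"

lemma fdefI: "fo_fv \<psi> \<subseteq> V \<Longrightarrow> (\<And>w \<sigma>. good w \<Longrightarrow> \<sigma> ` V \<subseteq> univ w \<Longrightarrow> P w \<sigma> \<longleftrightarrow> fo_sat \<psi> w \<sigma>) \<Longrightarrow> fdef V P"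
  unfolding fdef_def by blast

lemma fdefE:
  assumes "fdef V P"
  obtains \<psi> where "fo_fv \<psi> \<subseteq> V" "\<And>w \<sigma>. good w \<Longrightarrow> \<sigma> ` V \<subseteq> univ w \<Longrightarrow> P w \<sigma> \<longleftrightarrow> fo_sat \<psi> w \<sigma>"
  using assms unfolding fdef_def by blast

lemma fdef_cong:
  "(\<And>w \<sigma>. good w \<Longrightarrow> \<sigma> ` V \<subseteq> univ w \<Longrightarrow> P w \<sigma> \<longleftrightarrow> Q w \<sigma>) \<Longrightarrow> fdef V P \<Longrightarrow> fdef V Q"
  unfolding fdef_def by simp

lemma fdef_Not: "fdef V P \<Longrightarrow> fdef V (\<lambda>w \<sigma>. \<not> P w \<sigma>)"
  by (erule fdefE, rule_tac \<psi> = "FNot \<psi>" in fdefI) simp_all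

lemma fdef_disj: "fdef V P \<Longrightarrow> fdef V Q \<Longrightarrow> fdef V (\<lambda>w \<sigma>. P w \<sigma> \<or> Q w \<sigma>)"
  by (elim fdefE, rule_tac \<psi> = "FOr \<psi> \<psi>'" in fdefI) simp_all

lemma fdef_conj: "fdef V P \<Longrightarrow> fdef V Q \<Longrightarrow> fdef V (\<lambda>w \<sigma>. P w \<sigma> \<and> Q w \<sigma>)"
  using fdef_Not[OF fdef_disj[OF fdef_Not fdef_Not]] by force

lemma fdef_imp: "fdef V P \<Longrightarrow> fdef V Q \<Longrightarrow> fdef V (\<lambda>w \<sigma>. P w \<sigma> \<longrightarrow> Q w \<sigma>)"
  unfolding imp_conv_disj by (intro fdef_disj fdef_Not)

lemma fdef_less: "x \<in> V \<Longrightarrow> y \<in> V \<Longrightarrow> fdef V (\<lambda>w \<sigma>. \<sigma> x < \<sigma> y)"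
  and fdef_eq: "x \<in> V \<Longrightarrow> y \<in> V \<Longrightarrow> fdef V (\<lambda>w \<sigma>. \<sigma> x = \<sigma> y)"
  and fdef_mu: "x \<in> V \<Longrightarrow> y \<in> V \<Longrightarrow> fdef V (\<lambda>w \<sigma>. mu w (\<sigma> x) (\<sigma> y))"
  and fdef_call: "x \<in> V \<Longrightarrow> fdef V (\<lambda>w \<sigma>. call w (\<sigma> x))"
  and fdef_ret: "x \<in> V \<Longrightarrow> fdef V (\<lambda>w \<sigma>. ret w (\<sigma> x))"
  and fdef_lab: "x \<in> V \<Longrightarrow> fdef V (\<lambda>w \<sigma>. lab w (\<sigma> x) = a)"
  by (rule fdefI[of "FLess x y"] fdefI[of "FEq x y"] fdefI[of "FMu x y"] fdefI[of "FCall x"] fdefI[of "FRet x"] fdefI[of "FLetter a x"]; simp)+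

lemma fdef_le: "x \<in> V \<Longrightarrow> y \<in> V \<Longrightarrow> fdef V (\<lambda>w \<sigma>. \<sigma> x \<le> \<sigma> y)"
  unfolding le_less by (intro fdef_disj fdef_less fdef_eq)

lemma fdef_ex: "v \<notin> V \<Longrightarrow> fdef (insert v V) P \<Longrightarrow> fdef V (\<lambda>w \<sigma>. \<exists>b\<in>univ w. P w (\<sigma>(v := b)))"
proof (erule fdefE, rule_tac \<psi> = "FEx v \<psi>" in fdefI)
  fix \<psi> :: "'a fo" and w :: "'a nword" and \<sigma> :: "nat \<Rightarrow> nat"
  assume *: "v \<notin> V" "\<And>w \<sigma>. good w \<Longrightarrow> \<sigma> ` insert v V \<subseteq> univ w \<Longrightarrow> P w \<sigma> = fo_sat \<psi> w \<sigma>" "good w" "\<sigma> ` V \<subseteq> univ w"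
  have "P w (\<sigma>(v := b)) = fo_sat \<psi> w (\<sigma>(v := b))" if "b \<in> univ w" for b
    using that *(1,4) by (intro *(2)[OF *(3)]) auto
  thus "(\<exists>b\<in>univ w. P w (\<sigma>(v := b))) = fo_sat (FEx v \<psi>) w \<sigma>" by auto
qed auto

lemma fdef_all: "v \<notin> V \<Longrightarrow> fdef (insert v V) P \<Longrightarrow> fdef V (\<lambda>w \<sigma>. \<forall>b\<in>univ w. P w (\<sigma>(v := b)))"
  using fdef_Not[OF fdef_ex[of v V "\<lambda>w \<sigma>. \<not> P w \<sigma>", OF _ fdef_Not]] by simp

lemma fresh: "finite V \<Longrightarrow> \<exists>v :: nat. v \<notin> V"
  using ex_new_if_finite infinite_UNIV_nat by blast

text \<open>The subword with end points named by the variables \<open>l\<close> and \<open>u\<close>; \<open>None\<close> stands for \<open>\<infinity>\<close>.\<close>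

definition bnd :: "(nat \<Rightarrow> nat) \<Rightarrow> nat option \<Rightarrow> enat" where
  "bnd \<sigma> u = (case u of None \<Rightarrow> \<infinity> | Some y \<Rightarrow> enat (\<sigma> y))"

abbreviation Wd :: "nat \<Rightarrow> nat option \<Rightarrow> 'a nword \<Rightarrow> (nat \<Rightarrow> nat) \<Rightarrow> 'a nword" where
  "Wd l u w \<sigma> \<equiv> subword w (\<sigma> l) (bnd \<sigma> u)"

definition inb :: "nat \<Rightarrow> nat option \<Rightarrow> (nat \<Rightarrow> nat) \<Rightarrow> nat \<Rightarrow> bool" where
  "inb l u \<sigma> b \<longleftrightarrow> \<sigma> l \<le> b \<and> enat b \<le> bnd \<sigma> u"

lemma bnd_upd [simp]: "v \<notin> set_option u \<Longrightarrow> bnd (\<sigma>(v := b)) u = bnd \<sigma> u"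
  by (cases u) (auto simp: bnd_def)

lemma inb_upd [simp]: "v \<notin> set_option u \<Longrightarrow> v \<noteq> l \<Longrightarrow> inb l u (\<sigma>(v := b)) c = inb l u \<sigma> c"
  by (simp add: inb_def)

lemma subword_sel [simp]:
  "univ (subword w a e) = {k \<in> univ w. a \<le> k \<and> enat k \<le> e}"
  "mu (subword w a e) i j \<longleftrightarrow> mu w i j \<and> a \<le> i \<and> enat i \<le> e \<and> a \<le> j \<and> enat j \<le> e"
  "call (subword w a e) i \<longleftrightarrow> call w i \<and> a \<le> i \<and> enat i \<le> e"
  "ret (subword w a e) i \<longleftrightarrow> ret w i \<and> a \<le> i \<and> enat i \<le> e"
  "lab (subword w a e) = lab w"
  by (auto simp: subword_def induced_def)

lemma fdef_inb: "{x, l} \<union> set_option u \<subseteq> V \<Longrightarrow> fdef V (\<lambda>w \<sigma>. inb l u \<sigma> (\<sigma> x))"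
proof (cases u)
  case None
  assume "{x, l} \<union> set_option u \<subseteq> V"
  thus ?thesis using fdef_le[of l V x] None by (simp add: inb_def bnd_def)
next
  case (Some y)
  assume "{x, l} \<union> set_option u \<subseteq> V"
  thus ?thesis using fdef_conj[OF fdef_le[of l V x] fdef_le[of x V y]] Some by (simp add: inb_def bnd_def)
qed

lemma fdef_muW:
  assumes "{x, y, l} \<union> set_option u \<subseteq> V"
  shows "fdef V (\<lambda>w \<sigma>. mu (Wd l u w \<sigma>) (\<sigma> x) (\<sigma> y))"
proof -
  have "fdef V (\<lambda>w \<sigma>. mu w (\<sigma> x) (\<sigma> y) \<and> inb l u \<sigma> (\<sigma> x) \<and> inb l u \<sigma> (\<sigma> y))"
    using assms by (intro fdef_conj fdef_mu fdef_inb) auto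
  thus ?thesis by (rule fdef_cong[rotated]) (auto simp: inb_def)
qed

lemma fdef_mcW:
  assumes "{x, l} \<union> set_option u \<subseteq> V" "finite V"
  shows "fdef V (\<lambda>w \<sigma>. matched_call (Wd l u w \<sigma>) (\<sigma> x))"
proof -
  obtain v where v: "v \<notin> V" using fresh[OF assms(2)] by blast
  have "fdef (insert v V) (\<lambda>w \<sigma>. mu (Wd l u w \<sigma>) (\<sigma> x) (\<sigma> v))" by (rule fdef_muW) (use assms in auto)
  from fdef_ex[OF v this] show ?thesis
  proof (rule fdef_cong[rotated])
    fix w :: "'a nword" and \<sigma> assume "good w"
    show "(\<exists>b\<in>univ w. mu (Wd l u w (\<sigma>(v := b))) ((\<sigma>(v := b)) x) ((\<sigma>(v := b)) v)) = matched_call (Wd l u w \<sigma>) (\<sigma> x)"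
    proof -
      have "v \<noteq> x" "v \<noteq> l" "v \<notin> set_option u" using v assms by auto
      thus ?thesis using mu_univ[OF \<open>good w\<close>] by (auto simp: matched_call_def)
    qed
  qed
qed

text \<open>The conditions for reachability are read inside the subword. Calls and matching edges
  are relativised to the bounds, while the order is inherited.\<close>

lemma fdef_reachable:
  assumes "{x, y, l} \<union> set_option u \<subseteq> V" "finite V"
  shows "fdef V (\<lambda>w \<sigma>. inb l u \<sigma> (\<sigma> x) \<and> inb l u \<sigma> (\<sigma> y) \<and> reachable (Wd l u w \<sigma>) K (\<sigma> x) (\<sigma> y))"
proof -
  have xV: "x \<in> V" "y \<in> V" "l \<in> V" "set_option u \<subseteq> V" using assms by auto
  have in_univ: "\<sigma> x \<in> univ (Wd l u w \<sigma>)" "\<sigma> y \<in> univ (Wd l u w \<sigma>)"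
    if "\<sigma> ` V \<subseteq> univ w" "inb l u \<sigma> (\<sigma> x)" "inb l u \<sigma> (\<sigma> y)" for w :: "'a nword" and \<sigma>
    using that xV by (auto simp: inb_def)
  obtain v where v: "v \<notin> V" using fresh[OF assms(2)] by blast
  obtain v' where v': "v' \<notin> insert v V" using fresh[of "insert v V"] assms(2) by blast
  have ne: "v \<noteq> x" "v \<noteq> y" "v \<noteq> l" "v \<notin> set_option u" "v' \<noteq> x" "v' \<noteq> y" "v' \<noteq> l" "v' \<notin> set_option u" "v' \<noteq> v"
    using v v' xV by auto
  show ?thesis
  proof (cases K)
    case Linear
    have "fdef V (\<lambda>w \<sigma>. inb l u \<sigma> (\<sigma> x) \<and> inb l u \<sigma> (\<sigma> y) \<and> \<sigma> x \<le> \<sigma> y)"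
      using xV by (intro fdef_conj fdef_inb fdef_le) auto
    thus ?thesis unfolding Linear
    proof (rule fdef_cong[rotated])
      fix w :: "'a nword" and \<sigma> assume g: "good w" "\<sigma> ` V \<subseteq> univ w"
      show "(inb l u \<sigma> (\<sigma> x) \<and> inb l u \<sigma> (\<sigma> y) \<and> \<sigma> x \<le> \<sigma> y) =
        (inb l u \<sigma> (\<sigma> x) \<and> inb l u \<sigma> (\<sigma> y) \<and> reachable (Wd l u w \<sigma>) Linear (\<sigma> x) (\<sigma> y))"
        using reachable_Linear[OF good_subword[OF g(1)] in_univ[OF g(2)]] by blast
    qed
  next
    case CallPath
    have "fdef (insert v V) (\<lambda>w \<sigma>. mu (Wd l u w \<sigma>) (\<sigma> x) (\<sigma> v) \<and> \<sigma> x < \<sigma> y \<and> \<sigma> y < \<sigma> v)"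
      using xV by (intro fdef_conj fdef_muW fdef_less) auto
    hence "fdef V (\<lambda>w \<sigma>. \<exists>b\<in>univ w. mu (Wd l u w (\<sigma>(v := b))) ((\<sigma>(v := b)) x) ((\<sigma>(v := b)) v) \<and>
        (\<sigma>(v := b)) x < (\<sigma>(v := b)) y \<and> (\<sigma>(v := b)) y < (\<sigma>(v := b)) v)" by (rule fdef_ex[OF v])
    hence "fdef V (\<lambda>w \<sigma>. inb l u \<sigma> (\<sigma> x) \<and> inb l u \<sigma> (\<sigma> y) \<and> (\<sigma> x = \<sigma> y \<or> (\<exists>b\<in>univ w. mu (Wd l u w (\<sigma>(v := b))) ((\<sigma>(v := b)) x) ((\<sigma>(v := b)) v) \<and>
        (\<sigma>(v := b)) x < (\<sigma>(v := b)) y \<and> (\<sigma>(v := b)) y < (\<sigma>(v := b)) v)))"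
      using xV by (intro fdef_conj fdef_inb fdef_disj fdef_eq) auto
    thus ?thesis unfolding CallPath
    proof (rule fdef_cong[rotated])
      fix w :: "'a nword" and \<sigma> assume g: "good w" "\<sigma> ` V \<subseteq> univ w"
      let ?W = "Wd l u w \<sigma>"
      have "(\<exists>b\<in>univ w. mu ?W (\<sigma> x) b \<and> \<sigma> x < \<sigma> y \<and> \<sigma> y < b) \<longleftrightarrow> (\<exists>d. encloses ?W (\<sigma> x) d (\<sigma> y))"
        using mu_univ[OF g(1)] by (auto simp: encloses_def)
      moreover have "reachable ?W CallPath (\<sigma> x) (\<sigma> y) \<longleftrightarrow> \<sigma> x = \<sigma> y \<or> (\<exists>d. encloses ?W (\<sigma> x) d (\<sigma> y))"
        if "inb l u \<sigma> (\<sigma> x)" "inb l u \<sigma> (\<sigma> y)"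
        by (rule reachable_CallPath[OF good_subword[OF g(1)]]) (use in_univ[OF g(2) that] in simp)
      ultimately show "(inb l u \<sigma> (\<sigma> x) \<and> inb l u \<sigma> (\<sigma> y) \<and> (\<sigma> x = \<sigma> y \<or> (\<exists>b\<in>univ w. mu (Wd l u w (\<sigma>(v := b))) ((\<sigma>(v := b)) x) ((\<sigma>(v := b)) v) \<and>
        (\<sigma>(v := b)) x < (\<sigma>(v := b)) y \<and> (\<sigma>(v := b)) y < (\<sigma>(v := b)) v))) =
        (inb l u \<sigma> (\<sigma> x) \<and> inb l u \<sigma> (\<sigma> y) \<and> reachable ?W CallPath (\<sigma> x) (\<sigma> y))"
        using ne by auto
    qed
  next
    case Abstract
    let ?A = "\<lambda>w \<sigma> c d. mu (Wd l u w \<sigma>) c d \<longrightarrow> \<not> (\<sigma> x \<le> c \<and> c < \<sigma> y \<and> \<sigma> y < d) \<and> \<not> (c < \<sigma> x \<and> \<sigma> x < d \<and> d \<le> \<sigma> y)"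
    let ?B = "\<lambda>w \<sigma> k. \<sigma> x \<le> k \<and> k < \<sigma> y \<longrightarrow> inb l u \<sigma> k \<and> call w k \<longrightarrow> matched_call (Wd l u w \<sigma>) k"
    have "fdef (insert v' (insert v V)) (\<lambda>w \<sigma>. ?A w \<sigma> (\<sigma> v) (\<sigma> v'))"
      using xV by (intro fdef_imp fdef_conj fdef_Not fdef_muW fdef_less fdef_le) auto
    from fdef_all[OF v' this] have "fdef (insert v V) (\<lambda>w \<sigma>. \<forall>b\<in>univ w. ?A w \<sigma> (\<sigma> v) b)" using ne by simp
    from fdef_all[OF v this] have A: "fdef V (\<lambda>w \<sigma>. \<forall>a\<in>univ w. \<forall>b\<in>univ w. ?A w \<sigma> a b)" using ne by simp
    have "fdef (insert v V) (\<lambda>w \<sigma>. ?B w \<sigma> (\<sigma> v))"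
      using xV assms(2) by (intro fdef_imp fdef_conj fdef_less fdef_le fdef_inb fdef_call fdef_mcW) auto
    from fdef_all[OF v this] have B: "fdef V (\<lambda>w \<sigma>. \<forall>k\<in>univ w. ?B w \<sigma> k)" using ne by simp
    have "fdef V (\<lambda>w \<sigma>. inb l u \<sigma> (\<sigma> x) \<and> inb l u \<sigma> (\<sigma> y) \<and> \<sigma> x \<le> \<sigma> y \<and>
       (\<forall>a\<in>univ w. \<forall>b\<in>univ w. ?A w \<sigma> a b) \<and> (\<forall>k\<in>univ w. ?B w \<sigma> k))"
      using xV by (intro fdef_conj fdef_inb fdef_le A B) auto
    thus ?thesis unfolding Abstract
    proof (rule fdef_cong[rotated])
      fix w :: "'a nword" and \<sigma> assume g: "good w" "\<sigma> ` V \<subseteq> univ w"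
      let ?W = "Wd l u w \<sigma>"
      have a: "(\<forall>a\<in>univ w. \<forall>b\<in>univ w. ?A w \<sigma> a b) \<longleftrightarrow> (\<forall>a b. ?A w \<sigma> a b)"
        using mu_univ[OF g(1)] by (auto 0 3)
      have b: "(\<forall>k\<in>univ w. ?B w \<sigma> k) \<longleftrightarrow> (\<forall>k. \<sigma> x \<le> k \<and> k < \<sigma> y \<longrightarrow> call ?W k \<longrightarrow> matched_call ?W k)"
        using call_ret_univ(1)[OF g(1)] by (auto simp: inb_def)
      show "(inb l u \<sigma> (\<sigma> x) \<and> inb l u \<sigma> (\<sigma> y) \<and> \<sigma> x \<le> \<sigma> y \<and>
          (\<forall>a\<in>univ w. \<forall>b\<in>univ w. ?A w \<sigma> a b) \<and> (\<forall>k\<in>univ w. ?B w \<sigma> k)) =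
        (inb l u \<sigma> (\<sigma> x) \<and> inb l u \<sigma> (\<sigma> y) \<and> reachable ?W Abstract (\<sigma> x) (\<sigma> y))"
      proof (cases "inb l u \<sigma> (\<sigma> x) \<and> inb l u \<sigma> (\<sigma> y)")
        case True
        show ?thesis unfolding a b using True
            reachable_Abstract[OF good_subword[OF g(1)] in_univ[OF g(2)]] by blast
      qed blast
    qed
  qed
qed

text \<open>The positions form an interval, so the next position in the order is the number plus
  one.\<close>

lemma fdef_suc:
  assumes "x \<in> V" "y \<in> V" "finite V"
  shows "fdef V (\<lambda>w \<sigma>. \<sigma> y = \<sigma> x + 1)"
proof -
  obtain v where v: "v \<notin> V" using fresh[OF assms(3)] by blast
  have "fdef (insert v V) (\<lambda>w \<sigma>. \<not> (\<sigma> x < \<sigma> v \<and> \<sigma> v < \<sigma> y))" using assms by (intro fdef_Not fdef_conj fdef_less) auto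
  from fdef_conj[OF fdef_less[OF assms(1,2)] fdef_all[OF v this]] show ?thesis
  proof (rule fdef_cong[rotated])
    fix w :: "'a nword" and \<sigma> assume g: "good w" "\<sigma> ` V \<subseteq> univ w"
    have "\<sigma> x + 1 \<in> univ w" if "\<sigma> x < \<sigma> y"
      using univ_convex[OF g(1), of "\<sigma> x" "\<sigma> y" "\<sigma> x + 1"] g(2) that assms by auto
    moreover have "v \<noteq> x" "v \<noteq> y" using v assms by auto
    ultimately show "(\<sigma> x < \<sigma> y \<and> (\<forall>b\<in>univ w. \<not> ((\<sigma>(v := b)) x < (\<sigma>(v := b)) v \<and> (\<sigma>(v := b)) v < (\<sigma>(v := b)) y))) = (\<sigma> y = \<sigma> x + 1)"
      by auto
  qed
qed

section \<open>Bounds of nested within operators\<close>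

lemma subword_subword:
  assumes i: "a \<le> i" and e: "e' \<le> e"
  shows "subword (subword w a e) i e' = subword w i e'"
  using i e by (auto simp: subword_def induced_def fun_eq_iff intro: order.trans)

text \<open>A call whose return lies beyond the bound counts as unmatched in the subword. The within
  operator then reaches to the last position of the subword or to infinity, and either cuts off
  nothing below \<open>e\<close>, so the old bound stays in force.\<close>

lemma subword_within_unmatched:
  assumes g: "good w" and i: "i \<in> univ (subword w a e)" and m: "\<not> matched_call (subword w a e) i"
  shows "subword (subword w a e) i (within_end (subword w a e) i) = subword w i e"
proof -
  let ?W = "subword w a e"
  have le: "enat k \<le> within_end ?W i" if "k \<in> univ w" "a \<le> k" "enat k \<le> e" for k
    using that m Max_ge[of "univ ?W" k] unfolding within_end_def by auto
  have mu': "i \<in> univ w \<and> j \<in> univ w" if "mu w i j" for i j using that mu_univ[OF g] by blast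
  show ?thesis
    using i le mu' call_ret_univ[OF g]
    by (auto simp: subword_def induced_def fun_eq_iff)
qed

definition satW :: "'a ltl \<Rightarrow> nat \<Rightarrow> nat option \<Rightarrow> 'a nword \<Rightarrow> (nat \<Rightarrow> nat) \<Rightarrow> nat \<Rightarrow> bool" where
  "satW \<phi> l u w \<sigma> b \<longleftrightarrow> inb l u \<sigma> b \<and> ltl_sat \<phi> (Wd l u w \<sigma>) b"

lemma satW_upd: "v \<notin> set_option u \<Longrightarrow> v \<noteq> l \<Longrightarrow> satW \<phi> l u w (\<sigma>(v := b)) c = satW \<phi> l u w \<sigma> c"
  by (simp add: satW_def)

lemma reachable_univ: "reachable w K i j \<Longrightarrow> i \<in> univ w \<Longrightarrow> j \<in> univ w"
  unfolding reachable_def by (induction rule: rtranclp_induct) (auto simp: ustep_def)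

lemma reachable_univ': "reachable w K i j \<Longrightarrow> j \<in> univ w \<Longrightarrow> i \<in> univ w"
  unfolding reachable_def by (induction rule: converse_rtranclp_induct) (auto simp: ustep_def)

text \<open>Until and since take the same form once \<open>R\<close> is reachability or its
  converse.\<close>

lemma fdef_path:
  assumes V: "finite V" "{x, l} \<union> set_option u \<subseteq> V"
    and Ru: "\<And>w \<sigma> z b. z \<noteq> l \<Longrightarrow> z \<notin> set_option u \<Longrightarrow> R w (\<sigma>(z := b)) = R w \<sigma>"
    and R: "\<And>V x y. finite V \<Longrightarrow> {x, y, l} \<union> set_option u \<subseteq> V \<Longrightarrow> fdef V (\<lambda>w \<sigma>. R w \<sigma> (\<sigma> x) (\<sigma> y))"
    and P: "\<And>V x l u. finite V \<Longrightarrow> {x, l} \<union> set_option u \<subseteq> V \<Longrightarrow> fdef V (\<lambda>w \<sigma>. satW \<phi> l u w \<sigma> (\<sigma> x))"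
    and Q: "\<And>V x l u. finite V \<Longrightarrow> {x, l} \<union> set_option u \<subseteq> V \<Longrightarrow> fdef V (\<lambda>w \<sigma>. satW \<psi> l u w \<sigma> (\<sigma> x))"
  shows "fdef V (\<lambda>w \<sigma>. \<exists>b\<in>univ w. R w \<sigma> (\<sigma> x) b \<and> satW \<psi> l u w \<sigma> b \<and>
      (\<forall>k\<in>univ w. R w \<sigma> (\<sigma> x) k \<longrightarrow> R w \<sigma> k b \<longrightarrow> k \<noteq> b \<longrightarrow> satW \<phi> l u w \<sigma> k))"
proof -
  obtain v where v: "v \<notin> V" using fresh[OF V(1)] by blast
  obtain v' where v': "v' \<notin> insert v V" using fresh[of "insert v V"] V by blast
  have ne: "v \<noteq> x" "v \<noteq> l" "v \<notin> set_option u" "v' \<noteq> x" "v' \<noteq> l" "v' \<notin> set_option u" "v' \<noteq> v" using v v' V by auto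
  have "fdef (insert v' (insert v V)) (\<lambda>w \<sigma>. R w \<sigma> (\<sigma> x) (\<sigma> v') \<longrightarrow> R w \<sigma> (\<sigma> v') (\<sigma> v) \<longrightarrow> \<not> \<sigma> v' = \<sigma> v \<longrightarrow> satW \<phi> l u w \<sigma> (\<sigma> v'))"
    using V by (intro fdef_imp fdef_Not fdef_eq R P) auto
  from fdef_all[OF v' this]
  have "fdef (insert v V) (\<lambda>w \<sigma>. \<forall>k\<in>univ w. R w \<sigma> (\<sigma> x) k \<longrightarrow> R w \<sigma> k (\<sigma> v) \<longrightarrow> \<not> k = \<sigma> v \<longrightarrow> satW \<phi> l u w \<sigma> k)"
    using ne by (simp add: Ru satW_upd)
  hence "fdef (insert v V) (\<lambda>w \<sigma>. R w \<sigma> (\<sigma> x) (\<sigma> v) \<and> satW \<psi> l u w \<sigma> (\<sigma> v) \<and>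
      (\<forall>k\<in>univ w. R w \<sigma> (\<sigma> x) k \<longrightarrow> R w \<sigma> k (\<sigma> v) \<longrightarrow> \<not> k = \<sigma> v \<longrightarrow> satW \<phi> l u w \<sigma> k))"
    using V by (intro fdef_conj R Q) auto
  from fdef_ex[OF v this] show ?thesis using ne by (simp add: Ru satW_upd)
qed

text \<open>The bounds are variables of the formula under construction, which makes the induction
  strong enough for \<open>Within\<close>: its argument is translated with \<open>x\<close> as the
  left bound, and with the matching return or the old right bound as the right one.\<close>

lemma fdef_satW:
  "finite V \<Longrightarrow> {x, l} \<union> set_option u \<subseteq> V \<Longrightarrow> fdef V (\<lambda>w \<sigma>. satW \<phi> l u w \<sigma> (\<sigma> x))"
proof (induction \<phi> arbitrary: V x l u)
  case TT
  have "fdef V (\<lambda>w \<sigma>. inb l u \<sigma> (\<sigma> x))" by (rule fdef_inb[OF TT(2)])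
  then show ?case by (simp add: satW_def)
next
  case (Letter a)
  have "fdef V (\<lambda>w \<sigma>. inb l u \<sigma> (\<sigma> x) \<and> lab w (\<sigma> x) = a)"
    using Letter by (intro fdef_conj fdef_inb fdef_lab) auto
  then show ?case by (simp add: satW_def)
next
  case IsCall
  have "fdef V (\<lambda>w \<sigma>. inb l u \<sigma> (\<sigma> x) \<and> call w (\<sigma> x))"
    using IsCall by (intro fdef_conj fdef_inb fdef_call) auto
  then show ?case by (rule fdef_cong[rotated]) (auto simp: satW_def inb_def)
next
  case IsRet
  have "fdef V (\<lambda>w \<sigma>. inb l u \<sigma> (\<sigma> x) \<and> ret w (\<sigma> x))"
    using IsRet by (intro fdef_conj fdef_inb fdef_ret) auto
  then show ?case by (rule fdef_cong[rotated]) (auto simp: satW_def inb_def)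
next
  case (Not \<phi>)
  \<comment> \<open>\<open>satW\<close> includes the bounds on the position, which negation would
    destroy, so they are imposed again.\<close>
  have "fdef V (\<lambda>w \<sigma>. inb l u \<sigma> (\<sigma> x) \<and> \<not> satW \<phi> l u w \<sigma> (\<sigma> x))"
    using Not by (intro fdef_conj fdef_inb fdef_Not) auto
  then show ?case by (rule fdef_cong[rotated]) (auto simp: satW_def)
next
  case (Or \<phi> \<psi>)
  from fdef_disj[OF Or.IH(1)[OF Or.prems] Or.IH(2)[OF Or.prems]]
  show ?case by (rule fdef_cong[rotated]) (auto simp: satW_def)
next
  case (Next \<phi>)
  obtain v where v: "v \<notin> V" using fresh[OF Next.prems(1)] by blast
  have ne: "v \<noteq> x" "v \<noteq> l" "v \<notin> set_option u" using v Next.prems by auto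
  have "fdef (insert v V) (\<lambda>w \<sigma>. \<sigma> v = \<sigma> x + 1 \<and> satW \<phi> l u w \<sigma> (\<sigma> v))"
    using Next.prems by (intro fdef_conj fdef_suc Next.IH) auto
  from fdef_conj[OF fdef_inb[OF Next.prems(2)] fdef_ex[OF v this]]
  show ?case by (rule fdef_cong[rotated]) (use ne in \<open>auto simp: satW_def inb_def\<close>)
next
  case (Prev \<phi>)
  obtain v where v: "v \<notin> V" using fresh[OF Prev.prems(1)] by blast
  have ne: "v \<noteq> x" "v \<noteq> l" "v \<notin> set_option u" using v Prev.prems by auto
  have "fdef (insert v V) (\<lambda>w \<sigma>. \<sigma> x = \<sigma> v + 1 \<and> satW \<phi> l u w \<sigma> (\<sigma> v))"
    using Prev.prems by (intro fdef_conj fdef_suc Prev.IH) auto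
  from fdef_conj[OF fdef_inb[OF Prev.prems(2)] fdef_ex[OF v this]]
  show ?case by (rule fdef_cong[rotated]) (use ne in \<open>auto simp: satW_def inb_def\<close>)
next
  case (NextMu \<phi>)
  obtain v where v: "v \<notin> V" using fresh[OF NextMu.prems(1)] by blast
  have ne: "v \<noteq> x" "v \<noteq> l" "v \<notin> set_option u" using v NextMu.prems by auto
  have "fdef (insert v V) (\<lambda>w \<sigma>. mu (Wd l u w \<sigma>) (\<sigma> x) (\<sigma> v) \<and> satW \<phi> l u w \<sigma> (\<sigma> v))"
    using NextMu.prems by (intro fdef_conj fdef_muW NextMu.IH) auto
  from fdef_ex[OF v this]
  show ?case
  proof (rule fdef_cong[rotated])
    fix w :: "'a nword" and \<sigma> assume g: "good w" "\<sigma> ` V \<subseteq> univ w"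
    let ?W = "Wd l u w \<sigma>"
    have "ret_of ?W (\<sigma> x) = b" if "mu ?W (\<sigma> x) b" for b by (rule ret_of_eq[OF good_subword[OF g(1)] that])
    moreover have "b \<in> univ w \<and> inb l u \<sigma> b \<and> inb l u \<sigma> (\<sigma> x)" if "mu ?W (\<sigma> x) b" for b
      using that mu_univ[OF g(1)] by (auto simp: inb_def)
    ultimately have "(\<exists>b\<in>univ w. mu ?W (\<sigma> x) b \<and> satW \<phi> l u w \<sigma> b) = satW (NextMu \<phi>) l u w \<sigma> (\<sigma> x)"
      by (auto simp: satW_def matched_call_def simp del: subword_sel)
    thus "(\<exists>b\<in>univ w. mu (Wd l u w (\<sigma>(v := b))) ((\<sigma>(v := b)) x) ((\<sigma>(v := b)) v) \<and> satW \<phi> l u w (\<sigma>(v := b)) ((\<sigma>(v := b)) v)) =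
      satW (NextMu \<phi>) l u w \<sigma> (\<sigma> x)" using ne by (simp add: satW_upd del: subword_sel)
  qed
next
  case (PrevMu \<phi>)
  obtain v where v: "v \<notin> V" using fresh[OF PrevMu.prems(1)] by blast
  have ne: "v \<noteq> x" "v \<noteq> l" "v \<notin> set_option u" using v PrevMu.prems by auto
  have "fdef (insert v V) (\<lambda>w \<sigma>. mu (Wd l u w \<sigma>) (\<sigma> v) (\<sigma> x) \<and> satW \<phi> l u w \<sigma> (\<sigma> v))"
    using PrevMu.prems by (intro fdef_conj fdef_muW PrevMu.IH) auto
  from fdef_ex[OF v this]
  show ?case
  proof (rule fdef_cong[rotated])
    fix w :: "'a nword" and \<sigma> assume g: "good w" "\<sigma> ` V \<subseteq> univ w"
    let ?W = "Wd l u w \<sigma>"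
    have "b \<in> univ w \<and> inb l u \<sigma> b \<and> inb l u \<sigma> (\<sigma> x)" if "mu ?W b (\<sigma> x)" for b
      using that mu_univ[OF g(1)] by (auto simp: inb_def)
    hence "(\<exists>b\<in>univ w. mu ?W b (\<sigma> x) \<and> satW \<phi> l u w \<sigma> b) = satW (PrevMu \<phi>) l u w \<sigma> (\<sigma> x)"
      by (auto simp: satW_def simp del: subword_sel)
    thus "(\<exists>b\<in>univ w. mu (Wd l u w (\<sigma>(v := b))) ((\<sigma>(v := b)) v) ((\<sigma>(v := b)) x) \<and> satW \<phi> l u w (\<sigma>(v := b)) ((\<sigma>(v := b)) v)) =
      satW (PrevMu \<phi>) l u w \<sigma> (\<sigma> x)" using ne by (simp add: satW_upd del: subword_sel)
  qed
next
  case (Until K \<phi> \<psi>)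
  define R where "R = (\<lambda>(w :: 'a nword) \<sigma> a b. inb l u \<sigma> a \<and> inb l u \<sigma> b \<and> reachable (Wd l u w \<sigma>) K a b)"
  have "fdef V (\<lambda>w \<sigma>. \<exists>b\<in>univ w. R w \<sigma> (\<sigma> x) b \<and> satW \<psi> l u w \<sigma> b \<and>
      (\<forall>k\<in>univ w. R w \<sigma> (\<sigma> x) k \<longrightarrow> R w \<sigma> k b \<longrightarrow> k \<noteq> b \<longrightarrow> satW \<phi> l u w \<sigma> k))"
  proof (rule fdef_path[OF Until.prems _ _ Until.IH])
    show "R w (\<sigma>(z := b)) = R w \<sigma>" if "z \<noteq> l" "z \<notin> set_option u" for w \<sigma> z b
      using that by (intro ext) (simp add: R_def)
    show "fdef V (\<lambda>w \<sigma>. R w \<sigma> (\<sigma> x) (\<sigma> y))" if "finite V" "{x, y, l} \<union> set_option u \<subseteq> V" for V x y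
      using that(2,1) unfolding R_def by (rule fdef_reachable)
  qed
  thus ?case
  proof (rule fdef_cong[rotated])
    fix w :: "'a nword" and \<sigma> assume g: "good w" "\<sigma> ` V \<subseteq> univ w"
    let ?W = "Wd l u w \<sigma>"
    have iu: "b \<in> univ ?W \<longleftrightarrow> b \<in> univ w \<and> inb l u \<sigma> b" for b by (auto simp: inb_def)
    show "(\<exists>b\<in>univ w. R w \<sigma> (\<sigma> x) b \<and> satW \<psi> l u w \<sigma> b \<and>
      (\<forall>k\<in>univ w. R w \<sigma> (\<sigma> x) k \<longrightarrow> R w \<sigma> k b \<longrightarrow> k \<noteq> b \<longrightarrow> satW \<phi> l u w \<sigma> k)) = satW (Until K \<phi> \<psi>) l u w \<sigma> (\<sigma> x)"
    proof (cases "inb l u \<sigma> (\<sigma> x)")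
      case True
      have xu: "\<sigma> x \<in> univ ?W" using True g(2) Until.prems iu by auto
      have ru: "reachable ?W K (\<sigma> x) b \<Longrightarrow> b \<in> univ w \<and> inb l u \<sigma> b" for b using reachable_univ[OF _ xu] iu by blast
      have "satW (Until K \<phi> \<psi>) l u w \<sigma> (\<sigma> x) \<longleftrightarrow> ltl_sat (Until K \<phi> \<psi>) ?W (\<sigma> x)" using True by (simp add: satW_def)
      thus ?thesis unfolding until_reachable[OF good_subword[OF g(1)] xu] R_def satW_def using ru True by blast
    qed (auto simp: satW_def R_def)
  qed
next
  case (Since K \<phi> \<psi>)
  define R where "R = (\<lambda>(w :: 'a nword) \<sigma> a b. inb l u \<sigma> a \<and> inb l u \<sigma> b \<and> reachable (Wd l u w \<sigma>) K b a)"
  have "fdef V (\<lambda>w \<sigma>. \<exists>b\<in>univ w. R w \<sigma> (\<sigma> x) b \<and> satW \<psi> l u w \<sigma> b \<and>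
      (\<forall>k\<in>univ w. R w \<sigma> (\<sigma> x) k \<longrightarrow> R w \<sigma> k b \<longrightarrow> k \<noteq> b \<longrightarrow> satW \<phi> l u w \<sigma> k))"
  proof (rule fdef_path[OF Since.prems _ _ Since.IH])
    show "R w (\<sigma>(z := b)) = R w \<sigma>" if "z \<noteq> l" "z \<notin> set_option u" for w \<sigma> z b
      using that by (intro ext) (simp add: R_def)
    show "fdef V (\<lambda>w \<sigma>. R w \<sigma> (\<sigma> x) (\<sigma> y))" if "finite V" "{x, y, l} \<union> set_option u \<subseteq> V" for V x y
      using that using fdef_reachable[of y x l u V K] unfolding R_def by (simp add: insert_commute conj_ac)
  qed
  thus ?case
  proof (rule fdef_cong[rotated])
    fix w :: "'a nword" and \<sigma> assume g: "good w" "\<sigma> ` V \<subseteq> univ w"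
    let ?W = "Wd l u w \<sigma>"
    have iu: "b \<in> univ ?W \<longleftrightarrow> b \<in> univ w \<and> inb l u \<sigma> b" for b by (auto simp: inb_def)
    show "(\<exists>b\<in>univ w. R w \<sigma> (\<sigma> x) b \<and> satW \<psi> l u w \<sigma> b \<and>
      (\<forall>k\<in>univ w. R w \<sigma> (\<sigma> x) k \<longrightarrow> R w \<sigma> k b \<longrightarrow> k \<noteq> b \<longrightarrow> satW \<phi> l u w \<sigma> k)) = satW (Since K \<phi> \<psi>) l u w \<sigma> (\<sigma> x)"
    proof (cases "inb l u \<sigma> (\<sigma> x)")
      case True
      have xu: "\<sigma> x \<in> univ ?W" using True g(2) Since.prems iu by auto
      have ru: "reachable ?W K b (\<sigma> x) \<Longrightarrow> b \<in> univ w \<and> inb l u \<sigma> b" for b using reachable_univ'[OF _ xu] iu by blast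
      have "satW (Since K \<phi> \<psi>) l u w \<sigma> (\<sigma> x) \<longleftrightarrow> ltl_sat (Since K \<phi> \<psi>) ?W (\<sigma> x)" using True by (simp add: satW_def)
      thus ?thesis unfolding since_reachable[OF good_subword[OF g(1)] xu] R_def satW_def using ru True by blast
    qed (auto simp: satW_def R_def)
  qed
next
  case (Within \<phi>)
  obtain v where v: "v \<notin> V" using fresh[OF Within.prems(1)] by blast
  have ne: "v \<noteq> x" "v \<noteq> l" "v \<notin> set_option u" using v Within.prems by auto
  have "fdef (insert v V) (\<lambda>w \<sigma>. mu (Wd l u w \<sigma>) (\<sigma> x) (\<sigma> v) \<and> satW \<phi> x (Some v) w \<sigma> (\<sigma> x))"
    using Within.prems by (intro fdef_conj fdef_muW Within.IH) auto
  from fdef_ex[OF v this]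
  have 1: "fdef V (\<lambda>w \<sigma>. \<exists>b\<in>univ w. mu (Wd l u w \<sigma>) (\<sigma> x) b \<and> satW \<phi> x (Some v) w (\<sigma>(v := b)) (\<sigma> x))"
    using ne by (simp del: subword_sel)
  have "fdef V (\<lambda>w \<sigma>. (inb l u \<sigma> (\<sigma> x) \<and> call w (\<sigma> x)) \<and>
     ((\<exists>b\<in>univ w. mu (Wd l u w \<sigma>) (\<sigma> x) b \<and> satW \<phi> x (Some v) w (\<sigma>(v := b)) (\<sigma> x)) \<or>
      \<not> matched_call (Wd l u w \<sigma>) (\<sigma> x) \<and> satW \<phi> x u w \<sigma> (\<sigma> x)))"
    using Within.prems by (intro fdef_conj fdef_disj fdef_inb fdef_call 1 fdef_Not fdef_mcW Within.IH) auto
  thus ?case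
  proof (rule fdef_cong[rotated])
    fix w :: "'a nword" and \<sigma> assume g: "good w" "\<sigma> ` V \<subseteq> univ w"
    let ?W = "Wd l u w \<sigma>"
    note gW = good_subword[OF g(1), of "\<sigma> l" "bnd \<sigma> u"]
    have xw: "\<sigma> x \<in> univ w" using g(2) Within.prems by auto
    show "((inb l u \<sigma> (\<sigma> x) \<and> call w (\<sigma> x)) \<and>
     ((\<exists>b\<in>univ w. mu (Wd l u w \<sigma>) (\<sigma> x) b \<and> satW \<phi> x (Some v) w (\<sigma>(v := b)) (\<sigma> x)) \<or>
      \<not> matched_call (Wd l u w \<sigma>) (\<sigma> x) \<and> satW \<phi> x u w \<sigma> (\<sigma> x))) = satW (Within \<phi>) l u w \<sigma> (\<sigma> x)"
    proof (cases "inb l u \<sigma> (\<sigma> x) \<and> call w (\<sigma> x)")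
      case True
      have c: "call ?W (\<sigma> x)" using True by (simp add: inb_def)
      have xu: "\<sigma> x \<in> univ ?W" using True xw by (simp add: inb_def)
      have S: "satW (Within \<phi>) l u w \<sigma> (\<sigma> x) \<longleftrightarrow> ltl_sat \<phi> (subword ?W (\<sigma> x) (within_end ?W (\<sigma> x))) (\<sigma> x)"
        using True c by (simp add: satW_def del: subword_sel)
      show ?thesis
      proof (cases "matched_call ?W (\<sigma> x)")
        case False
        hence "\<nexists>b. mu ?W (\<sigma> x) b" by (simp add: matched_call_def del: subword_sel)
        thus ?thesis using True False S subword_within_unmatched[OF g(1) xu False]
          by (auto simp: satW_def inb_def simp del: subword_sel)
      next
        case mc: True
        then obtain d where d: "mu ?W (\<sigma> x) d" by (auto simp: matched_call_def simp del: subword_sel)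
        have we: "within_end ?W (\<sigma> x) = enat d" using mc ret_of_eq[OF gW d] by (simp add: within_end_def)
        have du: "d \<in> univ w" "enat d \<le> bnd \<sigma> u" "\<sigma> x \<le> d" using d mu_univ[OF g(1), of "\<sigma> x" d] by auto
        have "subword ?W (\<sigma> x) (enat d) = subword w (\<sigma> x) (enat d)"
          by (rule subword_subword) (use True du(2) in \<open>simp_all add: inb_def\<close>)
        hence "satW (Within \<phi>) l u w \<sigma> (\<sigma> x) \<longleftrightarrow> ltl_sat \<phi> (subword w (\<sigma> x) (enat d)) (\<sigma> x)" using S we by simp
        moreover have "mu ?W (\<sigma> x) b \<longleftrightarrow> b = d" for b using d mu_fun[OF gW d] by blast
        moreover have "satW \<phi> x (Some v) w (\<sigma>(v := d)) (\<sigma> x) \<longleftrightarrow> ltl_sat \<phi> (subword w (\<sigma> x) (enat d)) (\<sigma> x)"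
          using du ne by (simp add: satW_def inb_def bnd_def)
        ultimately show ?thesis using True mc du(1) by (auto simp del: subword_sel)
      qed
    next
      case False
      thus ?thesis by (auto simp: satW_def inb_def)
    qed
  qed
qed

theorem ltl_to_fo:
  fixes \<phi> :: "'a ltl"
  shows "\<exists>\<phi>'. fo_fv \<phi>' \<subseteq> {x} \<and> (\<forall>(w :: 'a nword) i \<sigma>. nested_word w \<and> i \<in> univ w \<longrightarrow>
    (ltl_sat \<phi> w i \<longleftrightarrow> fo_sat \<phi>' w (\<sigma>(x := i))))"
proof -
  obtain v where v: "v \<notin> {x}" using fresh[of "{x}"] by blast
  obtain v' where v': "v' \<notin> {v, x}" using fresh[of "{v, x}"] by blast
  \<comment> \<open>Only \<open>x\<close> may remain free, so the left bound is a quantified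
    variable that is forced to be the least position. With infinity as right bound the subword is
    then the whole word.\<close>
  have "fdef {v', v, x} (\<lambda>(w :: 'a nword) \<sigma>. \<not> \<sigma> v' < \<sigma> v)" by (intro fdef_Not fdef_less) auto
  from fdef_conj[OF fdef_all[OF v' this] fdef_satW[of "{v, x}" x v None \<phi>]]
  have "fdef {v, x} (\<lambda>(w :: 'a nword) \<sigma>. (\<forall>b\<in>univ w. \<not> b < \<sigma> v) \<and> satW \<phi> v None w \<sigma> (\<sigma> x))"
    using v' by auto
  from fdef_ex[OF v this]
  obtain \<phi>' where f: "fo_fv \<phi>' \<subseteq> {x}" and \<phi>': "\<And>w \<sigma>. good w \<Longrightarrow> \<sigma> ` {x} \<subseteq> univ w \<Longrightarrow>
    (\<exists>b\<in>univ w. (\<forall>c\<in>univ w. \<not> c < (\<sigma>(v := b)) v) \<and> satW \<phi> v None w (\<sigma>(v := b)) ((\<sigma>(v := b)) x)) = fo_sat \<phi>' w \<sigma>"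
    by (rule fdefE) blast
  have "ltl_sat \<phi> w i \<longleftrightarrow> fo_sat \<phi>' w (\<sigma>(x := i))" if w: "nested_word w" "i \<in> univ w" for w i \<sigma>
  proof -
    have g: "good w" by (rule good_nested_word[OF w(1)])
    have "(\<exists>n. univ w = {1..n}) \<or> univ w = {1..}"
      using w(1) unfolding nested_word_def finite_nested_word_def nested_omega_word_def by blast
    hence u: "1 \<in> univ w" "univ w \<subseteq> {1..}" using w(2) by (elim disjE exE; simp)+
    have s: "subword w 1 \<infinity> = w"
    proof -
      have ge: "1 \<le> i" if "i \<in> univ w" for i using u that by auto
      have "univ w \<inter> {k. 1 \<le> k} = univ w" using ge by blast
      moreover have "(mu w i j \<and> 1 \<le> i \<and> 1 \<le> j) = mu w i j" "(call w i \<and> 1 \<le> i) = call w i"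
        "(ret w i \<and> 1 \<le> i) = ret w i" for i j
        using mu_univ[OF g, of i j] call_ret_univ[OF g, of i] ge by blast+
      ultimately show ?thesis
        by (intro nword.equality) (simp_all add: subword_def induced_def)
    qed
    have m: "(b \<in> univ w \<and> (\<forall>c\<in>univ w. \<not> c < b)) \<longleftrightarrow> b = 1" for b
    proof
      assume "b \<in> univ w \<and> (\<forall>c\<in>univ w. \<not> c < b)"
      hence "\<not> 1 < b" "1 \<le> b" using u by auto
      thus "b = 1" by simp
    next
      assume "b = 1"
      moreover have "\<not> c < 1" if "c \<in> univ w" for c using that u by auto
      ultimately show "b \<in> univ w \<and> (\<forall>c\<in>univ w. \<not> c < b)" using u(1) by blast
    qed
    have "fo_sat \<phi>' w (\<sigma>(x := i)) \<longleftrightarrow> (\<exists>b. (b \<in> univ w \<and> (\<forall>c\<in>univ w. \<not> c < b)) \<and> satW \<phi> v None w (\<sigma>(x := i, v := b)) i)"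
      using \<phi>'[OF g, of "\<sigma>(x := i)"] w(2) v by auto
    also have "\<dots> \<longleftrightarrow> satW \<phi> v None w (\<sigma>(x := i, v := 1)) i" unfolding m by simp
    also have "\<dots> \<longleftrightarrow> ltl_sat \<phi> w i" using s u w(2) by (auto simp: satW_def inb_def bnd_def)
    finally show ?thesis by blast
  qed
  thus ?thesis using f by blast
qed

theorem theorem4p12:
  "(\<forall>(\<phi> :: 'a::finite ltl) x. \<exists>\<phi>' :: 'a fo. fo_fv \<phi>' \<subseteq> {x} \<and>
      (\<forall>(w :: 'a nword) i \<sigma>. nested_word w \<and> i \<in> univ w \<longrightarrow>
         (ltl_sat \<phi> w i \<longleftrightarrow> fo_sat \<phi>' w (\<sigma>(x := i))))) \<and>
   (\<forall>(\<psi> :: 'a fo) x. fo_fv \<psi> \<subseteq> {x} \<longrightarrow>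
      (\<exists>\<psi>' :: 'a ltl. \<forall>(w :: 'a nword) i \<sigma>. nested_word w \<and> i \<in> univ w \<longrightarrow>
         (fo_sat \<psi> w (\<sigma>(x := i)) \<longleftrightarrow> ltl_sat \<psi>' w i)))"
proof (intro conjI allI impI)
  show "\<exists>\<phi>' :: 'a fo. fo_fv \<phi>' \<subseteq> {x} \<and> (\<forall>(w :: 'a nword) i \<sigma>. nested_word w \<and> i \<in> univ w \<longrightarrow>
     (ltl_sat \<phi> w i \<longleftrightarrow> fo_sat \<phi>' w (\<sigma>(x := i))))" for \<phi> x
    by (rule ltl_to_fo)
  show "\<exists>\<psi>' :: 'a ltl. \<forall>(w :: 'a nword) i \<sigma>. nested_word w \<and> i \<in> univ w \<longrightarrow>
     (fo_sat \<psi> w (\<sigma>(x := i)) \<longleftrightarrow> ltl_sat \<psi>' w i)" if "fo_fv \<psi> \<subseteq> {x}" for \<psi> x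
    using fo_to_ltl[OF that] good_nested_word by blast
qed

end
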